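(* Let $D$ be a two-dimensional regular local ring with quotient field $F$. If $X$ is a set of two-dimensional regular local overrings of $D$ that are pairwise incomparable with respect to inclusion, then the intersection of the rings in $X$ is irredundant.
   Context: An overring of $D$ is a ring $R$ with $D \subseteq R \subseteq F$. For a nonempty set $X$ of two-dimensional regular local overrings of $D$, the intersection $A$ of the rings in $X$ is irredundant if no ring in $X$ can be omitted from the representation of $A$ as an intersection of the rings in $X$; that is, for each $\alpha \in X$, the intersection of the rings in $X \setminus \{\alpha\}$ properly contains $A$ (the empty intersection being $F$). *)

theory Defs
  imports "HOL-Algebra.Algebra" "HOL-Library.Extended_Nat"
begin

definition krull_dim :: "('a, 'b) ring_scheme \<Rightarrow> enat" where
  "krull_dim R = Sup {enat n | n. \<exists>P :: nat \<Rightarrow> 'a set.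
     (\<forall>i\<le>n. primeideal (P i) R) \<and> (\<forall>i<n. P i \<subset> P (Suc i))}"

definition local_ring :: "('a, 'b) ring_scheme \<Rightarrow> bool" where
  "local_ring R \<longleftrightarrow> cring R \<and> (\<exists>!M. maximalideal M R)"

text \<open>A Noetherian local ring is regular if its maximal ideal can be generated by as many
  elements as the Krull dimension; the maximal ideal in question is the unique one of
  \<^const>\<open>local_ring\<close>.\<close>

definition regular_local_ring :: "('a, 'b) ring_scheme \<Rightarrow> bool" where
  "regular_local_ring R \<longleftrightarrow> local_ring R \<and> noetherian_ring R \<and>
     (\<exists>S \<subseteq> carrier R. finite S \<and> enat (card S) = krull_dim R \<and> maximalideal (Idl\<^bsub>R\<^esub> S) R)"

text \<open>All rings are subrings of one ambient field \<open>F\<close> and are given by their carrier sets; the ring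
  structure on a subset \<open>R\<close> of \<open>F\<close> is \<open>F\<lparr>carrier := R\<rparr>\<close>.\<close>

definition two_dim_regular_local_subring :: "'a set \<Rightarrow> ('a, 'b) ring_scheme \<Rightarrow> bool" where
  "two_dim_regular_local_subring R F \<longleftrightarrow> subring R F \<and>
     regular_local_ring (F\<lparr>carrier := R\<rparr>) \<and> krull_dim (F\<lparr>carrier := R\<rparr>) = 2"

definition quotient_field_of :: "('a, 'b) ring_scheme \<Rightarrow> 'a set \<Rightarrow> bool" where
  "quotient_field_of F D \<longleftrightarrow> field F \<and> subring D F \<and>
     (\<forall>x \<in> carrier F. \<exists>a \<in> D. \<exists>b \<in> D - {\<zero>\<^bsub>F\<^esub>}. x = a \<otimes>\<^bsub>F\<^esub> inv\<^bsub>F\<^esub> b)"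

definition overring :: "('a, 'b) ring_scheme \<Rightarrow> 'a set \<Rightarrow> 'a set \<Rightarrow> bool" where
  "overring F D R \<longleftrightarrow> subring R F \<and> D \<subseteq> R"

text \<open>Intersecting with \<^term>\<open>carrier F\<close> makes the empty intersection equal to \<open>F\<close>.\<close>

definition ring_Inter :: "('a, 'b) ring_scheme \<Rightarrow> 'a set set \<Rightarrow> 'a set" where
  "ring_Inter F \<R> = carrier F \<inter> \<Inter>\<R>"

definition irredundant_Inter :: "('a, 'b) ring_scheme \<Rightarrow> 'a set set \<Rightarrow> bool" where
  "irredundant_Inter F \<R> \<longleftrightarrow> (\<forall>R \<in> \<R>. ring_Inter F \<R> \<subset> ring_Inter F (\<R> - {R}))"

end

theory Submission
  imports Defs
begin

text \<open>
  Let \<open>B\<close> be a ring of the family. To see that \<open>B\<close> cannot be omitted, one needs an element of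
  \<open>F\<close> that is not in \<open>B\<close> but is in all other rings of the family. There is even an element
  outside \<open>B\<close> that lies in every two-dimensional regular local overring of \<open>D\<close> incomparable with
  \<open>B\<close> (\<open>element_separating_incomparable_overrings\<close>).

  These overrings form a tree. If \<open>S\<close> is one of them, different from \<open>D\<close>, then the maximal ideal
  of \<open>D\<close> becomes principal in \<open>S\<close> (\<open>surface_overring_comparable\<close>), so that \<open>S\<close> has a centre on
  the blow-up of the closed point of \<open>D\<close> and contains the local ring \<open>T\<close> of that centre. This
  quadratic transform \<open>T\<close> of \<open>D\<close> is again a ring of the same kind (\<open>surface_T\<close>), and finitely
  many steps lead from \<open>D\<close> to \<open>B\<close>. The rings incomparable with \<open>B\<close> are exactly those that branch
  off from this chain of quadratic transforms before \<open>B\<close>.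

  The required element is a fraction \<open>h/g\<close>. Geometrically, \<open>g\<close> is the equation of a curve on \<open>D\<close>
  whose strict transform meets each exceptional curve on the way from \<open>D\<close> to \<open>B\<close> only at the
  centre of \<open>B\<close>. At a ring that branches off, \<open>g\<close> therefore generates a power of the ideal of
  the exceptional curve, and it divides every \<open>h\<close> that vanishes there to the same order. Such
  pairs, called separators below, are constructed by induction backwards along the chain. For
  \<open>D = B\<close> there is nothing to do. In the step from \<open>T\<close> to \<open>D\<close> (\<open>separator_descend\<close>) the task is
  to find a curve on \<open>D\<close> whose strict transform at \<open>T\<close> is close to a given curve \<open>g\<close>. Let \<open>x, y\<close>
  be generators of the maximal ideal of \<open>D\<close> such that \<open>t = y/x\<close> is in \<open>T\<close>. If \<open>g\<close> is not
  divisible by \<open>x\<close>, then \<open>T/(g)\<close> is generated, up to high powers of \<open>x\<close>, by the powers of \<open>t\<close>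
  below a certain exponent \<open>K\<close>; the relation that expresses \<open>t\<^sup>K\<close> is a Weierstrass polynomial:
  it is monic of degree \<open>K\<close>, and it is \<open>g\<close> up to a unit and terms of high order
  (\<open>weierstrass_polynomial\<close>). Multiplied by \<open>x\<^sup>K\<close> it becomes a form of degree \<open>K\<close> in \<open>x\<close> and
  \<open>y\<close>, hence an element of \<open>D\<close>, and its leading form vanishes only at the centre of \<open>B\<close>. Terms
  of high order do no harm, because in the rings that branch off \<open>g\<close> divides a power of the
  maximal ideal (\<open>separator_perturb\<close>).

  Regularity enters through the properties collected in \<open>surface\<close>: two generators of the maximal
  ideal, the impossibility of generating it by one element up to radical, separatedness, and
  fractions in lowest terms. They are derived from the definition in
  \<open>surface_if_two_dim_regular\<close> and are inherited by \<open>T\<close>.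
\<close>

section \<open>Binary forms and the ideals of a local ring\<close>

context ring
begin

text \<open>
  Coefficient lists take the place of polynomial rings: \<open>form x y cs\<close> is homogeneous in \<open>x\<close> and
  \<open>y\<close>, of degree one less than the length of \<open>cs\<close>, and \<open>form t \<one> cs\<close> is the value at \<open>t\<close> of the
  polynomial with coefficients \<open>cs\<close>, the constant term first.
\<close>
primrec form :: "'a \<Rightarrow> 'a \<Rightarrow> 'a list \<Rightarrow> 'a" where
  "form x y [] = \<zero>"
| "form x y (c # cs) = c \<otimes> y [^] length cs \<oplus> x \<otimes> form x y cs"

text \<open>
  The last argument counts coefficients, so the degree is one less. If the ideal \<open>m\<close> of \<open>A\<close> is
  generated by \<open>x\<close> and \<open>y\<close>, then \<open>forms A x y (Suc k)\<close> is \<open>m\<^sup>k\<close>, and taking the coefficients in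
  \<open>m\<close> gives \<open>m\<^sup>k\<^sup>+\<^sup>1\<close>.
\<close>
definition forms :: "'a set \<Rightarrow> 'a \<Rightarrow> 'a \<Rightarrow> nat \<Rightarrow> 'a set" where
  "forms A x y k = {form x y cs | cs. length cs = k \<and> set cs \<subseteq> A}"

definition nonunits :: "'a set \<Rightarrow> 'a set" where
  "nonunits A = {a \<in> A. \<forall>b\<in>A. a \<otimes> b \<noteq> \<one>}"

definition lin :: "'a set \<Rightarrow> 'a \<Rightarrow> 'a \<Rightarrow> 'a set" where
  "lin A a b = {a \<otimes> r \<oplus> b \<otimes> s | r s. r \<in> A \<and> s \<in> A}"

definition mults :: "'a set \<Rightarrow> 'a \<Rightarrow> 'a set" where
  "mults A a = {a \<otimes> r | r. r \<in> A}"

text \<open>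
  The radical of \<open>(a, b)\<close> contains the maximal ideal. In a two-dimensional factorial local ring
  this says that \<open>a\<close> and \<open>b\<close> have no common prime factor, that is, that \<open>a/b\<close> is in lowest
  terms.
\<close>
definition primary_pair :: "'a set \<Rightarrow> 'a \<Rightarrow> 'a \<Rightarrow> bool" where
  "primary_pair A a b \<longleftrightarrow> (\<forall>c\<in>nonunits A. \<exists>n::nat. c [^] n \<in> lin A a b)"

text \<open>
  The conclusion of Krull's intersection theorem. It speaks of all pairs of nonunits, so that it
  passes from a local ring to every local ring that it dominates.
\<close>
definition adically_separated :: "'a set \<Rightarrow> bool" where
  "adically_separated A \<longleftrightarrow> (\<forall>x\<in>nonunits A. \<forall>y\<in>nonunits A. \<forall>a\<in>A. (\<forall>k. a \<in> forms A x y (Suc k)) \<longrightarrow> a = \<zero>)"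

text \<open>
  By Krull's principal ideal theorem, a Noetherian local ring has dimension at least two iff its
  maximal ideal is not the radical of a principal ideal.
\<close>
definition dim_at_least_two :: "'a set \<Rightarrow> bool" where
  "dim_at_least_two A \<longleftrightarrow> (\<forall>b\<in>nonunits A. \<exists>c\<in>nonunits A. \<forall>n::nat. c [^] n \<notin> mults A b)"

text \<open>
  The properties of a two-dimensional regular local ring with quotient field \<open>R\<close> that carry the
  proof. Each of them is passed on by a direct argument to the quadratic transforms below.
\<close>
definition surface :: "'a set \<Rightarrow> bool" where
  "surface A \<longleftrightarrow> subring A R \<and> (\<exists>x\<in>A. \<exists>y\<in>A. nonunits A = lin A x y) \<and>
     dim_at_least_two A \<and> adically_separated A \<and>
     (\<forall>z\<in>carrier R. \<exists>a\<in>A. \<exists>b\<in>A. b \<noteq> \<zero> \<and> z \<otimes> b = a \<and> primary_pair A a b)"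

end

context cring
begin

lemma subring_closed:
  assumes "subring A R"
  shows "a \<in> A \<Longrightarrow> a \<in> carrier R" "\<zero> \<in> A" "\<one> \<in> A"
    "a \<in> A \<Longrightarrow> b \<in> A \<Longrightarrow> a \<otimes> b \<in> A" "a \<in> A \<Longrightarrow> b \<in> A \<Longrightarrow> a \<oplus> b \<in> A"
    "a \<in> A \<Longrightarrow> \<ominus> a \<in> A" "a \<in> A \<Longrightarrow> b \<in> A \<Longrightarrow> a \<ominus> b \<in> A"
    "a \<in> A \<Longrightarrow> a [^] (n::nat) \<in> A"
proof -
  show "a \<in> A \<Longrightarrow> a [^] (n::nat) \<in> A"
    by (induction n) (use subringE[OF assms] in auto)
qed (use subringE[OF assms] in \<open>auto simp: a_minus_def\<close>)

lemma form_closed [simp]: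
  "\<lbrakk>x \<in> carrier R; y \<in> carrier R; set cs \<subseteq> carrier R\<rbrakk> \<Longrightarrow> form x y cs \<in> carrier R"
  by (induction cs) auto

lemma form_in:
  assumes "subring A R" "x \<in> A" "y \<in> A" "set cs \<subseteq> A"
  shows "form x y cs \<in> A"
  using assms(4) by (induction cs) (auto simp: subring_closed[OF assms(1)] assms)

lemma form_append:
  assumes x: "x \<in> carrier R" and y: "y \<in> carrier R" and "set cs \<subseteq> carrier R" and ds: "set ds \<subseteq> carrier R"
  shows "form x y (cs @ ds) = y [^] length ds \<otimes> form x y cs \<oplus> x [^] length cs \<otimes> form x y ds"
  using assms(3)
proof (induction cs)
  case Nil
  then show ?case using assms by simp
next
  case (Cons c cs)
  define f where "f = form x y cs"
  define g where "g = form x y ds"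
  define p where "p = y [^] length ds"
  define q where "q = y [^] length cs"
  define r where "r = x [^] length cs"
  have cl [simp]: "c \<in> carrier R" "f \<in> carrier R" "g \<in> carrier R" "p \<in> carrier R" "q \<in> carrier R" "r \<in> carrier R"
    using Cons.prems assms by (auto simp: f_def g_def p_def q_def r_def)
  have 1: "y [^] (length cs + length ds) = q \<otimes> p"
    using y by (simp add: q_def p_def nat_pow_mult)
  have 2: "x [^] Suc (length cs) = r \<otimes> x"
    using x by (simp add: r_def)
  have IH: "form x y (cs @ ds) = p \<otimes> f \<oplus> r \<otimes> g"
    using Cons by (simp add: f_def g_def p_def r_def)
  have "form x y ((c # cs) @ ds) = c \<otimes> (q \<otimes> p) \<oplus> x \<otimes> (p \<otimes> f \<oplus> r \<otimes> g)"
    using 1 IH by simp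
  also have "\<dots> = p \<otimes> (c \<otimes> q \<oplus> x \<otimes> f) \<oplus> (r \<otimes> x) \<otimes> g"
    using cl assms(1-3) by algebra
  finally show ?case
    using 2 by (simp add: f_def g_def p_def q_def)
qed

lemma form_snoc:
  assumes "x \<in> carrier R" "y \<in> carrier R" "set cs \<subseteq> carrier R" "c \<in> carrier R"
  shows "form x y (cs @ [c]) = y \<otimes> form x y cs \<oplus> x [^] length cs \<otimes> c"
  using assms by (simp add: form_append)

text \<open>
  Homogeneity. The extra factor \<open>d\<close> on the left makes the exponent the length of the list rather
  than the degree, which covers the empty list.
\<close>
lemma form_scale:
  assumes d: "d \<in> carrier R" and x: "x \<in> carrier R" and y: "y \<in> carrier R" and "set cs \<subseteq> carrier R"
  shows "d \<otimes> form (d \<otimes> x) (d \<otimes> y) cs = d [^] length cs \<otimes> form x y cs"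
  using assms(4)
proof (induction cs)
  case (Cons c cs)
  define f where "f = form x y cs"
  define F where "F = form (d \<otimes> x) (d \<otimes> y) cs"
  define p where "p = y [^] length cs"
  define q where "q = d [^] length cs"
  have cl [simp]: "c \<in> carrier R" "f \<in> carrier R" "F \<in> carrier R" "p \<in> carrier R" "q \<in> carrier R"
    using Cons.prems assms by (auto simp: f_def p_def q_def F_def)
  have IH: "d \<otimes> F = q \<otimes> f"
    using Cons by (simp add: f_def F_def q_def)
  have "d \<otimes> form (d \<otimes> x) (d \<otimes> y) (c # cs) = d \<otimes> (c \<otimes> (q \<otimes> p) \<oplus> d \<otimes> x \<otimes> F)"
    using d y by (simp add: p_def q_def F_def nat_pow_distrib)
  also have "\<dots> = d \<otimes> (c \<otimes> (q \<otimes> p) \<oplus> x \<otimes> (d \<otimes> F))"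
    using cl assms(1-3) by algebra
  also have "\<dots> = (q \<otimes> d) \<otimes> (c \<otimes> p \<oplus> x \<otimes> f)"
    unfolding IH using cl assms(1-3) by algebra
  finally show ?case
    by (simp add: f_def p_def q_def)
qed (use assms in simp)

lemma form_smult:
  assumes a: "a \<in> carrier R" and x: "x \<in> carrier R" and y: "y \<in> carrier R" and "set cs \<subseteq> carrier R"
  shows "form x y (map ((\<otimes>) a) cs) = a \<otimes> form x y cs"
  using assms(4)
proof (induction cs)
  case (Cons c cs)
  define f where "f = form x y cs"
  define p where "p = y [^] length cs"
  have cl [simp]: "c \<in> carrier R" "f \<in> carrier R" "p \<in> carrier R" 
    using Cons.prems assms by (auto simp: f_def p_def)
  have "a \<otimes> c \<otimes> p \<oplus> x \<otimes> (a \<otimes> f) = a \<otimes> (c \<otimes> p \<oplus> x \<otimes> f)"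
    using cl assms(1-3) by algebra
  then show ?case using Cons by (simp add: f_def p_def)
qed (use assms in simp)

lemma form_add:
  assumes x: "x \<in> carrier R" and y: "y \<in> carrier R" and "length cs = length ds"
    and "set cs \<subseteq> carrier R" "set ds \<subseteq> carrier R"
  shows "form x y (map2 (\<oplus>) cs ds) = form x y cs \<oplus> form x y ds"
  using assms(3-)
proof (induction rule: list_induct2)
  case (Cons c cs d ds)
  define f where "f = form x y cs"
  define g where "g = form x y ds"
  define p where "p = y [^] length ds"
  have cl [simp]: "c \<in> carrier R" "d \<in> carrier R" "f \<in> carrier R" "g \<in> carrier R" "p \<in> carrier R" 
    using Cons.prems assms by (auto simp: f_def g_def p_def)
  have "(c \<oplus> d) \<otimes> p \<oplus> x \<otimes> (f \<oplus> g) = (c \<otimes> p \<oplus> x \<otimes> f) \<oplus> (d \<otimes> p \<oplus> x \<otimes> g)"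
    using cl assms(1-3) by algebra
  then show ?case using Cons by (simp add: f_def g_def p_def)
qed simp

lemma formsI: "set cs \<subseteq> A \<Longrightarrow> form x y cs \<in> forms A x y (length cs)"
  by (auto simp: forms_def)

lemma forms_closed:
  assumes "A \<subseteq> carrier R" "x \<in> carrier R" "y \<in> carrier R" "z \<in> forms A x y k"
  shows "z \<in> carrier R"
  using assms by (auto simp: forms_def intro!: form_closed)

lemma forms_mono: "A \<subseteq> B \<Longrightarrow> z \<in> forms A x y k \<Longrightarrow> z \<in> forms B x y k"
  by (auto simp: forms_def)

lemma forms_add:
  assumes "A \<subseteq> carrier R" "x \<in> carrier R" "y \<in> carrier R" "\<And>a b. a \<in> A \<Longrightarrow> b \<in> A \<Longrightarrow> a \<oplus> b \<in> A"
    and "z \<in> forms A x y k" "w \<in> forms A x y k"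
  shows "z \<oplus> w \<in> forms A x y k"
proof -
  obtain cs ds where cs: "z = form x y cs" "length cs = k" "set cs \<subseteq> A"
    and ds: "w = form x y ds" "length ds = k" "set ds \<subseteq> A"
    using assms(5,6) by (auto simp: forms_def)
  have "z \<oplus> w = form x y (map2 (\<oplus>) cs ds)"
    using assms cs ds by (subst form_add) auto
  moreover have "set (map2 (\<oplus>) cs ds) \<subseteq> A"
  proof
    fix e assume "e \<in> set (map2 (\<oplus>) cs ds)"
    then obtain c d where "(c, d) \<in> set (zip cs ds)" "e = c \<oplus> d"
      by auto
    then show "e \<in> A"
      using cs(3) ds(3) assms(4) set_zip_leftD[of c d] set_zip_rightD[of c d] by blast
  qed
  ultimately show ?thesis
    using cs ds formsI[of "map2 (\<oplus>) cs ds" A x y] by simp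
qed

lemma forms_smult:
  assumes "A \<subseteq> carrier R" "x \<in> carrier R" "y \<in> carrier R" "r \<in> carrier R" "\<And>a. a \<in> A \<Longrightarrow> r \<otimes> a \<in> B"
    and "z \<in> forms A x y k"
  shows "r \<otimes> z \<in> forms B x y k"
proof -
  obtain cs where cs: "z = form x y cs" "length cs = k" "set cs \<subseteq> A"
    using assms(6) by (auto simp: forms_def)
  have "r \<otimes> z = form x y (map ((\<otimes>) r) cs)"
    using assms cs by (subst form_smult) auto
  moreover have "set (map ((\<otimes>) r) cs) \<subseteq> B"
    using cs(3) assms(5) by auto
  ultimately show ?thesis
    using cs formsI[of "map ((\<otimes>) r) cs" B x y] by simp
qed

lemma forms_times_left:
  assumes "A \<subseteq> carrier R" "\<zero> \<in> A" "x \<in> carrier R" "y \<in> carrier R" "z \<in> forms A x y k"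
  shows "x \<otimes> z \<in> forms A x y (Suc k)"
proof -
  obtain cs where cs: "z = form x y cs" "length cs = k" "set cs \<subseteq> A"
    using assms(5) by (auto simp: forms_def)
  have "x \<otimes> z = form x y (\<zero> # cs)"
    using assms cs by (simp add: forms_def subset_trans[OF cs(3)])
  then show ?thesis using cs assms formsI[of "\<zero> # cs" A x y] by simp
qed

lemma forms_times_right:
  assumes "A \<subseteq> carrier R" "\<zero> \<in> A" "x \<in> carrier R" "y \<in> carrier R" "z \<in> forms A x y k"
  shows "y \<otimes> z \<in> forms A x y (Suc k)"
proof -
  obtain cs where cs: "z = form x y cs" "length cs = k" "set cs \<subseteq> A"
    using assms(5) by (auto simp: forms_def)
  have "y \<otimes> z = form x y (cs @ [\<zero>])"
    using assms cs by (subst form_snoc) (auto simp: subset_trans[OF cs(3)])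
  then show ?thesis using cs assms formsI[of "cs @ [\<zero>]" A x y] by simp
qed

lemma const_times_power_forms:
  assumes "A \<subseteq> carrier R" "\<zero> \<in> A" "x \<in> carrier R" "y \<in> carrier R" "c \<in> A"
  shows "c \<otimes> y [^] n \<in> forms A x y (Suc n)"
proof (induction n)
  case 0
  have "c = form x y [c]" using assms by auto
  then show ?case using assms formsI[of "[c]" A x y] by auto
next
  case (Suc n)
  have "c \<otimes> y [^] Suc n = y \<otimes> (c \<otimes> y [^] n)"
    using assms by (simp add: subset_iff m_ac)
  then show ?case using forms_times_right[OF assms(1-4) Suc] by simp
qed

lemma forms_SucE:
  assumes "A \<subseteq> carrier R" "\<zero> \<in> A" "x \<in> carrier R" "y \<in> carrier R" "z \<in> forms A x y (Suc (Suc n))"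
  obtains p q where "p \<in> forms A x y (Suc n)" "q \<in> forms A x y (Suc n)" "z = x \<otimes> p \<oplus> y \<otimes> q"
proof -
  obtain ds where ds: "z = form x y ds" "length ds = Suc (Suc n)" "set ds \<subseteq> A"
    using assms(5) by (auto simp: forms_def)
  then obtain c cs where cs: "z = form x y (c # cs)" "length cs = Suc n" "set cs \<subseteq> A" "c \<in> A"
    by (cases ds) auto
  have "c \<otimes> y [^] Suc n = y \<otimes> (c \<otimes> y [^] n)"
    using assms cs by (simp add: subset_iff m_ac)
  moreover have "form x y cs \<in> carrier R" "c \<otimes> y [^] n \<in> carrier R"
    using assms cs by (auto intro!: form_closed)
  ultimately have "z = x \<otimes> form x y cs \<oplus> y \<otimes> (c \<otimes> y [^] n)"
    using cs assms by (simp add: a_comm)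
  then show ?thesis
    using that cs formsI[of cs A x y] const_times_power_forms[OF assms(1-4) cs(4)] by auto
qed

end

section \<open>Noetherian local domains\<close>

context cring
begin

lemma ideal_closed:
  assumes "ideal I R"
  shows "a \<in> I \<Longrightarrow> a \<in> carrier R" "\<zero> \<in> I"
    "a \<in> I \<Longrightarrow> b \<in> I \<Longrightarrow> a \<oplus> b \<in> I" "a \<in> I \<Longrightarrow> \<ominus> a \<in> I" "a \<in> I \<Longrightarrow> b \<in> I \<Longrightarrow> a \<ominus> b \<in> I"
    "a \<in> I \<Longrightarrow> r \<in> carrier R \<Longrightarrow> r \<otimes> a \<in> I" "a \<in> I \<Longrightarrow> r \<in> carrier R \<Longrightarrow> a \<otimes> r \<in> I"
proof -
  interpret ideal I R by fact
  show "a \<in> I \<Longrightarrow> a \<in> carrier R" "\<zero> \<in> I"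
    "a \<in> I \<Longrightarrow> b \<in> I \<Longrightarrow> a \<oplus> b \<in> I" "a \<in> I \<Longrightarrow> \<ominus> a \<in> I" "a \<in> I \<Longrightarrow> b \<in> I \<Longrightarrow> a \<ominus> b \<in> I"
    "a \<in> I \<Longrightarrow> r \<in> carrier R \<Longrightarrow> r \<otimes> a \<in> I" "a \<in> I \<Longrightarrow> r \<in> carrier R \<Longrightarrow> a \<otimes> r \<in> I"
    by (auto simp: minus_eq I_l_closed I_r_closed)
qed

lemma idealI_closed:
  assumes "I \<subseteq> carrier R" "\<zero> \<in> I" "\<And>a b. a \<in> I \<Longrightarrow> b \<in> I \<Longrightarrow> a \<oplus> b \<in> I"
    and mult: "\<And>a r. a \<in> I \<Longrightarrow> r \<in> carrier R \<Longrightarrow> r \<otimes> a \<in> I"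
  shows "ideal I R"
proof (rule idealI)
  show "subgroup I (add_monoid R)"
  proof
    fix a assume a: "a \<in> I"
    then have "\<ominus> \<one> \<otimes> a \<in> I" by (simp add: mult)
    then have "\<ominus> a \<in> I" using a assms(1) by (simp add: l_minus subset_iff)
    then show "inv\<^bsub>add_monoid R\<^esub> a \<in> I" by (simp add: a_inv_def)
  qed (use assms in auto)
  show "a \<otimes> x \<in> I" if "a \<in> I" "x \<in> carrier R" for a x
    using mult[OF that] that assms(1) by (simp add: m_comm subset_iff)
qed (use assms ring_axioms in auto)

lemma ideal_add_mults:
  assumes "ideal J R" "a \<in> carrier R"
  shows "ideal {j \<oplus> a \<otimes> s | j s. j \<in> J \<and> s \<in> carrier R} R" (is "ideal ?K R")
proof (rule idealI_closed)
  note J = ideal_closed[OF assms(1)]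
  show "?K \<subseteq> carrier R" using J assms by auto
  have mem: "j \<oplus> a \<otimes> s \<in> ?K" if "j \<in> J" "s \<in> carrier R" for j s
    using that by blast
  show "\<zero> \<in> ?K" using mem[OF J(2) zero_closed] assms by simp
  fix x assume "x \<in> ?K"
  then obtain j s where x: "x = j \<oplus> a \<otimes> s" "j \<in> J" "s \<in> carrier R" by blast
  have j: "j \<in> carrier R" using x J by auto
  show "x \<oplus> y \<in> ?K" if "y \<in> ?K" for y
  proof -
    obtain k t where y: "y = k \<oplus> a \<otimes> t" "k \<in> J" "t \<in> carrier R" using \<open>y \<in> ?K\<close> by blast
    have "k \<in> carrier R" using y J by auto
    then have "x \<oplus> y = (j \<oplus> k) \<oplus> a \<otimes> (s \<oplus> t)"
      unfolding x y using j x(3) y(3) assms(2) by algebra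
    then show ?thesis using mem[of "j \<oplus> k" "s \<oplus> t"] J(3) x y by simp
  qed
  show "r \<otimes> x \<in> ?K" if r: "r \<in> carrier R" for r
  proof -
    have "r \<otimes> x = r \<otimes> j \<oplus> a \<otimes> (r \<otimes> s)"
      unfolding x using j x(3) r assms(2) by algebra
    then show ?thesis using mem[of "r \<otimes> j" "r \<otimes> s"] J(6) x r by simp
  qed
qed

lemma ideal_mults:
  assumes "a \<in> carrier R"
  shows "ideal (mults (carrier R) a) R"
proof -
  have "mults (carrier R) a = {j \<oplus> a \<otimes> s | j s. j \<in> {\<zero>} \<and> s \<in> carrier R}"
    unfolding mults_def using assms l_zero m_closed by (metis (no_types, lifting) singleton_iff)
  then show ?thesis using ideal_add_mults[OF zeroideal assms] by simp
qed

lemma lin_eq: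
  assumes "a \<in> carrier R" "b \<in> carrier R"
  shows "lin (carrier R) a b = {j \<oplus> b \<otimes> s | j s. j \<in> mults (carrier R) a \<and> s \<in> carrier R}"
  unfolding mults_def lin_def by blast

lemma ideal_lin:
  assumes "a \<in> carrier R" "b \<in> carrier R"
  shows "ideal (lin (carrier R) a b) R"
  unfolding lin_eq[OF assms] by (intro ideal_add_mults ideal_mults assms)

lemma nonunits_times:
  assumes A: "subring A R" and "a \<in> nonunits A" "r \<in> A"
  shows "a \<otimes> r \<in> nonunits A"
proof -
  have "a \<otimes> r \<otimes> b \<noteq> \<one>" if "b \<in> A" for b
    using assms(2,3) that subring_closed[OF A] m_assoc[of a r b] by (auto simp: nonunits_def)
  then show ?thesis using assms subring_closed[OF A] by (auto simp: nonunits_def)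
qed

end

lemma (in cring) prime_subset_nonunits:
  assumes "primeideal q R" shows "q \<subseteq> nonunits (carrier R)"
proof
  interpret q: primeideal q R by fact
  fix a assume a: "a \<in> q"
  have "a \<otimes> b \<noteq> \<one>" if "b \<in> carrier R" for b
    using a that q.I_notcarr q.one_imp_carrier q.I_r_closed by metis
  then show "a \<in> nonunits (carrier R)" using a by (simp add: nonunits_def)
qed

lemma (in cring) prime_contains_root:
  assumes "primeideal q R" "a \<in> carrier R" "a [^] (n::nat) \<in> q"
  shows "a \<in> q"
  using assms(3)
proof (induction n)
  interpret q: primeideal q R by fact
  {
    case 0
    then show ?case using q.one_imp_carrier q.I_notcarr by auto
  next
    case (Suc n)
    then show ?case using q.I_prime[of "a [^] n" a] assms(2) by auto
  }
qed

text \<open>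
  The ascending chain condition in the form in which it is used: chains have their union as a
  member, so Zorn's lemma applies to an arbitrary nonempty family of ideals.
\<close>
lemma (in noetherian_ring) maximal_in_ideal_family:
  assumes "Fam \<noteq> {}" "\<And>L. L \<in> Fam \<Longrightarrow> ideal L R"
  shows "\<exists>K\<in>Fam. \<forall>L\<in>Fam. K \<subseteq> L \<longrightarrow> L = K"
proof (rule subset_Zorn_nonempty[OF assms(1)])
  fix C assume C: "C \<noteq> {}" "subset.chain Fam C"
  have "subset.chain {L. ideal L R} C"
    using C(2) assms(2) by (auto simp: subset_chain_def)
  then have "\<Union>C \<in> C" using ideal_chain_is_trivial[OF C(1)] by simp
  then show "\<Union>C \<in> Fam" using C(2) by (auto simp: subset_chain_def)
qed

locale noetherian_local_domain = noetherian_domain +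
  assumes nonunits_add: "\<lbrakk>a \<in> nonunits (carrier R); b \<in> nonunits (carrier R)\<rbrakk> \<Longrightarrow> a \<oplus> b \<in> nonunits (carrier R)"
begin

abbreviation "C \<equiv> carrier R"
abbreviation "M \<equiv> nonunits C"

lemma M_carrier: "a \<in> M \<Longrightarrow> a \<in> carrier R" by (simp add: nonunits_def)

lemma unitE: assumes "a \<in> C" "a \<notin> M" obtains b where "b \<in> C" "a \<otimes> b = \<one>"
  using assms by (auto simp: nonunits_def)

lemma one_minus_unit: assumes "a \<in> M" shows "\<one> \<ominus> a \<notin> M"
proof
  assume "\<one> \<ominus> a \<in> M"
  then have "(\<one> \<ominus> a) \<oplus> a \<in> M" using assms nonunits_add by blast
  moreover have "(\<one> \<ominus> a) \<oplus> a = \<one>" using M_carrier[OF assms] by algebra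
  ultimately show False by (auto simp: nonunits_def)
qed

lemma long_form_in_ideal:
  assumes K: "ideal K R" and x: "x \<in> C" and y: "y \<in> C" and "x [^] (p::nat) \<in> K" "y [^] (q::nat) \<in> K"
    and cs: "set cs \<subseteq> C" "p + q \<le> length cs"
  shows "form x y cs \<in> K"
proof -
  note Kc = ideal_closed[OF K]
  define as bs where "as = take p cs" and "bs = drop p cs"
  have ab: "cs = as @ bs" "length as = p" "q \<le> length bs" "set as \<subseteq> C" "set bs \<subseteq> C"
    using cs set_take_subset[of p cs] set_drop_subset[of p cs] by (auto simp: as_def bs_def)
  have "y [^] length bs = y [^] q \<otimes> y [^] (length bs - q)"
    using ab(3) y by (simp add: nat_pow_mult)
  then have "y [^] length bs \<in> K"
    using assms(5) y Kc by simp
  then show ?thesis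
    using ab x y assms(4) unfolding ab(1) by (subst form_append) (auto intro!: Kc(3,7) form_closed)
qed

text \<open>
  Krull's intersection theorem for \<open>R/J\<close>. If \<open>w \<notin> J\<close>, take \<open>K \<supseteq> J\<close> maximal among the ideals
  without \<open>w\<close>, so that \<open>w\<close> lies in every ideal properly containing \<open>K\<close>. Then \<open>c w \<in> K\<close> for every
  nonunit \<open>c\<close>, since otherwise \<open>w\<close> would be congruent to \<open>c w s\<close> modulo \<open>K\<close> and \<open>1 - c s\<close> is a
  unit. As the ideals \<open>(K : c\<^sup>n)\<close> become stationary, this forces a power of \<open>c\<close> into \<open>K\<close>. So \<open>K\<close>
  contains all forms of high degree in \<open>x\<close> and \<open>y\<close>, and \<open>w\<close> is congruent to such a form modulo
  \<open>J\<close>.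
\<close>
lemma krull_intersection:
  assumes J: "ideal J R" and x: "x \<in> M" and y: "y \<in> M" and w: "w \<in> C"
    and near: "\<And>k. \<exists>j\<in>J. \<exists>f\<in>forms C x y (Suc k). w = j \<oplus> f"
  shows "w \<in> J"
proof (rule ccontr)
  assume "w \<notin> J"
  define Fam where "Fam = {K. ideal K R \<and> J \<subseteq> K \<and> w \<notin> K}"
  have "J \<in> Fam" using J \<open>w \<notin> J\<close> by (simp add: Fam_def)
  then have "\<exists>K\<in>Fam. \<forall>L\<in>Fam. K \<subseteq> L \<longrightarrow> L = K"
    by (intro maximal_in_ideal_family) (auto simp: Fam_def)
  then obtain K where "K \<in> Fam" and max: "\<And>L. L \<in> Fam \<Longrightarrow> K \<subseteq> L \<Longrightarrow> L = K"
    by blast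
  then have K: "ideal K R" "J \<subseteq> K" "w \<notin> K" by (auto simp: Fam_def)
  note Kc = ideal_closed[OF K(1)]
  have ext: "\<exists>k\<in>K. \<exists>s\<in>C. w = k \<oplus> a \<otimes> s" if a: "a \<in> C" "a \<notin> K" for a
  proof -
    let ?L = "{j \<oplus> a \<otimes> s | j s. j \<in> K \<and> s \<in> C}"
    have "a = \<zero> \<oplus> a \<otimes> \<one>" using a by simp
    then have "a \<in> ?L" using Kc by blast
    moreover have sub: "K \<subseteq> ?L"
    proof
      fix k assume k: "k \<in> K"
      have "k = k \<oplus> a \<otimes> \<zero>" using a k Kc by simp
      then show "k \<in> ?L" using k by blast
    qed
    moreover have "ideal ?L R" by (rule ideal_add_mults[OF K(1) a(1)])
    ultimately have "w \<in> ?L"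
      using max[OF _ sub] a K unfolding Fam_def by blast
    then show ?thesis by blast
  qed
  have absorb: "c \<otimes> w \<in> K" if c: "c \<in> M" for c
  proof (rule ccontr)
    have [simp]: "c \<in> C" using c by (rule M_carrier)
    assume "c \<otimes> w \<notin> K"
    then obtain k s where ks: "k \<in> K" "s \<in> C" "w = k \<oplus> (c \<otimes> w) \<otimes> s"
      using ext[of "c \<otimes> w"] w by auto
    have kC: "k \<in> C" using ks Kc by auto
    have "\<one> \<ominus> c \<otimes> s \<notin> M"
      using c ks nonunits_times[OF carrier_is_subring] one_minus_unit by blast
    then obtain i where i: "i \<in> C" "(\<one> \<ominus> c \<otimes> s) \<otimes> i = \<one>"
      using unitE[of "\<one> \<ominus> c \<otimes> s"] ks by auto
    have "w \<ominus> (c \<otimes> w) \<otimes> s = k"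
    proof -
      have "(k \<oplus> (c \<otimes> w) \<otimes> s) \<ominus> (c \<otimes> w) \<otimes> s = k"
        using kC ks(2) w \<open>c \<in> C\<close> by algebra
      then show ?thesis using ks(3) by simp
    qed
    then have "k \<otimes> i = w \<otimes> ((\<one> \<ominus> c \<otimes> s) \<otimes> i)"
    proof -
      have "(w \<ominus> (c \<otimes> w) \<otimes> s) \<otimes> i = w \<otimes> ((\<one> \<ominus> c \<otimes> s) \<otimes> i)"
        using i(1) ks(2) w \<open>c \<in> C\<close> by algebra
      then show ?thesis using \<open>w \<ominus> (c \<otimes> w) \<otimes> s = k\<close> by simp
    qed
    then have "w \<in> K" using i w ks(1) Kc(7)[of k i] by simp
    then show False using K by simp
  qed
  have pow: "\<exists>N::nat. c [^] N \<in> K" if c: "c \<in> M" for c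
  proof -
    have [simp]: "c \<in> C" using c by (rule M_carrier)
    define Q where "Q n = {r \<in> C. c [^] (n::nat) \<otimes> r \<in> K}" for n
    have idQ: "ideal (Q n) R" for n
    proof (rule idealI_closed)
      show "r \<otimes> a \<in> Q n" if "a \<in> Q n" "r \<in> C" for a r
      proof -
        have "c [^] n \<otimes> (r \<otimes> a) = r \<otimes> (c [^] n \<otimes> a)"
          using that by (intro m_lcomm) (auto simp: Q_def)
        then show ?thesis using that Kc by (auto simp: Q_def)
      qed
    qed (auto simp: Q_def r_distr Kc(2,3))
    have "\<exists>K\<in>range Q. \<forall>L\<in>range Q. K \<subseteq> L \<longrightarrow> L = K"
      by (intro maximal_in_ideal_family) (auto simp: idQ)
    then obtain N where "\<forall>L\<in>range Q. Q N \<subseteq> L \<longrightarrow> L = Q N"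
      by (elim bexE rangeE) simp
    then have N: "Q n = Q N" if "Q N \<subseteq> Q n" for n
      using that by simp
    have "Q N \<subseteq> Q (Suc N)"
    proof
      fix r assume r: "r \<in> Q N"
      have "c [^] Suc N \<otimes> r = c \<otimes> (c [^] N \<otimes> r)"
        using r by (simp add: Q_def m_ac)
      then show "r \<in> Q (Suc N)" using r Kc(6)[of "c [^] N \<otimes> r" c] by (simp add: Q_def)
    qed
    then have stab: "Q (Suc N) = Q N" by (rule N)
    have "c [^] N \<in> K"
    proof (rule ccontr)
      assume "c [^] N \<notin> K"
      then obtain k s where ks: "k \<in> K" "s \<in> C" "w = k \<oplus> c [^] N \<otimes> s"
        using ext[of "c [^] N"] by auto
      have kC: "k \<in> C" using ks Kc by auto
      define d where "d = c [^] N"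
      have d: "d \<in> C" by (simp add: d_def)
      have "c \<otimes> w \<ominus> c \<otimes> k = (d \<otimes> c) \<otimes> s"
        unfolding ks(3) d_def[symmetric] using kC ks(2) d \<open>c \<in> C\<close> by algebra
      then have "c [^] Suc N \<otimes> s = c \<otimes> w \<ominus> c \<otimes> k"
        by (simp add: d_def)
      then have "s \<in> Q (Suc N)"
        using ks absorb[OF c] Kc by (auto simp: Q_def)
      then have "s \<in> Q N" using stab by simp
      then have "c [^] N \<otimes> s \<in> K" by (simp add: Q_def)
      then show False using ks K Kc by simp
    qed
    then show ?thesis by blast
  qed
  obtain p q :: nat where pq: "x [^] p \<in> K" "y [^] q \<in> K"
    using pow[OF x] pow[OF y] by blast
  obtain j f where jf: "j \<in> J" "f \<in> forms C x y (Suc (p + q))" "w = j \<oplus> f"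
    using near by blast
  have "f \<in> K"
    using jf(2) long_form_in_ideal[OF K(1) _ _ pq] x y by (auto simp: forms_def M_carrier)
  then show False using jf(1,3) K Kc(3) by blast
qed

lemma adically_separated_carrier: "adically_separated C"
  unfolding adically_separated_def
proof (intro ballI impI)
  fix x y a assume "x \<in> M" "y \<in> M" "a \<in> C" and a: "\<forall>k. a \<in> forms C x y (Suc k)"
  have "a \<in> {\<zero>}"
    using krull_intersection[OF zeroideal \<open>x \<in> M\<close> \<open>y \<in> M\<close> \<open>a \<in> C\<close>] a \<open>a \<in> C\<close> by force
  then show "a = \<zero>" by simp
qed

end

text \<open>
  Two generators \<open>u, v\<close> of the maximal ideal and a prime ideal \<open>p\<close> strictly between \<open>0\<close> and the
  maximal ideal. The generators express regularity and the prime ideal expresses that the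
  dimension is at least two.
\<close>
locale noetherian_local_surface = noetherian_local_domain +
  fixes u v p
  assumes u: "u \<in> C" and v: "v \<in> C" and M_eq: "M = lin C u v"
    and p: "primeideal p R" "p \<noteq> {\<zero>}" "p \<noteq> M"
begin

lemma uM: "u \<in> M" and vM: "v \<in> M"
proof -
  have "u = u \<otimes> \<one> \<oplus> v \<otimes> \<zero>" "v = u \<otimes> \<zero> \<oplus> v \<otimes> \<one>" using u v by auto
  then show "u \<in> M" "v \<in> M" unfolding M_eq lin_def by blast+
qed

text \<open>
  Modulo \<open>u\<close> the maximal ideal is generated by \<open>v\<close>; so a nonzero element of \<open>R/uR\<close> is a power of
  \<open>v\<close> times a unit, the exponent being the largest \<open>k\<close> with \<open>w \<in> uR + m\<^sup>k\<close>.
\<close>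
lemma power_times_unit_mod:
  assumes w: "w \<in> C" "w \<notin> mults C u"
  shows "\<exists>k::nat. \<exists>e\<in>C - M. \<exists>r\<in>C. w = v [^] k \<otimes> e \<oplus> u \<otimes> r"
proof -
  let ?P = "\<lambda>k. \<exists>j\<in>mults C u. \<exists>f\<in>forms C u v (Suc k). w = j \<oplus> f"
  have "\<exists>k. \<not> ?P k"
    using krull_intersection[OF ideal_mults[OF u] uM vM w(1)] w(2) by blast
  define k where "k = (LEAST k. \<not> ?P k)"
  have k: "\<not> ?P k" using \<open>\<exists>k. \<not> ?P k\<close> unfolding k_def by (rule LeastI_ex)
  have "?P 0"
  proof -
    have "w = \<zero> \<oplus> form u v [w]" using w u by simp
    moreover have "form u v [w] \<in> forms C u v (Suc 0)"
      using formsI[of "[w]" C u v] w by simp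
    moreover have "\<zero> \<in> mults C u" using ideal_closed(2)[OF ideal_mults[OF u]] .
    ultimately show ?thesis by blast
  qed
  then obtain k' where k': "k = Suc k'" using k by (cases k) auto
  have "?P k'" using not_less_Least[of k' "\<lambda>k. \<not> ?P k"] k' unfolding k_def[symmetric] by simp
  then obtain j cs where jf: "j \<in> mults C u" "length cs = Suc k'" "set cs \<subseteq> C" "w = j \<oplus> form u v cs"
    by (auto simp: forms_def)
  obtain e ds where cs: "cs = e # ds" using jf(2) by (cases cs) auto
  obtain r where r: "j = u \<otimes> r" "r \<in> C" using jf(1) by (auto simp: mults_def)
  define g where "g = form u v ds"
  define d where "d = v [^] k'"
  have cl: "e \<in> C" "g \<in> C" "d \<in> C"
    using jf u v by (auto simp: cs g_def d_def)
  have w_eq: "w = u \<otimes> r \<oplus> (e \<otimes> d \<oplus> u \<otimes> g)"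
    using jf r by (simp add: cs g_def d_def)
  also have "\<dots> = d \<otimes> e \<oplus> u \<otimes> (r \<oplus> g)"
    using cl u r by algebra
  finally have *: "w = v [^] k' \<otimes> e \<oplus> u \<otimes> (r \<oplus> g)" by (simp add: d_def)
  have "e \<notin> M"
  proof
    assume "e \<in> M"
    then obtain a b where ab: "a \<in> C" "b \<in> C" "e = u \<otimes> a \<oplus> v \<otimes> b"
      unfolding M_eq lin_def by blast
    have "w = u \<otimes> (r \<oplus> g \<oplus> a \<otimes> d) \<oplus> b \<otimes> (d \<otimes> v)"
      unfolding w_eq ab(3) using cl(2-) u v r ab(1,2) by algebra
    moreover have "b \<otimes> (d \<otimes> v) \<in> forms C u v (Suc k)"
      using const_times_power_forms[of C u v b k] u v ab k' by (simp add: d_def)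
    moreover have "u \<otimes> (r \<oplus> g \<oplus> a \<otimes> d) \<in> mults C u"
      using r cl ab by (auto simp: mults_def)
    ultimately show False using k by blast
  qed
  then show ?thesis using * cl r by blast
qed

lemma power_left_forms: "c \<in> C \<Longrightarrow> u [^] (n::nat) \<otimes> c \<in> forms C u v (Suc n)"
proof (induction n)
  case 0
  have "c = form u v [c]" using 0 u by simp
  then show ?case using formsI[of "[c]" C u v] 0 by simp
next
  case (Suc n)
  have "u [^] Suc n \<otimes> c = u \<otimes> (u [^] n \<otimes> c)" using Suc u by (simp add: m_ac)
  then show ?case using forms_times_left[OF _ _ u v Suc.IH[OF Suc.prems]] by simp
qed

text \<open>
  If \<open>u \<in> q\<close>, then \<open>q\<close> is generated by \<open>u\<close>, because by the previous lemma anything larger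
  contains \<open>v\<close>. Otherwise take \<open>f \<in> q\<close> that is, modulo \<open>u\<close>, a unit times the smallest possible
  power of \<open>v\<close>. Then \<open>q = fR + uq\<close>, since \<open>u s \<in> q\<close> gives \<open>s \<in> q\<close>, so \<open>q \<subseteq> fR + u\<^sup>n q\<close> for all
  \<open>n\<close>, and Krull's theorem for \<open>R/fR\<close> gives \<open>q = fR\<close>.
\<close>
lemma nonmaximal_prime_principal:
  assumes q: "primeideal q R" "q \<noteq> {\<zero>}" "q \<noteq> M"
  obtains f where "f \<in> C" "q = mults C f"
proof (cases "u \<in> q")
  interpret q: primeideal q R by fact
  note qc = ideal_closed[OF q.is_ideal]
  have qM: "q \<subseteq> M" by (rule prime_subset_nonunits[OF q(1)])
  case True
  have "w \<in> mults C u" if wq: "w \<in> q" for w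
  proof (rule ccontr)
    assume "w \<notin> mults C u"
    then obtain k e r where *: "e \<in> C" "e \<notin> M" "r \<in> C" "w = v [^] (k::nat) \<otimes> e \<oplus> u \<otimes> r"
      using power_times_unit_mod[OF qc(1)[OF wq]] by blast
    define d where "d = v [^] k"
    have d: "d \<in> C" using v by (simp add: d_def)
    have "w \<ominus> u \<otimes> r = d \<otimes> e"
      unfolding * d_def[symmetric] using d u *(1,3) by algebra
    then have "d \<otimes> e \<in> q" using that True *(3) qc by metis
    then have "v [^] k \<in> q" using q.I_prime[of d e] d * qM by (auto simp: d_def)
    then have "v \<in> q" using prime_contains_root[OF q(1) v] by blast
    then have "M \<subseteq> q" using True by (auto simp: M_eq lin_def intro!: qc(3) qc(7))
    then show False using qM q(3) by blast
  qed
  moreover have "mults C u \<subseteq> q" using True qc(7) by (auto simp: mults_def)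
  ultimately show ?thesis using that u by blast
next
  interpret q: primeideal q R by fact
  note qc = ideal_closed[OF q.is_ideal]
  case False
  have cancel_u: "s \<in> q" if "u \<otimes> s \<in> q" "s \<in> C" for s
    using q.I_prime[OF u that(2,1)] False by blast
  have "\<not> q \<subseteq> mults C u"
  proof
    assume sub: "q \<subseteq> mults C u"
    have "w = \<zero>" if w: "w \<in> q" for w
    proof -
      have "\<exists>s\<in>q. w = u [^] (n::nat) \<otimes> s" for n
      proof (induction n)
        case 0
        then show ?case using w qc by force
      next
        case (Suc n)
        then obtain s where s: "s \<in> q" "w = u [^] n \<otimes> s" by blast
        then obtain t where t: "t \<in> C" "s = u \<otimes> t" using sub by (auto simp: mults_def)
        then have "t \<in> q" using s cancel_u by blast
        moreover have "w = u [^] Suc n \<otimes> t" using s t u by (simp add: m_ac)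
        ultimately show ?case by blast
      qed
      then have "w \<in> forms C u v (Suc n)" for n
        using power_left_forms qc(1) by metis
      then show ?thesis
        using adically_separated_carrier uM vM qc(1)[OF w] unfolding adically_separated_def by blast
    qed
    then show False using q(2) qc(2) by blast
  qed
  then obtain w0 where w0: "w0 \<in> q" "w0 \<notin> mults C u" by blast
  let ?P = "\<lambda>k::nat. \<exists>f\<in>q. \<exists>e\<in>C - M. \<exists>r\<in>C. f = v [^] k \<otimes> e \<oplus> u \<otimes> r"
  have "\<exists>k. ?P k"
  proof -
    have "w0 \<in> C" using w0 qc(1) by blast
    then show ?thesis using power_times_unit_mod[OF _ w0(2)] w0(1) by blast
  qed
  define k where "k = (LEAST k. ?P k)"
  have "?P k" using \<open>\<exists>k. ?P k\<close> unfolding k_def by (rule LeastI_ex)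
  then obtain f e r where f: "f \<in> q" "e \<in> C" "e \<notin> M" "r \<in> C" "f = v [^] k \<otimes> e \<oplus> u \<otimes> r" by blast
  have fC: "f \<in> C" using f(1) qc by blast
  obtain i where i: "i \<in> C" "e \<otimes> i = \<one>" using unitE[OF f(2,3)] by blast
  have step: "\<exists>g\<in>C. \<exists>s\<in>q. w = f \<otimes> g \<oplus> u \<otimes> s" if w: "w \<in> q" for w
  proof -
    have "\<exists>g\<in>C. \<exists>s\<in>C. w = f \<otimes> g \<oplus> u \<otimes> s"
    proof (cases "w \<in> mults C u")
      case True
      then obtain s where "s \<in> C" "w = u \<otimes> s" by (auto simp: mults_def)
      then have "w = f \<otimes> \<zero> \<oplus> u \<otimes> s" using fC u by simp
      then show ?thesis using \<open>s \<in> C\<close> by blast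
    next
      case False
      then obtain k' e' r' where *: "e' \<in> C" "e' \<notin> M" "r' \<in> C" "w = v [^] (k'::nat) \<otimes> e' \<oplus> u \<otimes> r'"
        using power_times_unit_mod[OF qc(1)[OF w]] by blast
      then have "?P k'" using w by blast
      then have "k \<le> k'" unfolding k_def by (rule Least_le)
      define d where "d = v [^] k"
      define b where "b = v [^] (k' - k)"
      have db: "d \<in> C" "b \<in> C" using v by (auto simp: d_def b_def)
      have "v [^] k' = d \<otimes> b" using \<open>k \<le> k'\<close> v by (simp add: d_def b_def nat_pow_mult)
      then have w_eq: "w = (d \<otimes> b) \<otimes> e' \<oplus> u \<otimes> r'" using * by simp
      have "f \<otimes> (i \<otimes> b \<otimes> e') \<oplus> u \<otimes> (r' \<ominus> r \<otimes> i \<otimes> b \<otimes> e')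
          = (e \<otimes> i) \<otimes> (d \<otimes> b) \<otimes> e' \<oplus> u \<otimes> r'"
        unfolding f(5) d_def[symmetric] using f(2,4) u i(1) db *(1,3) by algebra
      then have "w = f \<otimes> (i \<otimes> b \<otimes> e') \<oplus> u \<otimes> (r' \<ominus> r \<otimes> i \<otimes> b \<otimes> e')"
        using w_eq i(2) db *(1) by simp
      then show ?thesis using f(2,4) u i(1) db *(1,3) by blast
    qed
    then obtain g s where gs: "g \<in> C" "s \<in> C" "w = f \<otimes> g \<oplus> u \<otimes> s" by blast
    have "w \<ominus> f \<otimes> g = u \<otimes> s" unfolding gs(3) using gs(1,2) fC u by algebra
    then have "u \<otimes> s \<in> q" using w f(1) gs qc by metis
    then show ?thesis using gs cancel_u by blast
  qed
  have "w \<in> mults C f" if w: "w \<in> q" for w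
  proof (rule krull_intersection[OF ideal_mults[OF fC] uM vM])
    show "w \<in> C" using w qc by blast
    fix n
    have "\<exists>g\<in>C. \<exists>s\<in>q. w = f \<otimes> g \<oplus> u [^] (n::nat) \<otimes> s"
    proof (induction n)
      case 0
      have "w = f \<otimes> \<zero> \<oplus> u [^] (0::nat) \<otimes> w" using w qc fC by simp
      then show ?case using w by blast
    next
      case (Suc n)
      then obtain g s where gs: "g \<in> C" "s \<in> q" "w = f \<otimes> g \<oplus> u [^] n \<otimes> s" by blast
      obtain g' s' where gs': "g' \<in> C" "s' \<in> q" "s = f \<otimes> g' \<oplus> u \<otimes> s'" using step[OF gs(2)] by blast
      define d where "d = u [^] n"
      have d: "d \<in> C" using u by (simp add: d_def)
      have "s' \<in> C" using gs' qc by blast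
      then have "w = f \<otimes> (g \<oplus> d \<otimes> g') \<oplus> (d \<otimes> u) \<otimes> s'"
        unfolding gs(3) gs'(3) d_def[symmetric] using gs(1) gs'(1) fC u d by algebra
      then have "w = f \<otimes> (g \<oplus> d \<otimes> g') \<oplus> u [^] Suc n \<otimes> s'" by (simp add: d_def)
      moreover have "g \<oplus> d \<otimes> g' \<in> C" using gs(1) gs'(1) d by simp
      ultimately show ?case using gs'(2) by (intro bexI)
    qed
    then obtain g s where gs: "g \<in> C" "s \<in> q" "w = f \<otimes> g \<oplus> u [^] n \<otimes> s" by blast
    then have "u [^] n \<otimes> s \<in> forms C u v (Suc n)" "f \<otimes> g \<in> mults C f"
      using power_left_forms[of s n] qc(1) unfolding mults_def by blast+
    then show "\<exists>j\<in>mults C f. \<exists>f\<in>forms C u v (Suc n). w = j \<oplus> f"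
      using gs(3) by blast
  qed
  moreover have "mults C f \<subseteq> q" using f(1) qc(7) by (auto simp: mults_def)
  ultimately show ?thesis using that fC by blast
qed

text \<open>
  Write \<open>p = fR\<close>. If a power of every nonunit were divisible by the nonunit \<open>b\<close>, then \<open>b \<notin> p\<close>,
  and from \<open>f\<^sup>n = b s\<close> the prime \<open>f\<close> could be cancelled \<open>n\<close> times, so that \<open>b\<close> would be a unit.
\<close>
lemma dim_at_least_two_carrier: "dim_at_least_two C"
  unfolding dim_at_least_two_def
proof (rule ballI, rule ccontr)
  fix b assume b: "b \<in> M" and "\<not> (\<exists>c\<in>M. \<forall>n::nat. c [^] n \<notin> mults C b)"
  then have pow: "\<exists>n::nat. c [^] n \<in> mults C b" if "c \<in> M" for c using that by blast
  interpret p: primeideal p R by (rule p)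
  note pc = ideal_closed[OF p.is_ideal]
  have pM: "p \<subseteq> M" by (rule prime_subset_nonunits[OF p(1)])
  have bC: "b \<in> C" using b by (rule M_carrier)
  have bp: "b \<notin> p"
  proof
    assume "b \<in> p"
    obtain c where c: "c \<in> M" "c \<notin> p" using pM p(3) by blast
    obtain n :: nat and s where "c [^] n = b \<otimes> s" "s \<in> C"
      using pow[OF c(1)] by (auto simp: mults_def)
    then have "c [^] n \<in> p" using \<open>b \<in> p\<close> pc by simp
    then show False using prime_contains_root[OF p(1)] c M_carrier by blast
  qed
  obtain f where f: "f \<in> C" "p = mults C f"
    using nonmaximal_prime_principal[OF p] by blast
  have "f = f \<otimes> \<one>" using f by simp
  then have fp: "f \<in> p" unfolding f(2) mults_def by blast
  have f0: "f \<noteq> \<zero>"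
  proof
    assume f0: "f = \<zero>"
    have "z = \<zero>" if "z \<in> p" for z
    proof -
      have "z \<in> mults C f" using that f(2) by simp
      then obtain s where "s \<in> C" "z = f \<otimes> s" unfolding mults_def by blast
      then show ?thesis using f0 by simp
    qed
    then show False using p(2) pc(2) by blast
  qed
  have no: "\<not> (\<exists>s\<in>C. f [^] n = b \<otimes> s)" for n :: nat
  proof (induction n)
    case 0
    then show ?case using b by (auto simp: nonunits_def)
  next
    case (Suc n)
    show ?case
    proof
      assume "\<exists>s\<in>C. f [^] Suc n = b \<otimes> s"
      then obtain s where s: "s \<in> C" "f [^] Suc n = b \<otimes> s" by blast
      have "f [^] Suc n \<in> p" using fp f pc by simp
      then have "s \<in> p" using p.I_prime[OF bC s(1)] s(2) bp by auto
      then obtain t where t: "t \<in> C" "s = f \<otimes> t" unfolding f(2) mults_def by blast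
      have "f \<otimes> f [^] n = f \<otimes> (b \<otimes> t)"
        using s t f bC by (simp add: m_ac)
      then have "f [^] n = b \<otimes> t" using f0 f bC t by (simp add: m_lcancel)
      then show False using Suc t by blast
    qed
  qed
  obtain n :: nat where "f [^] n \<in> mults C b" using pow fp pM by blast
  then show False using no unfolding mults_def by blast
qed

text \<open>
  Among all ways to write the fraction \<open>a/b\<close>, take one whose denominator \<open>b'\<close> generates a
  maximal ideal. If some nonunit has no power in \<open>(a', b')\<close>, an ideal that is maximal with this
  property is prime, hence generated by one element \<open>f\<close>; dividing \<open>a'\<close> and \<open>b'\<close> by \<open>f\<close>
  contradicts the choice of \<open>b'\<close>.
\<close>
lemma coprime_representation:
  assumes a: "a \<in> C" and b: "b \<in> C" "b \<noteq> \<zero>"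
  obtains a' b' where "a' \<in> C" "b' \<in> C" "b' \<noteq> \<zero>" "a \<otimes> b' = a' \<otimes> b" "primary_pair C a' b'"
proof -
  define Fam where "Fam = {mults C b' | a' b'. a' \<in> C \<and> b' \<in> C \<and> b' \<noteq> \<zero> \<and> a \<otimes> b' = a' \<otimes> b}"
  have "mults C b \<in> Fam" unfolding Fam_def using a b by blast
  then have "\<exists>K\<in>Fam. \<forall>L\<in>Fam. K \<subseteq> L \<longrightarrow> L = K"
    by (intro maximal_in_ideal_family) (auto simp: Fam_def intro: ideal_mults)
  then obtain L where "L \<in> Fam" and max: "\<And>K. K \<in> Fam \<Longrightarrow> L \<subseteq> K \<Longrightarrow> K = L"
    by blast
  then obtain a' b' where ab: "L = mults C b'" "a' \<in> C" "b' \<in> C" "b' \<noteq> \<zero>" "a \<otimes> b' = a' \<otimes> b"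
    unfolding Fam_def by blast
  have "primary_pair C a' b'"
  proof (rule ccontr)
    assume "\<not> primary_pair C a' b'"
    then obtain c where c: "c \<in> M" and cpow: "\<And>n::nat. c [^] n \<notin> lin C a' b'"
      unfolding primary_pair_def by blast
    have cC: "c \<in> C" using c by (rule M_carrier)
    define Gam where "Gam = {K. ideal K R \<and> lin C a' b' \<subseteq> K \<and> (\<forall>n::nat. c [^] n \<notin> K)}"
    have "lin C a' b' \<in> Gam" using cpow ideal_lin ab unfolding Gam_def by blast
    then have "\<exists>K\<in>Gam. \<forall>L\<in>Gam. K \<subseteq> L \<longrightarrow> L = K"
      by (intro maximal_in_ideal_family) (auto simp: Gam_def)
    then obtain J where "J \<in> Gam" and maxJ: "\<And>K. K \<in> Gam \<Longrightarrow> J \<subseteq> K \<Longrightarrow> K = J"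
      by blast
    then have J: "ideal J R" "lin C a' b' \<subseteq> J" "\<And>n::nat. c [^] n \<notin> J" unfolding Gam_def by auto
    note Jc = ideal_closed[OF J(1)]
    have J1: "\<one> \<notin> J" using J(3)[of 0] by simp
    have ext: "\<exists>n::nat. \<exists>j\<in>J. \<exists>s\<in>C. c [^] n = j \<oplus> r \<otimes> s" if r: "r \<in> C" "r \<notin> J" for r
    proof -
      let ?K = "{j \<oplus> r \<otimes> s | j s. j \<in> J \<and> s \<in> C}"
      have "r = \<zero> \<oplus> r \<otimes> \<one>" using r by simp
      then have "r \<in> ?K" using Jc(2) one_closed by blast
      moreover have sub: "J \<subseteq> ?K"
      proof
        fix k assume k: "k \<in> J"
        have "k = k \<oplus> r \<otimes> \<zero>" using r k Jc by simp
        then show "k \<in> ?K" using k by blast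
      qed
      moreover have "ideal ?K R" by (rule ideal_add_mults[OF J(1) r(1)])
      ultimately have "?K \<notin> Gam" using maxJ r by blast
      then obtain n :: nat where "c [^] n \<in> ?K"
        using \<open>ideal ?K R\<close> sub J(2) unfolding Gam_def by blast
      then show ?thesis by blast
    qed
    have "primeideal J R"
    proof (rule primeidealI[OF J(1)])
      show "cring R" by (rule is_cring)
      show "C \<noteq> J" using J1 by auto
      fix r s assume rs: "r \<in> C" "s \<in> C" "r \<otimes> s \<in> J"
      show "r \<in> J \<or> s \<in> J"
      proof (rule ccontr)
        assume "\<not> (r \<in> J \<or> s \<in> J)"
        then obtain m n :: nat and j k x y where
          *: "j \<in> J" "x \<in> C" "c [^] m = j \<oplus> r \<otimes> x" "k \<in> J" "y \<in> C" "c [^] n = k \<oplus> s \<otimes> y"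
          using ext[of r] ext[of s] rs by blast
        have jk: "j \<in> C" "k \<in> C" using * Jc by auto
        have "c [^] (m + n) = (j \<oplus> r \<otimes> x) \<otimes> (k \<oplus> s \<otimes> y)"
          using * cC by (simp add: nat_pow_mult[symmetric])
        also have "\<dots> = j \<otimes> (k \<oplus> s \<otimes> y) \<oplus> k \<otimes> (r \<otimes> x) \<oplus> (r \<otimes> s) \<otimes> (x \<otimes> y)"
          using jk *(2,5) rs(1,2) by algebra
        also have "\<dots> \<in> J"
          using *(1,2,4,5) jk rs Jc(7)[OF rs(3), of "x \<otimes> y"] by (simp add: Jc(3,7))
        finally show False using J(3) by blast
      qed
    qed
    moreover have b'J: "b' \<in> J" and a'J: "a' \<in> J"
    proof -
      have "b' = a' \<otimes> \<zero> \<oplus> b' \<otimes> \<one>" "a' = a' \<otimes> \<one> \<oplus> b' \<otimes> \<zero>" using ab by auto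
      then have "b' \<in> lin C a' b'" "a' \<in> lin C a' b'" unfolding lin_def by blast+
      then show "b' \<in> J" "a' \<in> J" using J(2) by auto
    qed
    moreover have "c \<notin> J" using J(3)[of 1] cC by simp
    ultimately obtain f where f: "f \<in> C" "J = mults C f"
      using nonmaximal_prime_principal[of J] ab(4) c by blast
    obtain a'' b'' where *: "a'' \<in> C" "b'' \<in> C" "a' = f \<otimes> a''" "b' = f \<otimes> b''"
      using a'J b'J unfolding f(2) mults_def by blast
    have f0: "f \<noteq> \<zero>" and b''0: "b'' \<noteq> \<zero>" using * ab(4) f by auto
    have "f \<otimes> (a \<otimes> b'') = f \<otimes> (a'' \<otimes> b)"
      using ab(5) * f a b by (simp add: m_ac)
    then have "a \<otimes> b'' = a'' \<otimes> b" using f0 f a b * by (simp add: m_lcancel)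
    then have "mults C b'' \<in> Fam" unfolding Fam_def using * b''0 by blast
    moreover have "L \<subseteq> mults C b''"
    proof
      fix z assume "z \<in> L"
      then obtain s where "s \<in> C" "z = b' \<otimes> s" unfolding ab(1) mults_def by blast
      then have "z = b'' \<otimes> (f \<otimes> s)" "f \<otimes> s \<in> C" using * f by (simp_all add: m_ac)
      then show "z \<in> mults C b''" unfolding mults_def by blast
    qed
    ultimately have "mults C b'' = mults C b'" using max ab(1) by blast
    moreover have "b'' = b'' \<otimes> \<one>" using * by simp
    then have "b'' \<in> mults C b''" unfolding mults_def using one_closed by blast
    ultimately have "b'' \<in> mults C b'" by simp
    then obtain s where s: "s \<in> C" "b'' = b' \<otimes> s" unfolding mults_def by blast
    have "f \<otimes> s = \<one>"
    proof (rule m_lcancel[THEN iffD1, OF b''0 *(2)])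
      have "b'' = b'' \<otimes> (f \<otimes> s)" 
        using s(1) *(2) f(1) trans[OF s(2)[unfolded *(4)], of "b'' \<otimes> (f \<otimes> s)"] by (simp add: m_ac)
      then show "b'' \<otimes> (f \<otimes> s) = b'' \<otimes> \<one>" using *(2) by simp
    qed (use f s in auto)
    then have "\<one> \<in> J" using f(2) s(1) unfolding mults_def by (metis (mono_tags, lifting) mem_Collect_eq)
    then show False using J1 by simp
  qed
  then show ?thesis using that ab by blast
qed

end

section \<open>Two-dimensional regular local rings are surfaces\<close>

text \<open>
  The notions above mention the ring only through its operations, so it does not matter whether
  they are formed in the ambient ring or in the subring.
\<close>
lemma (in domain) surface_restrict:
  assumes A: "subring A R" and S: "S = R\<lparr>carrier := A\<rparr>"
  shows "ring.form S x y cs = form x y cs"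
    and "ring.forms S B x y k = forms B x y k"
    and "ring.nonunits S B = nonunits B"
    and "ring.lin S B a b = lin B a b"
    and "ring.mults S B a = mults B a"
    and "ring.primary_pair S B a b \<longleftrightarrow> primary_pair B a b"
    and "ring.adically_separated S B \<longleftrightarrow> adically_separated B"
    and "ring.dim_at_least_two S B \<longleftrightarrow> dim_at_least_two B"
proof -
  interpret S: ring S unfolding S by (rule subring_is_ring[OF A])
  have pow [simp]: "x [^]\<^bsub>S\<^esub> (n::nat) = x [^] n" for x n
    unfolding S by (rule nat_pow_consistent[symmetric])
  have ops [simp]: "\<zero>\<^bsub>S\<^esub> = \<zero>" "\<one>\<^bsub>S\<^esub> = \<one>" "a \<otimes>\<^bsub>S\<^esub> b = a \<otimes> b" "a \<oplus>\<^bsub>S\<^esub> b = a \<oplus> b" for a b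
    by (simp_all add: S)
  show form: "ring.form S x y cs = form x y cs" for x y cs
    by (induction cs) simp_all
  show forms: "ring.forms S B x y k = forms B x y k" for B x y k
    by (simp add: S.forms_def forms_def form)
  show nonunits: "ring.nonunits S B = nonunits B" for B
    by (simp add: S.nonunits_def nonunits_def)
  show lin: "ring.lin S B a b = lin B a b" for a b
    by (simp add: S.lin_def lin_def)
  show mults: "ring.mults S B a = mults B a" for a
    by (simp add: S.mults_def mults_def)
  show "ring.primary_pair S B a b \<longleftrightarrow> primary_pair B a b"
    by (simp add: S.primary_pair_def primary_pair_def nonunits lin)
  show "ring.adically_separated S B \<longleftrightarrow> adically_separated B"
    by (simp add: S.adically_separated_def adically_separated_def nonunits forms)
  show "ring.dim_at_least_two S B \<longleftrightarrow> dim_at_least_two B"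
    by (simp add: S.dim_at_least_two_def dim_at_least_two_def nonunits mults)
qed

text \<open>
  A nonunit lies in a maximal ideal, and there is only one.
\<close>
lemma (in noetherian_domain) nonunits_eq_maximal:
  assumes local: "local_ring R" and m: "maximalideal m R"
  shows "nonunits (carrier R) = m"
proof
  show "m \<subseteq> nonunits (carrier R)"
    using prime_subset_nonunits[OF maximalideal_prime[OF m]] .
  show "nonunits (carrier R) \<subseteq> m"
  proof
    fix a assume a: "a \<in> nonunits (carrier R)"
    then have aC: "a \<in> carrier R" by (simp add: nonunits_def)
    define Fam where "Fam = {K. ideal K R \<and> a \<in> K \<and> \<one> \<notin> K}"
    have "a = a \<otimes> \<one>" using aC by simp
    then have "a \<in> mults (carrier R) a" unfolding mults_def using one_closed by blast
    moreover have "\<one> \<notin> mults (carrier R) a" using a by (auto simp: mults_def nonunits_def)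
    ultimately have "mults (carrier R) a \<in> Fam"
      using ideal_mults[OF aC] by (simp add: Fam_def)
    then have "\<exists>K\<in>Fam. \<forall>L\<in>Fam. K \<subseteq> L \<longrightarrow> L = K"
      by (intro maximal_in_ideal_family) (auto simp: Fam_def)
    then obtain K where K: "K \<in> Fam" and max: "\<forall>L\<in>Fam. K \<subseteq> L \<longrightarrow> L = K"
      by blast
    have "maximalideal K R"
    proof (rule maximalidealI)
      show "ideal K R" using K by (simp add: Fam_def)
      show "carrier R \<noteq> K" using K by (auto simp: Fam_def)
      fix J assume J: "ideal J R" "K \<subseteq> J" "J \<subseteq> carrier R"
      show "J = K \<or> J = carrier R"
      proof (cases "\<one> \<in> J")
        case True
        then show ?thesis using ideal.one_imp_carrier[OF J(1)] by blast
      next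
        case False
        then have "J \<in> Fam" using J K by (auto simp: Fam_def)
        then show ?thesis using max J by blast
      qed
    qed
    then have "K = m" using local m unfolding local_ring_def by blast
    then show "a \<in> m" using K by (simp add: Fam_def)
  qed
qed

lemma krull_dim_2_chain:
  assumes "krull_dim R = 2"
  obtains P :: "nat \<Rightarrow> 'a set" where "\<And>i. i \<le> 2 \<Longrightarrow> primeideal (P i) R" "P 0 \<subset> P 1" "P 1 \<subset> P 2"
proof -
  let ?X = "{enat n | n. \<exists>P :: nat \<Rightarrow> 'a set. (\<forall>i\<le>n. primeideal (P i) R) \<and> (\<forall>i<n. P i \<subset> P (Suc i))}"
  have "1 < Sup ?X" using assms by (simp add: krull_dim_def one_enat_def numeral_eq_enat)
  then obtain x where x: "x \<in> ?X" "1 < x" unfolding less_Sup_iff by blast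
  then obtain n and P :: "nat \<Rightarrow> 'a set" where "x = enat n"
    and P: "\<forall>i\<le>n. primeideal (P i) R" "\<forall>i<n. P i \<subset> P (Suc i)"
    by blast
  then have n: "n \<ge> 2" using x(2) by (simp add: one_enat_def)
  have "P 0 \<subset> P (Suc 0)" "P 1 \<subset> P (Suc 1)"
    using P(2) n by auto
  then show ?thesis using that[of P] P(1) n by (simp add: numeral_2_eq_2)
qed

theorem surface_if_two_dim_regular:
  assumes qf: "quotient_field_of F D" and ov: "overring F D A"
    and reg: "two_dim_regular_local_subring A F"
  shows "ring.surface F A"
proof -
  interpret F: field F using qf by (simp add: quotient_field_of_def)
  define S where "S = F\<lparr>carrier := A\<rparr>"
  have A: "subring A F" and regS: "regular_local_ring S" and dimS: "krull_dim S = 2"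
    using reg by (auto simp: two_dim_regular_local_subring_def S_def)
  have "subdomain A F" by (rule F.subdomainI'[OF A])
  then interpret S: domain S unfolding S_def by (rule F.subdomain_is_domain)
  interpret S: noetherian_ring S using regS by (simp add: regular_local_ring_def)
  interpret S: noetherian_domain S by unfold_locales
  have local: "local_ring S" using regS by (simp add: regular_local_ring_def)
  have cS: "carrier S = A" by (simp add: S_def)
  note restrict = F.surface_restrict[OF A S_def]
  obtain G where G: "G \<subseteq> carrier S" "finite G" "enat (card G) = krull_dim S" "maximalideal (Idl\<^bsub>S\<^esub> G) S"
    using regS by (auto simp: regular_local_ring_def)
  have M: "S.nonunits A = Idl\<^bsub>S\<^esub> G"
    using S.nonunits_eq_maximal[OF local G(4)] by (simp add: cS)
  have "card G = 2" using G(3) dimS by (simp add: numeral_eq_enat)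
  then obtain u v where uv: "G = {u, v}" by (auto simp: card_2_iff)
  have uvA: "u \<in> A" "v \<in> A" using G(1) uv by (auto simp: cS)
  note Mc = S.ideal_closed[OF maximalideal.axioms(1)[OF G(4)]]
  have M_lin: "S.nonunits A = S.lin A u v"
  proof
    have "u = u \<otimes>\<^bsub>S\<^esub> \<one>\<^bsub>S\<^esub> \<oplus>\<^bsub>S\<^esub> v \<otimes>\<^bsub>S\<^esub> \<zero>\<^bsub>S\<^esub>" "v = u \<otimes>\<^bsub>S\<^esub> \<zero>\<^bsub>S\<^esub> \<oplus>\<^bsub>S\<^esub> v \<otimes>\<^bsub>S\<^esub> \<one>\<^bsub>S\<^esub>"
      using uvA by (auto simp: cS)
    then have "G \<subseteq> S.lin (carrier S) u v"
      unfolding uv S.lin_def using S.one_closed S.zero_closed by blast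
    then show "S.nonunits A \<subseteq> S.lin A u v"
      unfolding M using S.genideal_minimal[OF S.ideal_lin, of u v G] uvA by (simp add: cS)
    have "u \<in> S.nonunits A" "v \<in> S.nonunits A"
      using S.genideal_self[OF G(1)] unfolding M uv by auto
    then show "S.lin A u v \<subseteq> S.nonunits A"
      unfolding M S.lin_def by (auto intro!: Mc(3) Mc(7) simp: cS)
  qed
  obtain P where P: "\<And>i. i \<le> 2 \<Longrightarrow> primeideal (P i) S" "P 0 \<subset> P 1" "P 1 \<subset> P (2::nat)"
    using krull_dim_2_chain[OF dimS] by blast
  have "P 2 \<subseteq> S.nonunits A" using S.prime_subset_nonunits[OF P(1)[of 2]] by (simp add: cS)
  moreover have "\<zero>\<^bsub>S\<^esub> \<in> P 0"
    using S.ideal_closed(2)[OF primeideal.axioms(1)[OF P(1)]] by simp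
  ultimately have P1: "P 1 \<noteq> {\<zero>\<^bsub>S\<^esub>}" "P 1 \<noteq> S.nonunits (carrier S)" using P by (auto simp: cS)
  interpret S: noetherian_local_domain S
  proof
    show "a \<oplus>\<^bsub>S\<^esub> b \<in> S.nonunits (carrier S)" if "a \<in> S.nonunits (carrier S)" "b \<in> S.nonunits (carrier S)" for a b
      using that Mc(3) by (simp add: cS M)
  qed
  have "noetherian_local_surface_axioms S u v (P 1)"
    using P1 P(1)[of 1] uvA M_lin by (intro noetherian_local_surface_axioms.intro) (simp_all add: cS)
  then interpret S: noetherian_local_surface S u v "P 1"
    by (intro noetherian_local_surface.intro S.noetherian_local_domain_axioms)
  have "\<exists>a\<in>A. \<exists>b\<in>A. b \<noteq> \<zero>\<^bsub>F\<^esub> \<and> z \<otimes>\<^bsub>F\<^esub> b = a \<and> F.primary_pair A a b" if z: "z \<in> carrier F" for z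
  proof -
    obtain a b where ab: "a \<in> D" "b \<in> D" "b \<noteq> \<zero>\<^bsub>F\<^esub>" "z = a \<otimes>\<^bsub>F\<^esub> inv\<^bsub>F\<^esub> b"
      using qf z unfolding quotient_field_of_def by blast
    then have abA: "a \<in> A" "b \<in> A" using ov by (auto simp: overring_def)
    then have abF: "a \<in> carrier F" "b \<in> carrier F" using F.subring_closed(1)[OF A] by auto
    have zb: "z \<otimes>\<^bsub>F\<^esub> b = a"
      using ab abF by (simp add: F.m_assoc F.field_Units)
    obtain a' b' where *: "a' \<in> A" "b' \<in> A" "b' \<noteq> \<zero>\<^bsub>F\<^esub>" "a \<otimes>\<^bsub>F\<^esub> b' = a' \<otimes>\<^bsub>F\<^esub> b" "F.primary_pair A a' b'"
      using S.coprime_representation[of a b] abA ab(3) unfolding cS restrict by (auto simp: S_def)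
    have c: "a' \<in> carrier F" "b' \<in> carrier F" using * F.subring_closed(1)[OF A] by auto
    have "b \<otimes>\<^bsub>F\<^esub> (z \<otimes>\<^bsub>F\<^esub> b') = b \<otimes>\<^bsub>F\<^esub> a'"
      using zb *(4) z abF c by (metis F.m_assoc F.m_comm)
    then have "z \<otimes>\<^bsub>F\<^esub> b' = a'" using ab(3) abF c z by (simp add: F.m_lcancel)
    then show ?thesis using * by blast
  qed
  moreover have "F.adically_separated A" using S.adically_separated_carrier unfolding cS restrict .
  moreover have "F.dim_at_least_two A" using S.dim_at_least_two_carrier unfolding cS restrict .
  moreover have "F.nonunits A = F.lin A u v" using M_lin unfolding restrict .
  ultimately show ?thesis using A uvA unfolding F.surface_def by blast
qed

section \<open>Overrings of a surface\<close>

context field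
begin

lemma divide_ex:
  assumes "x \<in> carrier R" "x \<noteq> \<zero>" "y \<in> carrier R"
  obtains z where "z \<in> carrier R" "y = x \<otimes> z"
proof
  have "x \<in> Units R" using assms field_Units by blast
  then show "inv x \<otimes> y \<in> carrier R" "y = x \<otimes> (inv x \<otimes> y)"
    using assms by (simp_all add: m_assoc[symmetric])
qed

lemma pow_nonzero:
  assumes "a \<in> carrier R" "a \<noteq> \<zero>" shows "a [^] (n::nat) \<noteq> \<zero>"
  using assms by (induction n) (auto simp: integral_iff)

lemma power_add_mults:
  assumes A: "subring A R" and "x \<in> A" "r \<in> A" "q \<in> A"
  shows "\<exists>w\<in>A. (x \<otimes> r \<oplus> q) [^] (n::nat) = x \<otimes> w \<oplus> q [^] n"
proof (induction n)
  case 0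
  have "\<one> = x \<otimes> \<zero> \<oplus> \<one>" using subring_closed[OF A] assms by simp
  then show ?case using subring_closed(2)[OF A] by (intro bexI[of _ \<zero>]) simp_all
next
  case (Suc n)
  then obtain w where w: "w \<in> A" "(x \<otimes> r \<oplus> q) [^] n = x \<otimes> w \<oplus> q [^] n" by blast
  define p where "p = q [^] n"
  have pA: "p \<in> A" using subring_closed[OF A] assms by (simp add: p_def)
  have c: "x \<in> carrier R" "r \<in> carrier R" "q \<in> carrier R" "w \<in> carrier R" "p \<in> carrier R"
    using subring_closed(1)[OF A] assms w pA by auto
  have "(x \<otimes> r \<oplus> q) [^] Suc n = (x \<otimes> w \<oplus> p) \<otimes> (x \<otimes> r \<oplus> q)"
    using w by (simp add: p_def)
  also have "\<dots> = x \<otimes> (w \<otimes> (x \<otimes> r \<oplus> q) \<oplus> p \<otimes> r) \<oplus> p \<otimes> q"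
    using c by algebra
  finally have "(x \<otimes> r \<oplus> q) [^] Suc n = x \<otimes> (w \<otimes> (x \<otimes> r \<oplus> q) \<oplus> p \<otimes> r) \<oplus> q [^] Suc n"
    by (simp add: p_def)
  moreover have "w \<otimes> (x \<otimes> r \<oplus> q) \<oplus> p \<otimes> r \<in> A"
    using subring_closed[OF A] assms w(1) pA by simp
  ultimately show ?case by (intro bexI)
qed

lemma linI: "r \<in> A \<Longrightarrow> s \<in> A \<Longrightarrow> a \<otimes> r \<oplus> b \<otimes> s \<in> lin A a b"
  unfolding lin_def by blast

lemma linE: assumes "c \<in> lin A a b" obtains r s where "r \<in> A" "s \<in> A" "c = a \<otimes> r \<oplus> b \<otimes> s"
  using assms unfolding lin_def by blast

lemma lin_generators:
  assumes "subring A R" "x \<in> A" "y \<in> A"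
  shows "x \<in> lin A x y" "y \<in> lin A x y"
proof -
  note Ac = subring_closed[OF assms(1)]
  show "x \<in> lin A x y" "y \<in> lin A x y"
    using linI[OF Ac(3) Ac(2), of x y] linI[OF Ac(2) Ac(3), of x y] assms Ac(1) by simp_all
qed

lemma lin_commute:
  assumes "subring A R" "a \<in> carrier R" "b \<in> carrier R"
  shows "lin A a b = lin A b a"
proof -
  have "lin A a b \<subseteq> lin A b a" if "a \<in> carrier R" "b \<in> carrier R" for a b
  proof
    fix z assume "z \<in> lin A a b"
    then obtain r s where "r \<in> A" "s \<in> A" "z = a \<otimes> r \<oplus> b \<otimes> s" by (rule linE)
    then show "z \<in> lin A b a" using linI[of s A r b a] that subring_closed(1)[OF assms(1)] by (simp add: a_comm)
  qed
  then show ?thesis using assms by (simp add: subset_antisym)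
qed

lemma multsI: "r \<in> A \<Longrightarrow> a \<otimes> r \<in> mults A a"
  unfolding mults_def by blast

lemma multsE: assumes "c \<in> mults A a" obtains r where "r \<in> A" "c = a \<otimes> r"
  using assms unfolding mults_def by blast

lemma mults_add:
  assumes A: "subring A R" and a: "a \<in> carrier R" and "c \<in> mults A a" "d \<in> mults A a"
  shows "c \<oplus> d \<in> mults A a"
proof -
  obtain r s where rs: "r \<in> A" "c = a \<otimes> r" "s \<in> A" "d = a \<otimes> s" using assms by (auto elim!: multsE)
  have "c \<oplus> d = a \<otimes> (r \<oplus> s)" using rs a subring_closed(1)[OF A] by (simp add: r_distr)
  then show ?thesis using multsI[of "r \<oplus> s" A a] subring_closed[OF A] rs by simp
qed

lemma mults_times:
  assumes A: "subring A R" and a: "a \<in> carrier R" and "c \<in> mults A a" "d \<in> A"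
  shows "c \<otimes> d \<in> mults A a"
proof -
  obtain r where rs: "r \<in> A" "c = a \<otimes> r" using assms by (auto elim!: multsE)
  have "c \<otimes> d = a \<otimes> (r \<otimes> d)" using rs a assms subring_closed(1)[OF A] by (simp add: m_assoc)
  then show ?thesis using multsI[of "r \<otimes> d" A a] subring_closed[OF A] rs assms by simp
qed

lemma radical_of_generators:
  assumes A: "subring A R" and xy: "x \<in> A" "y \<in> A" and b: "b \<in> A"
    and px: "x [^] (k::nat) \<in> mults A b" and py: "y [^] (l::nat) \<in> mults A b"
    and c: "c \<in> lin A x y"
  shows "\<exists>n::nat. c [^] n \<in> mults A b"
proof -
  note Ac = subring_closed[OF A]
  obtain r s where rs: "r \<in> A" "s \<in> A" "c = x \<otimes> r \<oplus> y \<otimes> s" using c by (rule linE)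
  obtain w where w: "w \<in> A" "c [^] l = x \<otimes> w \<oplus> (y \<otimes> s) [^] l"
    using power_add_mults[OF A xy(1) rs(1), of "y \<otimes> s" l] Ac xy rs by auto
  have "(y \<otimes> s) [^] l = y [^] l \<otimes> s [^] l"
    using Ac(1) xy rs by (simp add: nat_pow_distrib)
  then have cl: "c [^] l = y [^] l \<otimes> s [^] l \<oplus> x \<otimes> w"
    using w Ac(1) xy rs by (simp add: a_comm)
  obtain w' where w': "w' \<in> A" "(c [^] l) [^] k = y [^] l \<otimes> w' \<oplus> (x \<otimes> w) [^] k"
    using power_add_mults[OF A _ _ , of "y [^] l" "s [^] l" "x \<otimes> w" k] Ac xy rs w cl by auto
  have "(x \<otimes> w) [^] k = x [^] k \<otimes> w [^] k"
    using Ac(1) xy w by (simp add: nat_pow_distrib)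
  then have "(c [^] l) [^] k \<in> mults A b"
    using w' w(1) px py Ac b by (auto intro!: mults_add[OF A] mults_times[OF A])
  moreover have "(c [^] l) [^] k = c [^] (l * k)"
    using rs Ac xy by (simp add: nat_pow_pow)
  ultimately show ?thesis by auto
qed

lemma surfaceE:
  assumes "surface A"
  obtains x y where "x \<in> A" "y \<in> A" "nonunits A = lin A x y"
  using assms unfolding surface_def by blast

lemma surface_subring: "surface A \<Longrightarrow> subring A R"
  by (simp add: surface_def)

lemma surface_fraction:
  assumes "surface A" "z \<in> carrier R"
  obtains a b where "a \<in> A" "b \<in> A" "b \<noteq> \<zero>" "z \<otimes> b = a" "primary_pair A a b"
  using assms unfolding surface_def by blast

lemma surface_dim_at_least_two:
  assumes "surface A" "b \<in> nonunits A" "\<And>c. c \<in> nonunits A \<Longrightarrow> \<exists>n::nat. c [^] n \<in> mults A b"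
  shows False
  using assms unfolding surface_def dim_at_least_two_def by blast

lemma nonunits_in: "a \<in> nonunits A \<Longrightarrow> a \<in> A"
  by (simp add: nonunits_def)

lemma unit_in: assumes "a \<in> A" "a \<notin> nonunits A" obtains b where "b \<in> A" "a \<otimes> b = \<one>"
  using assms by (auto simp: nonunits_def)

lemma unit_mono: "A \<subseteq> B \<Longrightarrow> u \<in> A \<Longrightarrow> u \<notin> nonunits A \<Longrightarrow> u \<notin> nonunits B"
  by (auto simp: nonunits_def)

lemma one_not_nonunit: "subring A R \<Longrightarrow> \<one> \<notin> nonunits A"
  using subring_closed(3) by (force simp: nonunits_def)

lemma surface_nonunits:
  assumes "surface A"
  shows "\<zero> \<in> nonunits A"
    "a \<in> nonunits A \<Longrightarrow> b \<in> nonunits A \<Longrightarrow> a \<oplus> b \<in> nonunits A"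
    "a \<in> nonunits A \<Longrightarrow> r \<in> A \<Longrightarrow> a \<otimes> r \<in> nonunits A"
    "a \<in> nonunits A \<Longrightarrow> r \<in> A \<Longrightarrow> r \<otimes> a \<in> nonunits A"
    "a \<in> nonunits A \<Longrightarrow> \<ominus> a \<in> nonunits A"
    "a \<in> nonunits A \<Longrightarrow> b \<in> nonunits A \<Longrightarrow> a \<ominus> b \<in> nonunits A"
proof -
  have A: "subring A R" using assms by (rule surface_subring)
  note Ac = subring_closed[OF A]
  obtain x y where xy: "x \<in> A" "y \<in> A" "nonunits A = lin A x y" using assms by (rule surfaceE)
  have c: "x \<in> carrier R" "y \<in> carrier R" using xy Ac by auto
  show "\<zero> \<in> nonunits A"
    using linI[OF Ac(2) Ac(2), of x y] c by (simp add: xy(3))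
  show add: "a \<oplus> b \<in> nonunits A" if ab: "a \<in> nonunits A" "b \<in> nonunits A" for a b
  proof -
    obtain r s t u where *: "r \<in> A" "s \<in> A" "t \<in> A" "u \<in> A" "a = x \<otimes> r \<oplus> y \<otimes> s" "b = x \<otimes> t \<oplus> y \<otimes> u"
      using ab unfolding xy(3) by (auto elim!: linE)
    have rc: "r \<in> carrier R" "s \<in> carrier R" "t \<in> carrier R" "u \<in> carrier R" using * Ac by auto
    have "a \<oplus> b = x \<otimes> (r \<oplus> t) \<oplus> y \<otimes> (s \<oplus> u)" unfolding * using c rc by algebra
    then show ?thesis using linI[of "r \<oplus> t" A "s \<oplus> u" x y] * Ac by (simp add: xy(3))
  qed
  show times: "a \<otimes> r \<in> nonunits A" if "a \<in> nonunits A" "r \<in> A" for a r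
    using nonunits_times[OF A that] .
  show "r \<otimes> a \<in> nonunits A" if "a \<in> nonunits A" "r \<in> A" for a r
    using times[OF that] that Ac(1) nonunits_in by (simp add: m_comm)
  show neg: "\<ominus> a \<in> nonunits A" if "a \<in> nonunits A" for a
    using times[OF that Ac(6)[OF Ac(3)]] Ac(1) nonunits_in[OF that] by (simp add: r_minus)
  show "a \<ominus> b \<in> nonunits A" if "a \<in> nonunits A" "b \<in> nonunits A" for a b
    unfolding minus_eq using add neg that by simp
qed

lemma surface_units_mult:
  assumes A: "subring A R" and "a \<in> A" "b \<in> A" "a \<notin> nonunits A" "b \<notin> nonunits A"
  shows "a \<otimes> b \<notin> nonunits A"
proof -
  note Ac = subring_closed[OF A]
  obtain c d where cd: "c \<in> A" "a \<otimes> c = \<one>" "d \<in> A" "b \<otimes> d = \<one>"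
    using assms by (metis unit_in)
  have "(a \<otimes> b) \<otimes> (c \<otimes> d) = (a \<otimes> c) \<otimes> (b \<otimes> d)"
    using cd(1,3) assms Ac(1) by (simp add: m_ac)
  then have "(a \<otimes> b) \<otimes> (c \<otimes> d) = \<one>" using cd by simp
  then show ?thesis using cd Ac(4) by (auto simp: nonunits_def)
qed

lemma surface_units_pow:
  assumes A: "subring A R" and "a \<in> A" "a \<notin> nonunits A"
  shows "a [^] (n::nat) \<notin> nonunits A"
proof (induction n)
  case 0
  then show ?case using one_not_nonunit[OF A] by simp
next
  case (Suc n)
  then show ?case using surface_units_mult[OF A _ _ Suc assms(3)] subring_closed[OF A] assms by simp
qed

lemma surface_nonunits_pow:
  assumes "surface A" "a \<in> nonunits A" "n > (0::nat)"
  shows "a [^] n \<in> nonunits A"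
proof -
  obtain m where "n = Suc m" using assms(3) by (cases n) auto
  then show ?thesis
    using surface_nonunits(4)[OF assms(1,2)] subring_closed(8)[OF surface_subring[OF assms(1)]] nonunits_in[OF assms(2)]
    by simp
qed

lemma unit_add_nonunit:
  assumes "surface A" "a \<in> A" "a \<notin> nonunits A" "b \<in> nonunits A"
  shows "a \<oplus> b \<notin> nonunits A"
proof
  assume "a \<oplus> b \<in> nonunits A"
  then have "(a \<oplus> b) \<ominus> b \<in> nonunits A" using surface_nonunits(6) assms by blast
  moreover have "a \<in> carrier R" "b \<in> carrier R"
    using subring_closed(1)[OF surface_subring] nonunits_in assms by blast+
  then have "(a \<oplus> b) \<ominus> b = a" by algebra
  ultimately show False using assms by simp
qed

text \<open>
  Otherwise the maximal ideal would be the radical of the ideal generated by \<open>b\<close>.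
\<close>
lemma maximal_ideal_not_principal:
  assumes "surface A" "b \<in> nonunits A"
  shows "\<not> nonunits A \<subseteq> mults A b"
proof
  assume *: "nonunits A \<subseteq> mults A b"
  show False
  proof (rule surface_dim_at_least_two[OF assms])
    fix c assume "c \<in> nonunits A"
    then have "c [^] (1::nat) \<in> mults A b"
      using * subring_closed(1)[OF surface_subring[OF assms(1)]] nonunits_in by auto
    then show "\<exists>n::nat. c [^] n \<in> mults A b" ..
  qed
qed

text \<open>
  Take \<open>z = y/x\<close>, where \<open>x\<close> and \<open>y\<close> generate the maximal ideal: if \<open>z\<close> or its inverse were in
  \<open>A\<close>, this ideal would be principal.
\<close>
lemma surface_not_valuation:
  assumes "surface A"
  obtains z where "z \<in> carrier R" "z \<notin> A" "\<And>w. w \<in> A \<Longrightarrow> z \<otimes> w \<noteq> \<one>"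
proof -
  have A: "subring A R" using assms by (rule surface_subring)
  note Ac = subring_closed[OF A]
  obtain x y where xy: "x \<in> A" "y \<in> A" "nonunits A = lin A x y" using assms by (rule surfaceE)
  have c: "x \<in> carrier R" "y \<in> carrier R" using xy Ac by auto
  have M: "x \<in> nonunits A" "y \<in> nonunits A"
    using lin_generators[OF A xy(1,2)] by (simp_all add: xy(3))
  have no_div: False if "a \<in> nonunits A" "x \<in> mults A a" "y \<in> mults A a" for a
  proof -
    have "a \<in> carrier R" using that nonunits_in Ac(1) by blast
    then have "nonunits A \<subseteq> mults A a"
      unfolding xy(3) using that by (auto elim!: linE intro!: mults_add[OF A] mults_times[OF A])
    then show False using maximal_ideal_not_principal[OF assms that(1)] by simp
  qed
  have self: "a \<in> mults A a" if "a \<in> A" for a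
    using multsI[OF Ac(3), of a] that Ac(1) by simp
  have "x \<noteq> \<zero>"
    using no_div[OF M(2)] self[OF xy(2)] multsI[OF Ac(2), of y] c by auto
  then obtain z where z: "z \<in> carrier R" "y = x \<otimes> z" using divide_ex c by blast
  show ?thesis
  proof (rule that[OF z(1)])
    show "z \<notin> A" using no_div[OF M(1)] self[OF xy(1)] multsI[of z A x] z by auto
    show "z \<otimes> w \<noteq> \<one>" if w: "w \<in> A" for w
    proof
      assume "z \<otimes> w = \<one>"
      then have "y \<otimes> w = x" using z c w Ac(1) by (simp add: m_assoc)
      then show False using no_div[OF M(2)] self[OF xy(2)] multsI[OF w, of y] by simp
    qed
  qed
qed

text \<open>
  Suppose that a nonunit \<open>c\<close> of \<open>A\<close> is a unit of \<open>B\<close>. A fraction in lowest terms over \<open>A\<close> has a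
  power of \<open>c\<close> in the ideal generated by its numerator and denominator, so one of the two is a
  unit of \<open>B\<close>. Hence \<open>B\<close> would be a valuation ring.
\<close>
lemma surface_dominates:
  assumes A: "surface A" and B: "surface B" and "A \<subseteq> B"
  shows "nonunits A \<subseteq> nonunits B"
proof (rule ccontr)
  assume "\<not> ?thesis"
  then obtain c where c: "c \<in> nonunits A" "c \<notin> nonunits B" by blast
  have cB: "c \<in> B" using c assms(3) nonunits_in by blast
  obtain z where z: "z \<in> carrier R" "z \<notin> B" "\<And>w. w \<in> B \<Longrightarrow> z \<otimes> w \<noteq> \<one>"
    using surface_not_valuation[OF B] by blast
  have sB: "subring B R" using B by (rule surface_subring)
  note Bc = subring_closed[OF sB]
  obtain a b where ab: "a \<in> A" "b \<in> A" "b \<noteq> \<zero>" "z \<otimes> b = a" "primary_pair A a b"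
    using surface_fraction[OF A z(1)] by blast
  have abB: "a \<in> B" "b \<in> B" using ab assms(3) by auto
  obtain n :: nat where "c [^] n \<in> lin A a b" using ab(5) c(1) unfolding primary_pair_def by blast
  then obtain r s where rs: "r \<in> A" "s \<in> A" "c [^] n = a \<otimes> r \<oplus> b \<otimes> s" by (rule linE)
  have "c [^] n \<notin> nonunits B" by (rule surface_units_pow[OF sB cB c(2)])
  then have "a \<notin> nonunits B \<or> b \<notin> nonunits B"
    using rs assms(3) surface_nonunits(2,3)[OF B] by (metis subsetD)
  then show False
  proof
    assume "a \<notin> nonunits B"
    then obtain e where e: "e \<in> B" "a \<otimes> e = \<one>" using unit_in abB by blast
    then have "z \<otimes> (b \<otimes> e) = \<one>" using ab(4) z(1) abB Bc(1) by (metis m_assoc)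
    then show False using z(3)[of "b \<otimes> e"] e(1) abB by (simp add: Bc)
  next
    assume "b \<notin> nonunits B"
    then obtain e where e: "e \<in> B" "b \<otimes> e = \<one>" using unit_in abB by blast
    then have "z = a \<otimes> e" using ab(4) z(1) abB Bc(1) by (metis m_assoc r_one)
    then show False using z(2) e(1) abB by (simp add: Bc)
  qed
qed

text \<open>
  A surface has depth two. If \<open>z = a/b\<close> in lowest terms, then the hypothesis puts a power of
  every nonunit into \<open>bA\<close>, and so \<open>b\<close> is a unit.
\<close>
lemma surface_saturated:
  assumes "surface A" "z \<in> carrier R" and pow: "\<And>c. c \<in> nonunits A \<Longrightarrow> \<exists>n::nat. z \<otimes> c [^] n \<in> A"
  shows "z \<in> A"
proof -
  have sA: "subring A R" using assms(1) by (rule surface_subring)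
  note Ac = subring_closed[OF sA]
  obtain a b where ab: "a \<in> A" "b \<in> A" "b \<noteq> \<zero>" "z \<otimes> b = a" "primary_pair A a b"
    using surface_fraction[OF assms(1,2)] by blast
  have abC: "a \<in> carrier R" "b \<in> carrier R" using ab Ac by auto
  have "b \<notin> nonunits A"
  proof
    assume b: "b \<in> nonunits A"
    show False
    proof (rule surface_dim_at_least_two[OF assms(1) b])
      fix c assume c: "c \<in> nonunits A"
      then have cC: "c \<in> carrier R" "c \<in> A" using nonunits_in Ac(1) by blast+
      obtain n :: nat where n: "z \<otimes> c [^] n \<in> A" using pow[OF c] by blast
      obtain k :: nat where "c [^] k \<in> lin A a b" using ab(5) c unfolding primary_pair_def by blast
      then obtain r s where rs: "r \<in> A" "s \<in> A" "c [^] k = a \<otimes> r \<oplus> b \<otimes> s" by (rule linE)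
      have rsC: "r \<in> carrier R" "s \<in> carrier R" using rs Ac by auto
      define d where "d = c [^] n"
      have d: "d \<in> carrier R" "d \<in> A" using cC Ac by (auto simp: d_def)
      have "c [^] (n + k) = d \<otimes> c [^] k"
        using cC by (simp add: d_def nat_pow_mult)
      also have "\<dots> = b \<otimes> ((z \<otimes> d) \<otimes> r \<oplus> d \<otimes> s)"
        unfolding rs(3) ab(4)[symmetric] using abC(2) rsC d(1) assms(2) by algebra
      finally have "c [^] (n + k) \<in> mults A b"
        using multsI[of "(z \<otimes> d) \<otimes> r \<oplus> d \<otimes> s" A b] n d rs Ac by (simp add: d_def)
      then show "\<exists>n::nat. c [^] n \<in> mults A b" ..
    qed
  qed
  then obtain e where e: "e \<in> A" "b \<otimes> e = \<one>" using unit_in ab by blast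
  then have "z = a \<otimes> e" using ab(4) assms(2) abC Ac(1) by (metis m_assoc r_one)
  then show "z \<in> A" using e(1) ab(1) by (simp add: Ac)
qed

lemma primary_pair_nonzero:
  assumes "surface A" "x \<in> nonunits A" "y \<in> nonunits A" "primary_pair A x y"
  shows "x \<noteq> \<zero>"
proof
  assume x0: "x = \<zero>"
  have sA: "subring A R" using assms(1) by (rule surface_subring)
  note Ac = subring_closed[OF sA]
  have yC: "y \<in> carrier R" using assms nonunits_in Ac(1) by blast
  show False
  proof (rule surface_dim_at_least_two[OF assms(1,3)])
    fix c assume "c \<in> nonunits A"
    then obtain n :: nat where "c [^] n \<in> lin A x y"
      using assms(4) unfolding primary_pair_def by blast
    then have "c [^] n \<in> mults A y"
      using x0 yC by (auto elim!: linE intro!: multsI simp: Ac)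
    then show "\<exists>n::nat. c [^] n \<in> mults A y" ..
  qed
qed

text \<open>
  Elements \<open>x, y\<close> as in the hypothesis form a quasi-regular sequence. The first term of a
  relation \<open>c y\<^sup>n + x F = 0\<close> shows that \<open>c/x\<close> becomes an element of \<open>A\<close> after multiplication by
  \<open>x\<close> or \<open>y\<^sup>n\<close>; so \<open>c/x \<in> A\<close> by the previous lemma, and division of the relation by \<open>x\<close> lowers
  the degree.
\<close>
lemma zero_form_nonunits:
  assumes A: "surface A" and xy: "x \<in> nonunits A" "y \<in> nonunits A" "primary_pair A x y"
    and "set cs \<subseteq> A" "form x y cs = \<zero>"
  shows "set cs \<subseteq> nonunits A"
  using assms(5,6)
proof (induction "length cs" arbitrary: cs)
  case 0
  then show ?case by simp
next
  case (Suc n)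
  have sA: "subring A R" using A by (rule surface_subring)
  note Ac = subring_closed[OF sA]
  note M = surface_nonunits[OF A]
  have xyA: "x \<in> A" "y \<in> A" using xy nonunits_in by auto
  have xyC: "x \<in> carrier R" "y \<in> carrier R" using xyA Ac by auto
  have x0: "x \<noteq> \<zero>" by (rule primary_pair_nonzero[OF A xy])
  obtain c ds where cs: "cs = c # ds" "length ds = n" using Suc by (cases cs) auto
  have cA: "c \<in> A" "set ds \<subseteq> A" using Suc cs by auto
  have cC: "c \<in> carrier R" "set ds \<subseteq> carrier R" using cA Ac by auto
  define F where "F = form x y ds"
  have F: "F \<in> A" "F \<in> carrier R" using form_in[OF sA xyA cA(2)] Ac by (auto simp: F_def)
  have eq: "c \<otimes> y [^] n \<oplus> x \<otimes> F = \<zero>" using Suc.prems cs by (simp add: F_def)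
  obtain z where z: "z \<in> carrier R" "c = x \<otimes> z" using divide_ex xyC x0 cC by blast
  define p where "p = y [^] n"
  have p: "p \<in> carrier R" "p \<in> A" using xyC xyA Ac by (auto simp: p_def)
  have "x \<otimes> (z \<otimes> p \<oplus> F) = c \<otimes> p \<oplus> x \<otimes> F"
    unfolding z(2) using xyC z(1) p(1) F(2) by algebra
  then have "x \<otimes> (z \<otimes> p \<oplus> F) = \<zero>" using eq by (simp add: p_def)
  then have zp: "z \<otimes> p \<oplus> F = \<zero>" using x0 xyC z p F by (simp add: integral_iff)
  then have zp': "z \<otimes> p = \<ominus> F" using z p F by (simp add: minus_equality)
  have "z \<in> A"
  proof (rule surface_saturated[OF A z(1)])
    fix m assume m: "m \<in> nonunits A"
    obtain k :: nat where "m [^] k \<in> lin A x y" using xy(3) m unfolding primary_pair_def by blast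
    then obtain r s where rs: "r \<in> A" "s \<in> A" "m [^] k = x \<otimes> r \<oplus> y \<otimes> s" by (rule linE)
    obtain w where w: "w \<in> A" "(m [^] k) [^] n = x \<otimes> w \<oplus> (y \<otimes> s) [^] n"
      using power_add_mults[OF sA xyA(1) rs(1), of "y \<otimes> s" n] Ac xyA rs by auto
    define q where "q = s [^] n"
    have q: "q \<in> carrier R" "q \<in> A" using rs Ac by (auto simp: q_def)
    have wC: "w \<in> carrier R" using w Ac by simp
    have "(y \<otimes> s) [^] n = p \<otimes> q"
      using rs xyC Ac by (simp add: p_def q_def nat_pow_distrib)
    moreover have "m [^] (k * n) = (m [^] k) [^] n"
      using m nonunits_in Ac by (simp add: nat_pow_pow)
    ultimately have "z \<otimes> m [^] (k * n) = z \<otimes> (x \<otimes> w \<oplus> p \<otimes> q)" using w by simp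
    also have "\<dots> = (x \<otimes> z) \<otimes> w \<oplus> (z \<otimes> p) \<otimes> q"
      using z(1) xyC wC p(1) q(1) by algebra
    also have "\<dots> = c \<otimes> w \<oplus> (\<ominus> F) \<otimes> q"
      using zp' z(2) by simp
    also have "\<dots> \<in> A" using cA w q F Ac by simp
    finally show "\<exists>n::nat. z \<otimes> m [^] n \<in> A" ..
  qed
  then have cM: "c \<in> nonunits A" using z(2) M(3) xy(1) by simp
  have "set ds \<subseteq> nonunits A"
  proof (cases ds)
    case Nil
    then show ?thesis by simp
  next
    case (Cons c1 es)
    have c1: "c1 \<in> A" "c1 \<in> carrier R" "set es \<subseteq> A" "set es \<subseteq> carrier R" using cA Ac Cons by auto
    define g where "g = form x y es"
    define b where "b = y [^] length es"
    have gb: "g \<in> carrier R" "b \<in> carrier R"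
      using c1 xyC by (auto simp: g_def b_def)
    have n: "n = Suc (length es)" using cs Cons by simp
    have "form x y ((c1 \<oplus> z \<otimes> y) # es) = (c1 \<oplus> z \<otimes> y) \<otimes> b \<oplus> x \<otimes> g"
      by (simp add: g_def b_def)
    also have "\<dots> = z \<otimes> (b \<otimes> y) \<oplus> (c1 \<otimes> b \<oplus> x \<otimes> g)"
      using gb z(1) xyC c1(2) by algebra
    also have "\<dots> = z \<otimes> p \<oplus> F"
      by (simp add: p_def F_def n Cons g_def b_def)
    finally have "form x y ((c1 \<oplus> z \<otimes> y) # es) = \<zero>" using zp by simp
    moreover have "set ((c1 \<oplus> z \<otimes> y) # es) \<subseteq> A" using c1 \<open>z \<in> A\<close> xyA Ac by simp
    ultimately have IH: "set ((c1 \<oplus> z \<otimes> y) # es) \<subseteq> nonunits A"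
      using Suc.hyps(1)[of "(c1 \<oplus> z \<otimes> y) # es"] n by simp
    have "(c1 \<oplus> z \<otimes> y) \<ominus> z \<otimes> y \<in> nonunits A"
      using IH xy(2) \<open>z \<in> A\<close> by (auto intro!: M)
    moreover have "(c1 \<oplus> z \<otimes> y) \<ominus> z \<otimes> y = c1"
      using c1(2) z(1) xyC by algebra
    ultimately show ?thesis using IH Cons by simp
  qed
  then show ?case using cM cs by simp
qed

text \<open>
  The coefficients of a form are determined modulo nonunits by its value modulo \<open>m (x, y)\<^sup>n\<close>:
  subtract two forms with the same value and apply quasi-regularity.
\<close>
lemma form_in_nonunit_forms:
  assumes A: "surface A" and xy: "x \<in> nonunits A" "y \<in> nonunits A" "primary_pair A x y"
    and cs: "set cs \<subseteq> A" and f: "form x y cs \<in> forms (nonunits A) x y (length cs)"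
  shows "set cs \<subseteq> nonunits A"
proof -
  have sA: "subring A R" using A by (rule surface_subring)
  note Ac = subring_closed[OF sA]
  note M = surface_nonunits[OF A]
  have MA: "nonunits A \<subseteq> A" using nonunits_in by blast
  have C: "A \<subseteq> carrier R" using Ac(1) by blast
  have xyC: "x \<in> carrier R" "y \<in> carrier R" using xy MA C by auto
  obtain ds where ds: "form x y cs = form x y ds" "length ds = length cs" "set ds \<subseteq> nonunits A"
    using f by (auto simp: forms_def)
  define es where "es = map2 (\<oplus>) cs (map ((\<otimes>) (\<ominus> \<one>)) ds)"
  have dsC: "set ds \<subseteq> carrier R" using ds MA C by blast
  have csC: "set cs \<subseteq> carrier R" using cs C by blast
  have "form x y es = form x y cs \<oplus> \<ominus> \<one> \<otimes> form x y ds"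
    unfolding es_def using xyC csC dsC ds(2) by (subst form_add) (auto simp: form_smult)
  also have "\<dots> = \<zero>"
    using xyC csC dsC by (simp add: ds(1) l_minus r_neg)
  finally have z: "form x y es = \<zero>" .
  have len: "length es = length cs" using ds(2) by (simp add: es_def)
  have nth: "es ! i = cs ! i \<ominus> ds ! i" if "i < length cs" for i
  proof -
    have "ds ! i \<in> carrier R" using that ds(2) dsC nth_mem[of i ds] by auto
    then show ?thesis using that ds(2) by (simp add: es_def l_minus minus_eq)
  qed
  have "set es \<subseteq> A"
  proof
    fix e assume "e \<in> set es"
    then obtain i where i: "i < length cs" "e = es ! i" using len by (auto simp: in_set_conv_nth)
    then have "cs ! i \<in> A" "ds ! i \<in> A" using cs ds MA by (auto simp: subset_iff)
    then show "e \<in> A" using nth i Ac by simp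
  qed
  then have esM: "set es \<subseteq> nonunits A" using zero_form_nonunits[OF A xy _ z] by simp
  show ?thesis
  proof
    fix c assume "c \<in> set cs"
    then obtain i where i: "i < length cs" "c = cs ! i" by (auto simp: in_set_conv_nth)
    have "es ! i \<in> nonunits A" "ds ! i \<in> nonunits A"
      using i len ds esM nth_mem by (metis subsetD)+
    then have "es ! i \<oplus> ds ! i \<in> nonunits A" by (rule M)
    moreover have "cs ! i \<in> carrier R" "ds ! i \<in> carrier R"
      using i csC dsC ds(2) nth_mem by (metis subsetD)+
    then have "(cs ! i \<ominus> ds ! i) \<oplus> ds ! i = cs ! i" by algebra
    ultimately show "c \<in> nonunits A" using nth i by simp
  qed
qed

text \<open>
  If \<open>x\<close> and \<open>y\<close> generate the maximal ideal \<open>m\<close>, then \<open>m (x, y)\<^sup>n \<subseteq> (x, y)\<^sup>n\<^sup>+\<^sup>1\<close>.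
\<close>
lemma forms_nonunits_up:
  assumes A: "surface A" and M: "nonunits A = lin A x y" and xy: "x \<in> A" "y \<in> A"
    and "set cs \<subseteq> nonunits A"
  shows "form x y cs \<in> forms A x y (Suc (length cs))"
  using assms(5)
proof (induction cs)
  case Nil
  have "\<zero> \<in> A" using subring_closed(2)[OF surface_subring[OF A]] .
  moreover have "form x y [] = form x y [\<zero>]"
    using xy subring_closed(1)[OF surface_subring[OF A]] by simp
  ultimately show ?case using formsI[of "[\<zero>]" A x y] by simp
next
  case (Cons c cs)
  have sA: "subring A R" using A by (rule surface_subring)
  note Ac = subring_closed[OF sA]
  have C: "A \<subseteq> carrier R" using Ac(1) by blast
  have xyC: "x \<in> carrier R" "y \<in> carrier R" using xy Ac by auto
  obtain a b where ab: "a \<in> A" "b \<in> A" "c = x \<otimes> a \<oplus> y \<otimes> b"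
    using Cons.prems by (auto simp: M elim!: linE)
  have abC: "a \<in> carrier R" "b \<in> carrier R" using ab Ac by auto
  define n where "n = length cs"
  define p where "p = y [^] n"
  define g where "g = form x y cs"
  have MA: "set cs \<subseteq> A" using Cons.prems nonunits_in by auto
  have g: "g \<in> carrier R" using form_in[OF sA xy MA] Ac by (simp add: g_def)
  have p: "p \<in> carrier R" using xyC by (simp add: p_def)
  have "form x y (c # cs) = x \<otimes> (a \<otimes> p) \<oplus> y \<otimes> (b \<otimes> p) \<oplus> x \<otimes> g"
  proof -
    have "(x \<otimes> a \<oplus> y \<otimes> b) \<otimes> p \<oplus> x \<otimes> g = x \<otimes> (a \<otimes> p) \<oplus> y \<otimes> (b \<otimes> p) \<oplus> x \<otimes> g"
      using xyC abC p g by algebra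
    then show ?thesis by (simp add: ab p_def n_def g_def)
  qed
  moreover have "a \<otimes> p \<in> forms A x y (Suc n)" "b \<otimes> p \<in> forms A x y (Suc n)"
    unfolding p_def by (rule const_times_power_forms[OF C Ac(2) xyC]; fact)+
  moreover have "g \<in> forms A x y (Suc n)" using Cons by (simp add: g_def n_def)
  ultimately show ?case
    using forms_add[OF C xyC] forms_times_left[OF C Ac(2) xyC] forms_times_right[OF C Ac(2) xyC] Ac(5)
    by (simp add: n_def)
qed

text \<open>
  Conversely \<open>(x, y)\<^sup>n\<^sup>+\<^sup>1 \<subseteq> m (x, y)\<^sup>n\<close> for nonunits \<open>x\<close> and \<open>y\<close>.
\<close>
lemma forms_nonunits_down:
  assumes A: "surface A" and xy: "x \<in> nonunits A" "y \<in> nonunits A"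
    and z: "z \<in> forms A x y (Suc (Suc n))"
  shows "z \<in> forms (nonunits A) x y (Suc n)"
proof -
  have sA: "subring A R" using A by (rule surface_subring)
  note Ac = subring_closed[OF sA]
  note M = surface_nonunits[OF A]
  have C: "A \<subseteq> carrier R" using Ac(1) by blast
  have MC: "nonunits A \<subseteq> carrier R" using nonunits_in Ac(1) by blast
  have xyC: "x \<in> carrier R" "y \<in> carrier R" using xy MC by auto
  obtain p q where pq: "p \<in> forms A x y (Suc n)" "q \<in> forms A x y (Suc n)" "z = x \<otimes> p \<oplus> y \<otimes> q"
    using forms_SucE[OF C Ac(2) xyC z] by blast
  have "x \<otimes> p \<in> forms (nonunits A) x y (Suc n)" "y \<otimes> q \<in> forms (nonunits A) x y (Suc n)"
    by (rule forms_smult[OF C xyC _ _ pq(1)] forms_smult[OF C xyC _ _ pq(2)]; use xyC M(3) xy in blast)+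
  then show ?thesis
    unfolding pq by (intro forms_add[OF MC xyC]) (auto intro: M)
qed

lemma forms_nonunits_decrease:
  assumes A: "surface A" and xy: "x \<in> nonunits A" "y \<in> nonunits A"
    and "m \<le> n" "z \<in> forms (nonunits A) x y (Suc n)"
  shows "z \<in> forms (nonunits A) x y (Suc m)"
  using assms(4,5)
proof (induction rule: inc_induct)
  case (step k)
  have "nonunits A \<subseteq> A" using nonunits_in by blast
  then show ?case using forms_nonunits_down[OF A xy] forms_mono step by metis
qed

text \<open>
  The initial form of \<open>a\<close>: its degree is the largest \<open>n\<close> with \<open>a \<in> m\<^sup>n\<close>.
\<close>
lemma primitive_form_exists:
  assumes A: "surface A" and M: "nonunits A = lin A x y" and xy: "x \<in> A" "y \<in> A"
    and a: "a \<in> A" "a \<noteq> \<zero>"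
  obtains cs n where "length cs = Suc n" "set cs \<subseteq> A" "\<not> set cs \<subseteq> nonunits A" "a = form x y cs"
proof -
  have sA: "subring A R" using A by (rule surface_subring)
  note Ac = subring_closed[OF sA]
  have xyC: "x \<in> carrier R" "y \<in> carrier R" using xy Ac by auto
  have xyM: "x \<in> nonunits A" "y \<in> nonunits A"
    using lin_generators[OF sA xy] by (simp_all add: M)
  obtain k where k: "a \<notin> forms A x y (Suc k)"
    using A a xyM unfolding surface_def adically_separated_def by blast
  define n where "n = (LEAST k. a \<notin> forms A x y (Suc k))"
  have n: "a \<notin> forms A x y (Suc n)" using k unfolding n_def by (rule LeastI)
  have "a = form x y [a]" using a Ac xyC by simp
  then have "a \<in> forms A x y (Suc 0)" using formsI[of "[a]" A x y] a by simp
  then obtain m where m: "n = Suc m" using n by (cases n) auto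
  have "a \<in> forms A x y (Suc m)"
    using not_less_Least[of m "\<lambda>k. a \<notin> forms A x y (Suc k)"] m unfolding n_def[symmetric] by simp
  then obtain cs where cs: "a = form x y cs" "length cs = Suc m" "set cs \<subseteq> A"
    by (auto simp: forms_def)
  moreover have "\<not> set cs \<subseteq> nonunits A"
    using forms_nonunits_up[OF A M xy, of cs] cs n m by auto
  ultimately show ?thesis using that by blast
qed

text \<open>
  This is the step from a ring to its quadratic transforms in Abhyankar's factorization theorem:
  the maximal ideal of \<open>A\<close> becomes principal in every larger surface \<open>B\<close>.

  Let \<open>w = a/b\<close> in lowest terms over \<open>A\<close> be an element of \<open>B\<close> outside \<open>A\<close>. As \<open>a = w b\<close>, powers
  of \<open>x\<close> and \<open>y\<close> are multiples of the nonunit \<open>b\<close> in \<open>B\<close>. Write \<open>x = d x'\<close> and \<open>y = d y'\<close>, where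
  \<open>x'/y'\<close> is in lowest terms over \<open>B\<close>. Then \<open>d\<close> is a nonunit, since otherwise the maximal ideal
  of \<open>B\<close> would be the radical of \<open>bB\<close>. Suppose that \<open>x'\<close> and \<open>y'\<close> are both nonunits, and write
  \<open>x' = p/q\<close> with \<open>p, q \<in> A\<close>. The initial forms of \<open>p\<close> and \<open>q\<close>, of degrees \<open>i\<close> and \<open>j\<close>, give
  \<open>x' d\<^sup>j Q = d\<^sup>i P\<close>, where \<open>P\<close> and \<open>Q\<close> are the values of these forms at \<open>x', y'\<close>. If \<open>i \<le> j\<close>,
  then \<open>P\<close> has nonunit coefficients because of the factor \<open>x'\<close>; if \<open>i > j\<close>, then \<open>x' Q\<close> does
  because of the factor \<open>d\<close>. Both contradict quasi-regularity, as units of \<open>A\<close> are units of \<open>B\<close>.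
\<close>
theorem surface_overring_comparable:
  assumes A: "surface A" and B: "surface B" and AB: "A \<subseteq> B" "A \<noteq> B"
    and M: "nonunits A = lin A x y" and xy: "x \<in> A" "y \<in> A"
  shows "y \<in> mults B x \<or> x \<in> mults B y"
proof (rule ccontr)
  assume no: "\<not> ?thesis"
  have sA: "subring A R" and sB: "subring B R" using A B by (auto intro: surface_subring)
  note Ac = subring_closed[OF sA] and Bc = subring_closed[OF sB]
  note MB = surface_nonunits[OF B]
  have dom: "nonunits A \<subseteq> nonunits B" by (rule surface_dominates[OF A B AB(1)])
  have xyC: "x \<in> carrier R" "y \<in> carrier R" using xy Ac by auto
  have xyB: "x \<in> B" "y \<in> B" using xy AB by auto
  have xyM: "x \<in> nonunits A" "y \<in> nonunits A"
    using lin_generators[OF sA xy] by (simp_all add: M)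
  have x0: "x \<noteq> \<zero>" using no multsI[OF Bc(2), of y] xyC by auto
  have y0: "y \<noteq> \<zero>" using no multsI[OF Bc(2), of x] xyC by auto

  obtain w where w: "w \<in> B" "w \<notin> A" using AB by blast
  obtain a b where ab: "a \<in> A" "b \<in> A" "b \<noteq> \<zero>" "w \<otimes> b = a" "primary_pair A a b"
    using surface_fraction[OF A Bc(1)[OF w(1)]] by blast
  have abC: "a \<in> carrier R" "b \<in> carrier R" "w \<in> carrier R" using ab w Ac Bc by auto
  have "b \<in> nonunits A"
  proof (rule ccontr)
    assume "b \<notin> nonunits A"
    then obtain e where e: "e \<in> A" "b \<otimes> e = \<one>" using unit_in ab by blast
    then have "w = a \<otimes> e" using ab(4) abC Ac(1) by (metis m_assoc r_one)
    then show False using w(2) e(1) ab(1) by (simp add: Ac)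
  qed
  then have bB: "b \<in> nonunits B" using dom by blast
  have b_pow: "\<exists>n::nat. c [^] n \<in> mults B b" if c: "c \<in> nonunits A" for c
  proof -
    obtain n :: nat where "c [^] n \<in> lin A a b" using ab(5) c unfolding primary_pair_def by blast
    then obtain r s where rs: "r \<in> A" "s \<in> A" "c [^] n = a \<otimes> r \<oplus> b \<otimes> s" by (rule linE)
    have "r \<in> carrier R" "s \<in> carrier R" using rs Ac by auto
    then have "c [^] n = b \<otimes> (w \<otimes> r \<oplus> s)"
      unfolding rs(3) ab(4)[symmetric] using abC(2,3) by algebra
    moreover have "w \<otimes> r \<oplus> s \<in> B" using w rs AB by (simp add: Bc subset_iff)
    ultimately show ?thesis using multsI by metis
  qed

  obtain z where z: "z \<in> carrier R" "x = y \<otimes> z" using divide_ex xyC y0 by blast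
  obtain x' y' where x'y': "x' \<in> B" "y' \<in> B" "y' \<noteq> \<zero>" "z \<otimes> y' = x'" "primary_pair B x' y'"
    using surface_fraction[OF B z(1)] by blast
  have x'y'C: "x' \<in> carrier R" "y' \<in> carrier R" using x'y' Bc by auto
  obtain d where d: "d \<in> carrier R" "y = y' \<otimes> d" using divide_ex x'y' x'y'C xyC by blast
  have yd: "y = d \<otimes> y'" using d x'y'C by (simp add: m_comm)
  have xd: "x = d \<otimes> x'"
    unfolding z(2) x'y'(4)[symmetric] yd using d(1) x'y'C(2) z(1) by algebra
  have d0: "d \<noteq> \<zero>" using yd y0 x'y'C by auto
  have dB: "d \<in> B"
  proof (rule surface_saturated[OF B d(1)])
    fix m assume m: "m \<in> nonunits B"
    obtain n :: nat where "m [^] n \<in> lin B x' y'" using x'y'(5) m unfolding primary_pair_def by blast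
    then obtain r s where rs: "r \<in> B" "s \<in> B" "m [^] n = x' \<otimes> r \<oplus> y' \<otimes> s" by (rule linE)
    have "r \<in> carrier R" "s \<in> carrier R" using rs Bc by auto
    then have "d \<otimes> m [^] n = x \<otimes> r \<oplus> y \<otimes> s"
      unfolding rs(3) xd yd using d(1) x'y'C by algebra
    also have "\<dots> \<in> B" using rs xyB Bc by simp
    finally show "\<exists>n::nat. d \<otimes> m [^] n \<in> B" ..
  qed
  have cross: "x \<otimes> y' = y \<otimes> x'" unfolding xd yd using d(1) x'y'C by algebra
  have x'M: "x' \<in> nonunits B"
  proof (rule ccontr)
    assume "x' \<notin> nonunits B"
    then obtain e where e: "e \<in> B" "x' \<otimes> e = \<one>" using unit_in x'y' by blast
    have eC: "e \<in> carrier R" using e Bc by simp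
    have "y = (y \<otimes> x') \<otimes> e" using e(2) eC xyC x'y'C by (simp add: m_assoc)
    also have "\<dots> = x \<otimes> (y' \<otimes> e)" using cross[symmetric] eC xyC x'y'C by (simp add: m_assoc)
    finally show False using no multsI[of "y' \<otimes> e" B x] e x'y' Bc by simp
  qed
  have y'M: "y' \<in> nonunits B"
  proof (rule ccontr)
    assume "y' \<notin> nonunits B"
    then obtain e where e: "e \<in> B" "y' \<otimes> e = \<one>" using unit_in x'y' by blast
    have eC: "e \<in> carrier R" using e Bc by simp
    have "x = (x \<otimes> y') \<otimes> e" using e(2) eC xyC x'y'C by (simp add: m_assoc)
    also have "\<dots> = y \<otimes> (x' \<otimes> e)" using cross eC xyC x'y'C by (simp add: m_assoc)
    finally show False using no multsI[of "x' \<otimes> e" B y] e x'y' Bc by simp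
  qed
  have dM: "d \<in> nonunits B"
  proof (rule ccontr)
    assume "d \<notin> nonunits B"
    then obtain e where e: "e \<in> B" "d \<otimes> e = \<one>" using unit_in dB by blast
    have eC: "e \<in> carrier R" using e Bc by simp
    have "x \<otimes> e = x' \<otimes> (d \<otimes> e)" "y \<otimes> e = y' \<otimes> (d \<otimes> e)"
      unfolding xd yd using d(1) x'y'C eC by algebra+
    then have x'e: "x' = x \<otimes> e" "y' = y \<otimes> e" using e x'y'C by simp_all
    obtain k l :: nat where kl: "x [^] k \<in> mults B b" "y [^] l \<in> mults B b"
      using b_pow xyM by blast
    have bB': "b \<in> B" using bB nonunits_in by blast
    show False
    proof (rule surface_dim_at_least_two[OF B bB])
      fix c assume c: "c \<in> nonunits B"
      obtain n :: nat where "c [^] n \<in> lin B x' y'" using x'y'(5) c unfolding primary_pair_def by blast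
      then obtain r s where rs: "r \<in> B" "s \<in> B" "c [^] n = x' \<otimes> r \<oplus> y' \<otimes> s" by (rule linE)
      have "c [^] n = x \<otimes> (e \<otimes> r) \<oplus> y \<otimes> (e \<otimes> s)"
        unfolding rs(3) using x'e rs xyC eC Bc(1) by (simp add: m_assoc)
      then have "c [^] n \<in> lin B x y" using linI[of "e \<otimes> r" B "e \<otimes> s" x y] e rs Bc by simp
      then obtain m :: nat where "(c [^] n) [^] m \<in> mults B b"
        using radical_of_generators[OF sB xyB bB' kl] by blast
      then have "c [^] (n * m) \<in> mults B b" using c nonunits_in Bc by (simp add: nat_pow_pow)
      then show "\<exists>n::nat. c [^] n \<in> mults B b" ..
    qed
  qed
  have x'0: "x' \<noteq> \<zero>" using xd x0 d by auto
  obtain p q where pq: "p \<in> A" "q \<in> A" "q \<noteq> \<zero>" "x' \<otimes> q = p"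
    using surface_fraction[OF A x'y'C(1)] by blast
  have qC: "q \<in> carrier R" using pq Ac by simp
  have p0: "p \<noteq> \<zero>" using pq x'0 x'y'C qC by (auto simp: integral_iff)
  obtain ps i where ps: "length ps = Suc i" "set ps \<subseteq> A" "\<not> set ps \<subseteq> nonunits A" "p = form x y ps"
    using primitive_form_exists[OF A M xy pq(1) p0] by blast
  obtain qs j where qs: "length qs = Suc j" "set qs \<subseteq> A" "\<not> set qs \<subseteq> nonunits A" "q = form x y qs"
    using primitive_form_exists[OF A M xy pq(2,3)] by blast
  have psB: "set ps \<subseteq> B" "set qs \<subseteq> B" using ps qs AB by auto
  have psC: "set ps \<subseteq> carrier R" "set qs \<subseteq> carrier R" using psB Bc by auto
  have not_ps: "\<not> set ps \<subseteq> nonunits B" using ps(2,3) unit_mono[OF AB(1)] by blast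
  have not_qs: "\<not> set qs \<subseteq> nonunits B" using qs(2,3) unit_mono[OF AB(1)] by blast
  define P where "P = form x' y' ps"
  define Q where "Q = form x' y' qs"
  have PQ: "P \<in> carrier R" "Q \<in> carrier R"
    using psC x'y'C by (auto simp: P_def Q_def)
  have PQf: "P \<in> forms B x' y' (Suc i)" "Q \<in> forms B x' y' (Suc j)"
    using formsI[OF psB(1)] formsI[OF psB(2)] ps qs by (auto simp: P_def Q_def)
  have "d \<otimes> p = d \<otimes> (d [^] i \<otimes> P)"
    using form_scale[OF d(1) x'y'C psC(1)] xd yd ps PQ d by (simp add: P_def m_ac)
  then have pP: "p = d [^] i \<otimes> P" using d0 d(1) PQ ps xyC psC by (simp add: m_lcancel)
  have "d \<otimes> q = d \<otimes> (d [^] j \<otimes> Q)"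
    using form_scale[OF d(1) x'y'C psC(2)] xd yd qs PQ d by (simp add: Q_def m_ac)
  then have qQ: "q = d [^] j \<otimes> Q" using d0 d(1) PQ qs xyC psC by (simp add: m_lcancel)
  have key: "x' \<otimes> (d [^] j \<otimes> Q) = d [^] i \<otimes> P" using pq(4) pP qQ by simp
  have BC: "B \<subseteq> carrier R" using Bc(1) by blast
  show False
  proof (cases "i \<le> j")
    case True
    have dj: "d [^] j = d [^] i \<otimes> d [^] (j - i)" using True d by (simp add: nat_pow_mult)
    have "d [^] i \<otimes> P = d [^] i \<otimes> ((x' \<otimes> d [^] (j - i)) \<otimes> Q)"
      unfolding key[symmetric] dj using d(1) x'y'C PQ by (simp add: m_ac)
    then have "P = (x' \<otimes> d [^] (j - i)) \<otimes> Q"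
      using pow_nonzero[OF d(1) d0, of i] d x'y'C PQ by (simp add: m_lcancel)
    moreover have "(x' \<otimes> d [^] (j - i)) \<otimes> Q \<in> forms (nonunits B) x' y' (Suc j)"
      by (rule forms_smult[OF BC x'y'C _ _ PQf(2)]) (use x'y'C d dB x'M Bc MB in auto)
    ultimately have "P \<in> forms (nonunits B) x' y' (Suc i)"
      using forms_nonunits_decrease[OF B x'M y'M True] by simp
    then show False
      using form_in_nonunit_forms[OF B x'M y'M x'y'(5) psB(1)] not_ps ps by (simp add: P_def)
  next
    case False
    then have ij: "Suc j \<le> i" by simp
    have di: "d [^] i = d [^] j \<otimes> d [^] (i - j)" using ij d by (simp add: nat_pow_mult)
    have "d [^] j \<otimes> (x' \<otimes> Q) = d [^] j \<otimes> (d [^] (i - j) \<otimes> P)"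
      using key unfolding di using d(1) x'y'C PQ by (simp add: m_ac)
    then have "x' \<otimes> Q = d [^] (i - j) \<otimes> P"
      using pow_nonzero[OF d(1) d0, of j] d x'y'C PQ by (simp add: m_lcancel)
    moreover have dij: "d [^] (i - j) \<in> nonunits B"
      by (rule surface_nonunits_pow[OF B dM]) (use False in simp)
    have "d [^] (i - j) \<otimes> P \<in> forms (nonunits B) x' y' (Suc i)"
      by (rule forms_smult[OF BC x'y'C _ _ PQf(1)]) (use d dij MB in auto)
    ultimately have "x' \<otimes> Q \<in> forms (nonunits B) x' y' (Suc (Suc j))"
      using forms_nonunits_decrease[OF B x'M y'M ij] by simp
    moreover have "x' \<otimes> Q = form x' y' (\<zero> # qs)" using x'y'C PQ by (simp add: Q_def)
    ultimately have "set (\<zero> # qs) \<subseteq> nonunits B"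
      using form_in_nonunit_forms[OF B x'M y'M x'y'(5), of "\<zero> # qs"] psB Bc qs by simp
    then show False using not_qs by simp
  qed
qed

end

section \<open>The quadratic transform along an overring\<close>

text \<open>
  A surface \<open>B\<close> above \<open>A\<close> together with generators \<open>x, y\<close> of the maximal ideal of \<open>A\<close>, numbered
  such that \<open>t = y/x\<close> lies in \<open>B\<close>. So \<open>B\<close> has a centre in the chart \<open>A[t]\<close> of the blow-up of
  \<open>A\<close>, in which \<open>x = 0\<close> is the exceptional curve.
\<close>
locale blowup = field +
  fixes A B x y t
  assumes A: "surface A" and B: "surface B" and AB: "A \<subseteq> B"
    and xA: "x \<in> A" and yA: "y \<in> A" and MA: "nonunits A = lin A x y"
    and x0: "x \<noteq> \<zero>" and tB: "t \<in> B" and yt: "y = x \<otimes> t"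
begin

lemma sA: "subring A R" and sB: "subring B R"
  using A B by (auto intro: surface_subring)

lemmas Ac = subring_closed[OF sA] and Bc = subring_closed[OF sB]
lemmas MAc = surface_nonunits[OF A] and MBc = surface_nonunits[OF B]

lemma dom: "nonunits A \<subseteq> nonunits B"
  by (rule surface_dominates[OF A B AB])

lemma elems [simp]: "x \<in> carrier R" "y \<in> carrier R" "t \<in> carrier R" "A \<subseteq> carrier R" "B \<subseteq> carrier R"
  using Ac(1) Bc(1) xA yA tB by auto

lemma xM: "x \<in> nonunits A" and yM: "y \<in> nonunits A" and xMB: "x \<in> nonunits B"
proof -
  show "x \<in> nonunits A" "y \<in> nonunits A"
    using lin_generators[OF sA xA yA] by (simp_all add: MA)
  then show "x \<in> nonunits B" using dom by blast
qed

lemma primary_yx: "primary_pair A y x"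
  unfolding primary_pair_def
proof
  fix c assume "c \<in> nonunits A"
  then obtain r s where rs: "r \<in> A" "s \<in> A" "c = x \<otimes> r \<oplus> y \<otimes> s" unfolding MA by (rule linE)
  have "c [^] (1::nat) = y \<otimes> s \<oplus> x \<otimes> r" using rs Ac(1) by (simp add: a_comm)
  then show "\<exists>n::nat. c [^] n \<in> lin A y x" using linI[OF rs(2,1)] by metis
qed

text \<open>
  The values at \<open>t\<close> of the polynomials over \<open>A\<close> of degree less than \<open>k\<close>. The element \<open>t\<close> lies in
  the quotient field of \<open>A\<close>, so an element of this set does not determine a polynomial; only its
  class modulo \<open>x\<close> does.
\<close>
definition pol :: "nat \<Rightarrow> 'a set" where "pol k = forms A t \<one> k"

lemma pol_carrier: "z \<in> pol k \<Longrightarrow> z \<in> carrier R"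
  unfolding pol_def by (rule forms_closed) auto

lemma pol_cons: assumes "c \<in> A" "r \<in> pol k" shows "c \<oplus> t \<otimes> r \<in> pol (Suc k)"
proof -
  obtain cs where cs: "r = form t \<one> cs" "length cs = k" "set cs \<subseteq> A"
    using assms by (auto simp: pol_def forms_def)
  have "c \<oplus> t \<otimes> r = form t \<one> (c # cs)" using cs assms Ac by simp
  then show ?thesis using formsI[of "c # cs" A t \<one>] cs assms by (simp add: pol_def)
qed

lemma pol_consE: assumes "z \<in> pol (Suc k)"
  obtains c r where "c \<in> A" "r \<in> pol k" "z = c \<oplus> t \<otimes> r"
proof -
  obtain cs where cs: "z = form t \<one> cs" "length cs = Suc k" "set cs \<subseteq> A"
    using assms by (auto simp: pol_def forms_def)
  then obtain c ds where ds: "cs = c # ds" by (cases cs) auto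
  then show ?thesis using that[of c "form t \<one> ds"] cs formsI[of ds A t \<one>] Ac by (simp add: pol_def)
qed

lemma pol_snocE: assumes "z \<in> pol (Suc k)"
  obtains c r where "c \<in> A" "r \<in> pol k" "z = c \<otimes> t [^] k \<oplus> r"
proof -
  obtain cs where cs: "z = form t \<one> cs" "length cs = Suc k" "set cs \<subseteq> A"
    using assms by (auto simp: pol_def forms_def)
  then obtain c ds where ds: "cs = ds @ [c]" by (cases cs rule: rev_cases) auto
  have "c \<in> carrier R" "set ds \<subseteq> carrier R" using cs ds Ac by auto
  then have "z = c \<otimes> t [^] k \<oplus> form t \<one> ds"
    using cs ds by (simp add: form_snoc a_comm m_comm)
  then show ?thesis using that[of c "form t \<one> ds"] cs ds formsI[of ds A t \<one>] by (simp add: pol_def)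
qed

lemma pol_0: "z \<in> pol 0 \<longleftrightarrow> z = \<zero>"
  by (auto simp: pol_def forms_def)

lemma pol_add: "z \<in> pol k \<Longrightarrow> w \<in> pol k \<Longrightarrow> z \<oplus> w \<in> pol k"
  unfolding pol_def by (rule forms_add) (use Ac in auto)

lemma pol_smult: "c \<in> A \<Longrightarrow> z \<in> pol k \<Longrightarrow> c \<otimes> z \<in> pol k"
  unfolding pol_def by (rule forms_smult[of A]) (use Ac in auto)

lemma pol_minus: assumes "z \<in> pol k" shows "\<ominus> z \<in> pol k"
  using pol_smult[OF Ac(6)[OF Ac(3)] assms] pol_carrier[OF assms] by (simp add: l_minus)

lemma pol_diff: "z \<in> pol k \<Longrightarrow> w \<in> pol k \<Longrightarrow> z \<ominus> w \<in> pol k"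
  unfolding minus_eq by (intro pol_add pol_minus)

lemma pol_mono: assumes "k \<le> l" "z \<in> pol k" shows "z \<in> pol l"
  using assms
proof (induction rule: dec_induct)
  case (step n)
  then have "\<one> \<otimes> z \<in> pol (Suc n)"
    unfolding pol_def by (intro forms_times_right) (use Ac in auto)
  then show ?case using pol_carrier[OF \<open>z \<in> pol k\<close>] by simp
qed

lemma pol_zero: "\<zero> \<in> pol k"
  using pol_mono[of 0 k \<zero>] by (simp add: pol_0)

lemma pol_t: "z \<in> pol k \<Longrightarrow> t \<otimes> z \<in> pol (Suc k)"
  unfolding pol_def by (rule forms_times_left) (use Ac in auto)

lemma pol_tpow: assumes "z \<in> pol k" shows "t [^] d \<otimes> z \<in> pol (d + k)"
proof (induction d)
  case 0
  then show ?case using assms pol_carrier by simp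
next
  case (Suc d)
  have "t [^] Suc d \<otimes> z = t \<otimes> (t [^] d \<otimes> z)"
    using pol_carrier[OF assms] by (simp add: m_ac)
  then show ?case using pol_t[OF Suc] by simp
qed

lemma pol_const: assumes "c \<in> A" shows "c \<in> pol (Suc k)"
proof (rule pol_mono[of "Suc 0"])
  show "c \<in> pol (Suc 0)" using pol_cons[OF assms pol_zero[of 0]] assms Ac by simp
qed simp

lemma pol_times: assumes "p \<in> pol k" "q \<in> pol l" shows "p \<otimes> q \<in> pol (k + l)"
  using assms(1)
proof (induction k arbitrary: p)
  case 0
  then show ?case using assms pol_carrier pol_zero by (simp add: pol_0)
next
  case (Suc k)
  obtain c r where cr: "c \<in> A" "r \<in> pol k" "p = c \<oplus> t \<otimes> r" using pol_consE[OF Suc.prems] .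
  have "c \<in> carrier R" "r \<in> carrier R" "q \<in> carrier R"
    using cr pol_carrier assms Ac by auto
  then have "p \<otimes> q = c \<otimes> q \<oplus> t \<otimes> (r \<otimes> q)"
    unfolding cr using elems(3) by algebra
  moreover have "c \<otimes> q \<in> pol (Suc k + l)" using pol_mono[OF _ pol_smult[OF cr(1) assms(2)], of "Suc k + l"] by simp
  moreover have "t \<otimes> (r \<otimes> q) \<in> pol (Suc k + l)" using pol_t[OF Suc.IH[OF cr(2)]] by simp
  ultimately show ?case using pol_add by simp
qed

text \<open>
  The ring \<open>A[t]\<close>.
\<close>
definition P :: "'a set" where "P = (\<Union>k. pol k)"

lemma PI: "z \<in> pol k \<Longrightarrow> z \<in> P" by (auto simp: P_def)
lemma PE: assumes "z \<in> P" obtains k where "z \<in> pol k" using assms by (auto simp: P_def)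

lemma sP: "subring P R"
proof (rule subringI)
  show "P \<subseteq> carrier R" using pol_carrier by (auto simp: P_def)
  show "\<one> \<in> P" using PI[OF pol_const[OF Ac(3)]] .
  show "\<ominus> h \<in> P" if "h \<in> P" for h using that pol_minus by (auto simp: P_def)
  show "h1 \<otimes> h2 \<in> P" if "h1 \<in> P" "h2 \<in> P" for h1 h2
    using that pol_times by (auto simp: P_def) blast
  show "h1 \<oplus> h2 \<in> P" if h: "h1 \<in> P" "h2 \<in> P" for h1 h2
  proof -
    obtain k l where "h1 \<in> pol k" "h2 \<in> pol l" using h by (auto simp: P_def)
    then have "h1 \<in> pol (max k l)" "h2 \<in> pol (max k l)" using pol_mono by (metis max.cobounded1 max.cobounded2)+
    then show ?thesis using PI pol_add by blast
  qed
qed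

lemmas Pc = subring_closed[OF sP]

lemma A_P: "A \<subseteq> P" using pol_const PI by blast

lemma t_P: "t \<in> P" using PI[OF pol_t[OF pol_const[OF Ac(3)]]] by simp

lemma P_subset:
  assumes "subring S R" "A \<subseteq> S" "t \<in> S" shows "P \<subseteq> S"
proof
  fix z assume "z \<in> P"
  then obtain k where "z \<in> pol k" by (rule PE)
  then show "z \<in> S"
    using assms by (auto simp: pol_def forms_def intro!: form_in subring_closed(3))
qed

lemma P_B: "P \<subseteq> B" by (rule P_subset[OF sB AB tB])

lemma nonunit_in_xP: assumes "c \<in> nonunits A" shows "\<exists>w\<in>P. c = x \<otimes> w"
proof -
  obtain r s where rs: "r \<in> A" "s \<in> A" "c = x \<otimes> r \<oplus> y \<otimes> s" using assms unfolding MA by (rule linE)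
  have "r \<in> carrier R" "s \<in> carrier R" using rs Ac by auto
  then have "c = x \<otimes> (r \<oplus> t \<otimes> s)" unfolding rs yt using elems(1,3) by algebra
  moreover have "r \<oplus> t \<otimes> s \<in> P" using rs A_P t_P by (auto intro!: Pc(4,5))
  ultimately show ?thesis by blast
qed

text \<open>
  A coefficient in the maximal ideal of \<open>A\<close> is a multiple of \<open>x\<close> in \<open>A[t]\<close>, so leading
  coefficients that are nonunits can be dropped.
\<close>
lemma leading_unit_mod_x:
  assumes "z \<in> pol k"
  shows "z \<in> mults P x \<or> (\<exists>e<k. \<exists>c\<in>A - nonunits A. \<exists>r\<in>pol e. \<exists>s\<in>P. z = (c \<otimes> t [^] e \<oplus> r) \<oplus> x \<otimes> s)"
  using assms
proof (induction k arbitrary: z)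
  case 0
  then show ?case using multsI[OF Pc(2), of x] by (simp add: pol_0)
next
  case (Suc k)
  obtain c r where cr: "c \<in> A" "r \<in> pol k" "z = c \<otimes> t [^] k \<oplus> r" using pol_snocE[OF Suc.prems] .
  have rC: "r \<in> carrier R" "c \<in> carrier R" using cr pol_carrier Ac by auto
  show ?case
  proof (cases "c \<in> nonunits A")
    case False
    have "z = (c \<otimes> t [^] k \<oplus> r) \<oplus> x \<otimes> \<zero>" using cr rC by simp
    then show ?thesis using cr False Pc(2) by blast
  next
    case True
    then obtain w where w: "w \<in> P" "c = x \<otimes> w" using nonunit_in_xP by blast
    define q where "q = w \<otimes> t [^] k"
    have qP: "q \<in> P" using w t_P Pc by (simp add: q_def)
    then have qC: "q \<in> carrier R" "w \<in> carrier R" using w Pc(1) by auto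
    have zq: "z = r \<oplus> x \<otimes> q" unfolding cr w q_def using qC rC by (simp add: m_assoc a_comm)
    from Suc.IH[OF cr(2)] show ?thesis
    proof
      assume "r \<in> mults P x"
      then have "z \<in> mults P x" unfolding zq using multsI[OF qP] by (intro mults_add[OF sP]) auto
      then show ?thesis ..
    next
      assume "\<exists>e<k. \<exists>c\<in>A - nonunits A. \<exists>r'\<in>pol e. \<exists>s\<in>P. r = (c \<otimes> t [^] e \<oplus> r') \<oplus> x \<otimes> s"
      then obtain e c' r' s where *: "e < k" "c' \<in> A - nonunits A" "r' \<in> pol e" "s \<in> P"
        "r = (c' \<otimes> t [^] e \<oplus> r') \<oplus> x \<otimes> s" by blast
      define f where "f = c' \<otimes> t [^] e \<oplus> r'"
      have "f \<in> carrier R" "s \<in> carrier R" using * pol_carrier Ac Pc by (auto simp: f_def)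
      then have "z = f \<oplus> x \<otimes> (s \<oplus> q)"
        unfolding zq *(5) f_def[symmetric] using qC elems(1) by algebra
      moreover have "s \<oplus> q \<in> P" using *(4) qP Pc(5) by blast
      moreover have "e < Suc k" using *(1) by simp
      ultimately show ?thesis using *(2,3) unfolding f_def by blast
    qed
  qed
qed

text \<open>
  The class of \<open>t\<close> is transcendental over the residue field, so that \<open>A[t]/xA[t]\<close> is a
  polynomial ring: an equation modulo \<open>x\<close> becomes, on multiplication by a power of \<open>x\<close>, an
  equation between forms in \<open>y\<close> and \<open>x\<close>. Zeros pad the two coefficient lists to the same length.
\<close>
lemma coefficients_nonunit:
  assumes cs: "set cs \<subseteq> A" and z: "form t \<one> cs \<in> mults P x"
  shows "set cs \<subseteq> nonunits A"
proof -
  obtain s where s: "s \<in> P" "form t \<one> cs = x \<otimes> s" using z by (rule multsE)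
  obtain l where l: "s \<in> pol l" using s(1) by (rule PE)
  define K where "K = max (length cs) l"
  obtain ss where ss: "length ss = K" "set ss \<subseteq> A" "s = form t \<one> ss"
    using pol_mono[OF _ l, of K] by (auto simp: pol_def forms_def K_def)
  define ds where "ds = cs @ replicate (K - length cs) \<zero>"
  have ds: "length ds = K" "set ds \<subseteq> A" using cs Ac by (auto simp: ds_def K_def)
  have dsC: "set ds \<subseteq> carrier R" "set ss \<subseteq> carrier R" "set cs \<subseteq> carrier R" using ds ss cs elems by blast+
  have zeros: "form t \<one> (replicate n \<zero>) = \<zero>" for n by (induction n) auto
  have "form t \<one> ds = form t \<one> cs"
    unfolding ds_def using dsC by (subst form_append) (auto simp: zeros)
  then have eq: "form t \<one> ds = x \<otimes> form t \<one> ss" using s ss by simp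
  have scale: "x \<otimes> form y x es = x [^] K \<otimes> form t \<one> es" if "length es = K" "set es \<subseteq> carrier R" for es
    using form_scale[of x t \<one> es] that by (simp add: yt)
  have "x \<otimes> form y x ds = x \<otimes> form y x (map ((\<otimes>) x) ss)"
    using scale[OF ds(1) dsC(1)] scale[OF ss(1) dsC(2)] dsC eq by (simp add: form_smult m_lcomm)
  then have "form y x ds = form y x (map ((\<otimes>) x) ss)"
    using x0 dsC by (subst (asm) m_lcancel) (auto intro!: form_closed m_closed)
  moreover have "set (map ((\<otimes>) x) ss) \<subseteq> nonunits A" using ss xM MAc(3) by auto
  ultimately have "form y x ds \<in> forms (nonunits A) y x (length ds)"
    using formsI[of "map ((\<otimes>) x) ss" "nonunits A" y x] ss ds by simp
  then have "set ds \<subseteq> nonunits A"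
    by (rule form_in_nonunit_forms[OF A yM xM primary_yx ds(2)])
  then show ?thesis by (auto simp: ds_def)
qed

lemma leading_unit_not_in_xP:
  assumes "c \<in> A" "c \<notin> nonunits A" "r \<in> pol e"
  shows "c \<otimes> t [^] e \<oplus> r \<notin> mults P x"
proof
  assume *: "c \<otimes> t [^] e \<oplus> r \<in> mults P x"
  obtain cs where cs: "r = form t \<one> cs" "length cs = e" "set cs \<subseteq> A"
    using assms by (auto simp: pol_def forms_def)
  have "set cs \<subseteq> carrier R" "c \<in> carrier R" using cs assms Ac by auto
  then have "form t \<one> (cs @ [c]) = c \<otimes> t [^] e \<oplus> r"
    using cs by (simp add: form_snoc a_comm m_comm)
  then have "set (cs @ [c]) \<subseteq> nonunits A"
    using coefficients_nonunit[of "cs @ [c]"] * cs assms by simp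
  then show False using assms by simp
qed

lemma monic_nonunit_of_lower_degree:
  assumes z: "z \<in> pol k" "z \<in> nonunits B" "z \<notin> mults P x"
  shows "\<exists>e<k. \<exists>r\<in>pol e. t [^] e \<oplus> r \<in> nonunits B"
proof -
  obtain e c r s where *: "e < k" "c \<in> A" "c \<notin> nonunits A" "r \<in> pol e" "s \<in> P" "z = (c \<otimes> t [^] e \<oplus> r) \<oplus> x \<otimes> s"
    using leading_unit_mod_x[OF z(1)] z(3) by blast
  obtain i where i: "i \<in> A" "c \<otimes> i = \<one>" using unit_in[OF *(2,3)] by blast
  define u where "u = t [^] e"
  have C: "c \<in> carrier R" "i \<in> carrier R" "r \<in> carrier R" "s \<in> carrier R" "u \<in> carrier R"
    using * i Ac(1) Pc(1) pol_carrier by (auto simp: u_def)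
  have "i \<otimes> (z \<ominus> x \<otimes> s) \<in> nonunits B"
    using MBc(3)[OF xMB, of s] MBc(4,6) z(2) *(5) P_B i(1) AB by blast
  moreover have "i \<otimes> (((c \<otimes> u \<oplus> r) \<oplus> x \<otimes> s) \<ominus> x \<otimes> s) = (c \<otimes> i) \<otimes> u \<oplus> i \<otimes> r"
    using C elems(1) by algebra
  ultimately have "t [^] e \<oplus> i \<otimes> r \<in> nonunits B" using *(6) i(2) by (simp add: u_def)
  then show ?thesis using *(1) pol_smult[OF i(1) *(4)] by blast
qed

text \<open>
  If the centre of \<open>B\<close> were the generic point of the exceptional curve, the order of an element
  of \<open>A\<close> would determine it up to a unit of \<open>B\<close>: dehomogenize the initial form.
\<close>
lemma homogeneous_unit:
  assumes "a \<in> A" "a \<noteq> \<zero>"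
    and no_monic: "\<And>e r. r \<in> pol e \<Longrightarrow> t [^] e \<oplus> r \<notin> nonunits B"
  shows "\<exists>i::nat. \<exists>p\<in>B - nonunits B. a = x [^] i \<otimes> p"
proof -
  have "nonunits A = lin A y x" using MA lin_commute[OF sA elems(1,2)] by simp
  then obtain ps i where ps: "length ps = Suc i" "set ps \<subseteq> A" "\<not> set ps \<subseteq> nonunits A" "a = form y x ps"
    using primitive_form_exists[OF A _ yA xA assms(1,2)] by blast
  define p where "p = form t \<one> ps"
  have psC: "set ps \<subseteq> carrier R" using ps elems by blast
  have p: "p \<in> pol (Suc i)" using formsI[OF ps(2), of t \<one>] ps by (simp add: p_def pol_def)
  have pC: "p \<in> carrier R" using pol_carrier[OF p] .
  have aC: "a \<in> carrier R" using assms Ac(1) by blast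
  have "x \<otimes> a = x \<otimes> (x [^] i \<otimes> p)"
    using form_scale[of x t \<one> ps] psC pC by (simp add: yt[symmetric] ps p_def m_ac)
  then have "a = x [^] i \<otimes> p" using x0 aC pC by (subst (asm) m_lcancel) auto
  moreover have "p \<in> B" using PI[OF p] P_B by blast
  moreover have "p \<notin> nonunits B"
  proof
    assume "p \<in> nonunits B"
    moreover have "p \<notin> mults P x" using coefficients_nonunit[OF ps(2)] ps(3) by (auto simp: p_def)
    ultimately show False using monic_nonunit_of_lower_degree[OF p] no_monic by blast
  qed
  ultimately show ?thesis by blast
qed

text \<open>
  The centre of \<open>B\<close> is a closed point of the exceptional curve. Otherwise every element of the
  field would be a power of \<open>x\<close> times a unit of \<open>B\<close>, and \<open>B\<close> would be a valuation ring.
\<close>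
lemma monic_nonunit_exists:
  "\<exists>e. \<exists>r\<in>pol e. t [^] e \<oplus> r \<in> nonunits B"
proof (rule ccontr)
  assume no: "\<not> ?thesis"
  then have no_monic: "t [^] e \<oplus> r \<notin> nonunits B" if "r \<in> pol e" for e r
    using that by blast
  obtain z where z: "z \<in> carrier R" "z \<notin> B" "\<And>w. w \<in> B \<Longrightarrow> z \<otimes> w \<noteq> \<one>"
    using surface_not_valuation[OF B] by blast
  obtain a b where ab: "a \<in> A" "b \<in> A" "b \<noteq> \<zero>" "z \<otimes> b = a"
    using surface_fraction[OF A z(1)] by blast
  have "z \<noteq> \<zero>" using z Bc by auto
  then have a0: "a \<noteq> \<zero>" using ab z Ac by (auto simp: integral_iff)
  obtain i :: nat and p where p: "p \<in> B" "p \<notin> nonunits B" "a = x [^] i \<otimes> p"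
    using homogeneous_unit[OF ab(1) a0 no_monic] by blast
  obtain j :: nat and q where q: "q \<in> B" "q \<notin> nonunits B" "b = x [^] j \<otimes> q"
    using homogeneous_unit[OF ab(2,3) no_monic] by blast
  obtain p' where p': "p' \<in> B" "p \<otimes> p' = \<one>" using unit_in[OF p(1,2)] by blast
  obtain q' where q': "q' \<in> B" "q \<otimes> q' = \<one>" using unit_in[OF q(1,2)] by blast
  have C: "p \<in> carrier R" "q \<in> carrier R" "p' \<in> carrier R" "q' \<in> carrier R" using p q p' q' Bc by auto
  have xB: "x \<in> B" using xA AB by blast
  have xp: "x [^] n \<in> carrier R" "x [^] n \<in> B" "x [^] n \<noteq> \<zero>" for n :: nat
    using xB Bc pow_nonzero[OF _ x0] by auto
  have eq: "x [^] j \<otimes> (z \<otimes> q) = x [^] i \<otimes> p"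
    using ab(4) p(3) q(3) z(1) C xp by (simp add: m_ac)
  show False
  proof (cases "j \<le> i")
    case True
    have "x [^] i = x [^] j \<otimes> x [^] (i - j)" using True by (simp add: nat_pow_mult)
    then have "x [^] j \<otimes> (z \<otimes> q) = x [^] j \<otimes> (x [^] (i - j) \<otimes> p)" using eq C xp by (simp add: m_assoc)
    then have "z \<otimes> q = x [^] (i - j) \<otimes> p" using xp C z(1) by (simp add: m_lcancel)
    then have "z = x [^] (i - j) \<otimes> p \<otimes> q'" using q'(2) C z(1) by (metis m_assoc r_one)
    then show False using z(2) xp(2) p(1) q'(1) Bc by simp
  next
    case False
    then have "x [^] j = x [^] i \<otimes> x [^] (j - i)" by (simp add: nat_pow_mult)
    then have "x [^] i \<otimes> (x [^] (j - i) \<otimes> (z \<otimes> q)) = x [^] i \<otimes> p" using eq C xp z(1) by (simp add: m_assoc)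
    then have "x [^] (j - i) \<otimes> (z \<otimes> q) = p" using xp C z(1) by (simp add: m_lcancel)
    then have "z \<otimes> (x [^] (j - i) \<otimes> q \<otimes> p') = \<one>" using p'(2) C z(1) xp(1)[of "j - i"]
      by (metis m_assoc m_lcomm m_closed)
    then show False using z(3)[of "x [^] (j - i) \<otimes> q \<otimes> p'"] xp(2) q(1) p'(1) by (simp add: Bc(4))
  qed
qed

end

text \<open>
  A monic polynomial of minimal degree \<open>d\<close> that vanishes at the centre of \<open>B\<close>; over the residue
  field it is the irreducible polynomial that defines the centre on the exceptional curve.
\<close>
locale blowup_center = blowup +
  fixes d g
  assumes g: "g \<in> pol d" and center: "t [^] d \<oplus> g \<in> nonunits B"
    and minimal: "\<And>e r. e < d \<Longrightarrow> r \<in> pol e \<Longrightarrow> t [^] e \<oplus> r \<notin> nonunits B"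
begin

definition \<gamma> :: 'a where "\<gamma> = t [^] d \<oplus> g"

lemma gMB: "\<gamma> \<in> nonunits B" using center by (simp add: \<gamma>_def)

lemma gP: "\<gamma> \<in> P"
  unfolding \<gamma>_def by (intro Pc PI[OF g] t_P)

lemma gC [simp]: "\<gamma> \<in> carrier R" using gP Pc(1) by blast

lemma g_pol: "\<gamma> \<in> pol (Suc d)"
  unfolding \<gamma>_def using pol_tpow[OF pol_const[OF Ac(3), of 0], of d] pol_mono[OF _ g, of "Suc d"] pol_add by simp

lemma d_pos: "d > 0"
proof (rule ccontr)
  assume "\<not> d > 0"
  then have "d = 0" "g = \<zero>" using g by (auto simp: pol_0)
  then have "\<gamma> = \<one>" unfolding \<gamma>_def by simp
  then show False using gMB one_not_nonunit[OF sB] by simp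
qed

lemma xP_nonunit: "z \<in> mults P x \<Longrightarrow> z \<in> nonunits B"
  using MBc(3)[OF xMB] P_B by (auto elim!: multsE)

lemma short_nonunit_in_xP:
  assumes z: "z \<in> pol d" "z \<in> nonunits B" shows "z \<in> mults P x"
  using monic_nonunit_of_lower_degree[OF z] minimal by blast

text \<open>
  Polynomial division in Horner's scheme: the remainder, multiplied by \<open>t\<close>, acquires one term of
  degree \<open>e\<close>. For \<open>e = 0\<close> the divisor is \<open>1\<close>.
\<close>
lemma monic_division:
  assumes h: "h \<in> pol e" and z: "z \<in> pol k"
  shows "\<exists>q\<in>pol (k - e). \<exists>r\<in>pol e. z = q \<otimes> (t [^] e \<oplus> h) \<oplus> r"
proof -
  define \<delta> where "\<delta> = t [^] e \<oplus> h"
  have hC: "h \<in> carrier R" using pol_carrier[OF h] .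
  have \<delta>: "\<delta> \<in> carrier R" using hC by (simp add: \<delta>_def)
  have "\<exists>q\<in>pol (k - e). \<exists>r\<in>pol e. z = q \<otimes> \<delta> \<oplus> r"
  proof (cases "k \<le> e")
    case True
    have "z = \<zero> \<otimes> \<delta> \<oplus> z" using pol_carrier[OF z] \<delta> by simp
    then show ?thesis using pol_zero pol_mono[OF True z] by blast
  next
    case False
    then have "e \<le> k" by simp
    then show ?thesis using z
    proof (induction k arbitrary: z rule: dec_induct)
      case base
      have "z = \<zero> \<otimes> \<delta> \<oplus> z" using pol_carrier[OF base] \<delta> by simp
      then show ?case using pol_zero base by blast
    next
      case (step k)
      obtain c z' where cz: "c \<in> A" "z' \<in> pol k" "z = c \<oplus> t \<otimes> z'" using pol_consE[OF step.prems] .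
      obtain q r where qr: "q \<in> pol (k - e)" "r \<in> pol e" "z' = q \<otimes> \<delta> \<oplus> r" using step.IH[OF cz(2)] by blast
      obtain c' r' where cr: "c' \<in> A" "r' \<in> pol e" "t \<otimes> r = c' \<otimes> t [^] e \<oplus> r'"
        using pol_snocE[OF pol_t[OF qr(2)]] .
      have C: "c \<in> carrier R" "q \<in> carrier R" "r \<in> carrier R" "c' \<in> carrier R" "r' \<in> carrier R"
        using cz qr cr pol_carrier Ac by auto
      define u where "u = t [^] e"
      have u: "u \<in> carrier R" by (simp add: u_def)
      have "z = c \<oplus> (t \<otimes> q \<otimes> \<delta> \<oplus> t \<otimes> r)"
        unfolding cz(3) qr(3) using C \<delta> elems(3) by algebra
      also have "t \<otimes> r = c' \<otimes> u \<oplus> r'" using cr by (simp add: u_def)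
      also have "c \<oplus> (t \<otimes> q \<otimes> \<delta> \<oplus> (c' \<otimes> u \<oplus> r')) = (t \<otimes> q \<oplus> c') \<otimes> \<delta> \<oplus> (c \<oplus> r' \<ominus> c' \<otimes> h)"
        unfolding \<delta>_def u_def[symmetric] using C u hC elems(3) by algebra
      finally have zeq: "z = (t \<otimes> q \<oplus> c') \<otimes> \<delta> \<oplus> (c \<oplus> r' \<ominus> c' \<otimes> h)" .
      have q': "t \<otimes> q \<oplus> c' \<in> pol (Suc k - e)"
        using pol_add[OF pol_t[OF qr(1)] pol_const[OF cr(1)]] step(1) by (simp add: Suc_diff_le)
      show ?case
      proof (cases e)
        case (Suc e')
        have "c \<oplus> r' \<ominus> c' \<otimes> h \<in> pol e"
          using pol_const[OF cz(1), of e'] cr(1,2) h by (auto intro!: pol_diff pol_add pol_smult simp: Suc)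
        then show ?thesis using zeq q' by blast
      next
        case 0
        have "\<delta> = \<one>" using h 0 by (simp add: \<delta>_def pol_0)
        then have "z = z \<otimes> \<delta> \<oplus> \<zero>" using pol_carrier[OF step.prems] by simp
        then show ?thesis using step.prems pol_zero[of e] 0 by fastforce
      qed
    qed
  qed
  then show ?thesis by (simp add: \<delta>_def)
qed

lemma gamma_times_nonunit: "q \<in> P \<Longrightarrow> q \<otimes> \<gamma> \<in> nonunits B"
  using MBc(4)[OF gMB] P_B by blast

text \<open>
  The expansion in powers of \<open>\<gamma>\<close> modulo \<open>x\<close>. A remainder of degree below \<open>d\<close> is a unit of \<open>B\<close> or
  divisible by \<open>x\<close>, by minimality of \<open>d\<close>. The bound on \<open>s d\<close> is what later distinguishes a
  polynomial from a monic one of degree \<open>s d\<close>.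
\<close>
lemma pol_decomposition:
  assumes "z \<in> pol l"
  shows "z \<in> mults P x \<or> (\<exists>s e u. e \<in> P \<and> e \<notin> nonunits B \<and> u \<in> P \<and> z = \<gamma> [^] s \<otimes> e \<oplus> x \<otimes> u \<and> s * d < l)"
  using assms
proof (induction l arbitrary: z rule: less_induct)
  case (less l)
  show ?case
  proof (cases "l = 0")
    case True
    then show ?thesis using less.prems multsI[OF Pc(2), of x] by (simp add: pol_0)
  next
    case False
    obtain q r where qr: "q \<in> pol (l - d)" "r \<in> pol d" "z = q \<otimes> \<gamma> \<oplus> r"
      using monic_division[OF g less.prems] by (auto simp: \<gamma>_def)
    have zP: "z \<in> P" and qP: "q \<in> P" and rP: "r \<in> P" using PI less.prems qr by auto
    have C: "z \<in> carrier R" "q \<in> carrier R" "r \<in> carrier R" using zP qP rP Pc by auto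
    show ?thesis
    proof (cases "r \<in> nonunits B")
      case False
      have "r \<oplus> q \<otimes> \<gamma> \<notin> nonunits B"
        using unit_add_nonunit[OF B _ False gamma_times_nonunit[OF qP]] rP P_B by blast
      then have "z \<notin> nonunits B" using qr C by (simp add: a_comm)
      moreover have "z = \<gamma> [^] (0::nat) \<otimes> z \<oplus> x \<otimes> \<zero>" using C by simp
      ultimately show ?thesis using zP Pc(2) \<open>l \<noteq> 0\<close> by (intro disjI2 exI[of _ 0] exI[of _ z] exI[of _ \<zero>]) auto
    next
      case True
      then obtain r' where r': "r' \<in> P" "r = x \<otimes> r'" using short_nonunit_in_xP qr multsE by metis
      have r'C: "r' \<in> carrier R" using r' Pc(1) by blast
      have "l - d < l" using \<open>l \<noteq> 0\<close> d_pos by simp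
      from less.IH[OF this qr(1)] show ?thesis
      proof
        assume "q \<in> mults P x"
        then have "z \<in> mults P x" unfolding qr r'
          by (intro mults_add[OF sP elems(1)] mults_times[OF sP elems(1) _ gP] multsI r'(1))
        then show ?thesis ..
      next
        assume "\<exists>s e u. e \<in> P \<and> e \<notin> nonunits B \<and> u \<in> P \<and> q = \<gamma> [^] s \<otimes> e \<oplus> x \<otimes> u \<and> s * d < l - d"
        then obtain s e u where *: "e \<in> P" "e \<notin> nonunits B" "u \<in> P" "q = \<gamma> [^] s \<otimes> e \<oplus> x \<otimes> u" "s * d < l - d"
          by blast
        define v where "v = \<gamma> [^] s"
        have C': "e \<in> carrier R" "u \<in> carrier R" "v \<in> carrier R" using * Pc by (auto simp: v_def)
        have "z = (v \<otimes> \<gamma>) \<otimes> e \<oplus> x \<otimes> (u \<otimes> \<gamma> \<oplus> r')"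
          unfolding qr(3) *(4) r'(2) v_def[symmetric] using C' r'C elems(1) gC by algebra
        then have "z = \<gamma> [^] Suc s \<otimes> e \<oplus> x \<otimes> (u \<otimes> \<gamma> \<oplus> r')" by (simp add: v_def)
        moreover have "u \<otimes> \<gamma> \<oplus> r' \<in> P" using *(3) gP r'(1) Pc(4,5) by simp
        moreover have "Suc s * d < l" using *(5) by simp
        ultimately show ?thesis using *(1,2) by blast
      qed
    qed
  qed
qed

lemma P_nonunits: "z \<in> P \<Longrightarrow> z \<in> nonunits B \<Longrightarrow> z \<in> lin P x \<gamma>"
proof -
  assume z: "z \<in> P" "z \<in> nonunits B"
  obtain l where "z \<in> pol l" using z(1) by (rule PE)
  from pol_decomposition[OF this] show ?thesis
  proof
    assume "z \<in> mults P x"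
    then obtain w where w: "w \<in> P" "z = x \<otimes> w" by (rule multsE)
    then have "z = x \<otimes> w \<oplus> \<gamma> \<otimes> \<zero>" using Pc(1) by simp
    then show ?thesis using linI[OF w(1) Pc(2), of x \<gamma>] by metis
  next
    assume "\<exists>s e u. e \<in> P \<and> e \<notin> nonunits B \<and> u \<in> P \<and> z = \<gamma> [^] s \<otimes> e \<oplus> x \<otimes> u \<and> s * d < l"
    then obtain s :: nat and e u where *: "e \<in> P" "e \<notin> nonunits B" "u \<in> P" "z = \<gamma> [^] s \<otimes> e \<oplus> x \<otimes> u" by blast
    have C: "e \<in> carrier R" "u \<in> carrier R" using * Pc by auto
    show ?thesis
    proof (cases s)
      case 0
      have "e \<oplus> x \<otimes> u \<notin> nonunits B"
        using unit_add_nonunit[OF B _ *(2) xP_nonunit[OF multsI[OF *(3)]]] *(1) P_B by blast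
      then show ?thesis using z * 0 C by simp
    next
      case (Suc n)
      have "z = x \<otimes> u \<oplus> \<gamma> \<otimes> (\<gamma> [^] n \<otimes> e)" using *(4) Suc C by (simp add: m_ac a_comm)
      then show ?thesis using linI[of u P "\<gamma> [^] n \<otimes> e" x \<gamma>] * gP Pc by simp
    qed
  qed
qed

text \<open>
  The quadratic transform of \<open>A\<close> along \<open>B\<close>: the localization of \<open>A[t]\<close> at the centre of \<open>B\<close>.
\<close>
definition T :: "'a set" where
  "T = {w \<in> carrier R. \<exists>p\<in>P. \<exists>q\<in>P. q \<notin> nonunits B \<and> w \<otimes> q = p}"

lemma TI: "w \<in> carrier R \<Longrightarrow> q \<in> P \<Longrightarrow> q \<notin> nonunits B \<Longrightarrow> w \<otimes> q \<in> P \<Longrightarrow> w \<in> T"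
  by (auto simp: T_def)

lemma TE: assumes "w \<in> T"
  obtains q where "w \<in> carrier R" "q \<in> P" "q \<notin> nonunits B" "w \<otimes> q \<in> P"
  using assms by (auto simp: T_def)

lemma P_T: "P \<subseteq> T"
proof
  fix z assume "z \<in> P"
  then show "z \<in> T" using TI[of z \<one>] Pc one_not_nonunit[OF sB] by simp
qed

lemma sT: "subring T R"
proof (rule subringI)
  show "T \<subseteq> carrier R" by (auto simp: T_def)
  show "\<one> \<in> T" using P_T Pc(3) by blast
  show "\<ominus> h \<in> T" if h: "h \<in> T" for h
  proof -
    obtain q where q: "h \<in> carrier R" "q \<in> P" "q \<notin> nonunits B" "h \<otimes> q \<in> P" using h by (rule TE)
    then have "\<ominus> h \<otimes> q \<in> P" using Pc(6)[OF q(4)] Pc(1) by (simp add: l_minus)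
    then show ?thesis using q by (intro TI[of _ q]) auto
  qed
  fix h1 h2 assume h: "h1 \<in> T" "h2 \<in> T"
  obtain q where q: "h1 \<in> carrier R" "q \<in> P" "q \<notin> nonunits B" "h1 \<otimes> q \<in> P" using h(1) by (rule TE)
  obtain r where r: "h2 \<in> carrier R" "r \<in> P" "r \<notin> nonunits B" "h2 \<otimes> r \<in> P" using h(2) by (rule TE)
  have qr: "q \<otimes> r \<in> P" "q \<otimes> r \<notin> nonunits B"
    using Pc(4)[OF q(2) r(2)] surface_units_mult[OF sB _ _ q(3) r(3)] q(2) r(2) P_B by auto
  have C: "q \<in> carrier R" "r \<in> carrier R" using q r Pc by auto
  have "(h1 \<otimes> h2) \<otimes> (q \<otimes> r) = (h1 \<otimes> q) \<otimes> (h2 \<otimes> r)" using q(1) r(1) C by (simp add: m_ac)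
  then show "h1 \<otimes> h2 \<in> T" using TI[OF _ qr, of "h1 \<otimes> h2"] q r Pc(4) by simp
  have "(h1 \<oplus> h2) \<otimes> (q \<otimes> r) = (h1 \<otimes> q) \<otimes> r \<oplus> (h2 \<otimes> r) \<otimes> q" using q(1) r(1) C by algebra
  then show "h1 \<oplus> h2 \<in> T" using TI[OF _ qr, of "h1 \<oplus> h2"] q r Pc(4,5) by simp
qed

lemmas Tc = subring_closed[OF sT]

lemma A_T: "A \<subseteq> T" using A_P P_T by blast

lemma T_subset:
  assumes S: "subring S R" "P \<subseteq> S" and units: "\<And>q. q \<in> P \<Longrightarrow> q \<notin> nonunits B \<Longrightarrow> q \<notin> nonunits S"
  shows "T \<subseteq> S"
proof
  fix w assume "w \<in> T"
  then obtain q where q: "w \<in> carrier R" "q \<in> P" "q \<notin> nonunits B" "w \<otimes> q \<in> P" by (rule TE)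
  then obtain i where i: "i \<in> S" "q \<otimes> i = \<one>" using units[OF q(2,3)] unit_in[of q S] S by blast
  have "i \<in> carrier R" "q \<in> carrier R" using i q subring_closed(1)[OF S(1)] Pc by auto
  then have "w = (w \<otimes> q) \<otimes> i" using i q by (simp add: m_assoc)
  moreover have "(w \<otimes> q) \<otimes> i \<in> S" using i q S subring_closed(4)[OF S(1)] by blast
  ultimately show "w \<in> S" by simp
qed

lemma T_B: "T \<subseteq> B" by (rule T_subset[OF sB P_B])

lemma T_nonunits: "nonunits T = T \<inter> nonunits B"
proof
  show "T \<inter> nonunits B \<subseteq> nonunits T"
    using T_B by (auto simp: nonunits_def)
  show "nonunits T \<subseteq> T \<inter> nonunits B"
  proof (rule ccontr)
    assume "\<not> ?thesis"
    then obtain w where w: "w \<in> nonunits T" "w \<notin> nonunits B" using nonunits_in by blast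
    obtain q where q: "w \<in> carrier R" "q \<in> P" "q \<notin> nonunits B" "w \<otimes> q \<in> P" using nonunits_in[OF w(1)] by (rule TE)
    have wB: "w \<in> B" using nonunits_in[OF w(1)] T_B by blast
    then obtain i where i: "i \<in> B" "w \<otimes> i = \<one>" using unit_in w by blast
    have iC: "i \<in> carrier R" "q \<in> carrier R" using i Bc q Pc by auto
    have "w \<otimes> q \<notin> nonunits B" using surface_units_mult[OF sB wB _ w(2) q(3)] q P_B by blast
    moreover have "i \<otimes> (w \<otimes> q) = (w \<otimes> i) \<otimes> q" using iC q by (simp add: m_ac)
    then have "i \<otimes> (w \<otimes> q) = q" using i iC by simp
    ultimately have "i \<in> T" using q iC by (intro TI[of i "w \<otimes> q"]) auto
    then show False using w(1) i by (auto simp: nonunits_def)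
  qed
qed

lemma xT: "x \<in> nonunits T" and gT: "\<gamma> \<in> nonunits T"
  using xMB gMB xA A_T gP P_T by (auto simp: T_nonunits)

text \<open>
  \<open>T/xT\<close> is a discrete valuation ring with uniformizer \<open>\<gamma>\<close>.
\<close>
lemma T_decomposition:
  assumes "w \<in> T"
  shows "w \<in> mults T x \<or> (\<exists>s::nat. \<exists>e\<in>T - nonunits T. \<exists>u\<in>T. w = \<gamma> [^] s \<otimes> e \<oplus> x \<otimes> u)"
proof -
  obtain q where q: "w \<in> carrier R" "q \<in> P" "q \<notin> nonunits B" "w \<otimes> q \<in> P" using assms by (rule TE)
  have "q \<in> T" "q \<notin> nonunits T" using q P_T by (auto simp: T_nonunits)
  then obtain i where i: "i \<in> T" "q \<otimes> i = \<one>" using unit_in by blast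
  have iC: "i \<in> carrier R" "q \<in> carrier R" using i Tc q Pc by auto
  have w: "w = (w \<otimes> q) \<otimes> i" using i iC q by (simp add: m_assoc)
  have iunit: "i \<notin> nonunits T" using i \<open>q \<in> T\<close> iC by (auto simp: nonunits_def m_comm)
  obtain l where "w \<otimes> q \<in> pol l" using q(4) by (rule PE)
  from pol_decomposition[OF this] show ?thesis
  proof
    assume "w \<otimes> q \<in> mults P x"
    then obtain v where v: "v \<in> P" "w \<otimes> q = x \<otimes> v" by (rule multsE)
    have vC: "v \<in> carrier R" using v Pc(1) by blast
    have "w = x \<otimes> (v \<otimes> i)" using w v iC vC by (simp add: m_assoc)
    moreover have "v \<otimes> i \<in> T" using v P_T i(1) by (auto intro!: Tc(4))
    ultimately show ?thesis using multsI by metis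
  next
    assume "\<exists>s e u. e \<in> P \<and> e \<notin> nonunits B \<and> u \<in> P \<and> w \<otimes> q = \<gamma> [^] s \<otimes> e \<oplus> x \<otimes> u \<and> s * d < l"
    then obtain s :: nat and e u where *: "e \<in> P" "e \<notin> nonunits B" "u \<in> P" "w \<otimes> q = \<gamma> [^] s \<otimes> e \<oplus> x \<otimes> u" by blast
    have eT: "e \<in> T" "u \<in> T" "e \<notin> nonunits T" using * P_T by (auto simp: T_nonunits)
    define v where "v = \<gamma> [^] s"
    have C: "e \<in> carrier R" "u \<in> carrier R" "v \<in> carrier R" using * Pc by (auto simp: v_def)
    have "w = (v \<otimes> e \<oplus> x \<otimes> u) \<otimes> i" using w * by (simp add: v_def)
    also have "\<dots> = v \<otimes> (e \<otimes> i) \<oplus> x \<otimes> (u \<otimes> i)" using C iC elems(1) by algebra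
    finally have "w = \<gamma> [^] s \<otimes> (e \<otimes> i) \<oplus> x \<otimes> (u \<otimes> i)" by (simp add: v_def)
    moreover have "e \<otimes> i \<in> T - nonunits T" using surface_units_mult[OF sT eT(1) i(1) eT(3) iunit] eT i(1) by (simp add: Tc(4))
    moreover have "u \<otimes> i \<in> T" using eT i(1) by (simp add: Tc(4))
    ultimately show ?thesis by blast
  qed
qed

lemma T_maximal_ideal: "nonunits T = lin T x \<gamma>"
proof
  show "lin T x \<gamma> \<subseteq> nonunits T"
  proof
    fix c assume "c \<in> lin T x \<gamma>"
    then obtain r s where rs: "r \<in> T" "s \<in> T" "c = x \<otimes> r \<oplus> \<gamma> \<otimes> s" by (rule linE)
    have "c \<in> nonunits B" unfolding rs using rs T_B xMB gMB by (intro MBc(2,3)) auto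
    moreover have "c \<in> T" using rs xT gT nonunits_in Tc by simp
    ultimately show "c \<in> nonunits T" by (simp add: T_nonunits)
  qed
  show "nonunits T \<subseteq> lin T x \<gamma>"
  proof
    fix w assume w: "w \<in> nonunits T"
    then have wT: "w \<in> T" "w \<in> nonunits B" by (auto simp: T_nonunits)
    obtain q where q: "w \<in> carrier R" "q \<in> P" "q \<notin> nonunits B" "w \<otimes> q \<in> P" using wT(1) by (rule TE)
    have "q \<in> T" "q \<notin> nonunits T" using q P_T by (auto simp: T_nonunits)
    then obtain i where i: "i \<in> T" "q \<otimes> i = \<one>" using unit_in by blast
    have iC: "i \<in> carrier R" "q \<in> carrier R" using i Tc q Pc by auto
    have "w \<otimes> q \<in> nonunits B" using MBc(3)[OF wT(2)] q(2) P_B by blast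
    then have "w \<otimes> q \<in> lin P x \<gamma>" using P_nonunits q(4) by blast
    then obtain r s where rs: "r \<in> P" "s \<in> P" "w \<otimes> q = x \<otimes> r \<oplus> \<gamma> \<otimes> s" by (rule linE)
    have C: "r \<in> carrier R" "s \<in> carrier R" using rs Pc by auto
    have "w = (w \<otimes> q) \<otimes> i" using i iC q by (simp add: m_assoc)
    also have "\<dots> = x \<otimes> (r \<otimes> i) \<oplus> \<gamma> \<otimes> (s \<otimes> i)"
      unfolding rs using C iC elems(1) gC by algebra
    also have "\<dots> \<in> lin T x \<gamma>" using rs P_T i(1) by (intro linI Tc(4)) auto
    finally show "w \<in> lin T x \<gamma>" .
  qed
qed

lemma gamma_power_monic: "\<exists>h\<in>pol (s * d). \<gamma> [^] s = t [^] (s * d) \<oplus> h"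
proof (induction s)
  case 0
  then show ?case using pol_zero by (intro bexI[of _ \<zero>]) auto
next
  case (Suc s)
  then obtain h where h: "h \<in> pol (s * d)" "\<gamma> [^] s = t [^] (s * d) \<oplus> h" by blast
  define u where "u = t [^] (s * d)"
  define v where "v = t [^] d"
  have C: "h \<in> carrier R" "u \<in> carrier R" "v \<in> carrier R" "g \<in> carrier R"
    using h g pol_carrier by (auto simp: u_def v_def)
  have "\<gamma> [^] Suc s = (u \<oplus> h) \<otimes> (v \<oplus> g)" using h by (simp add: u_def v_def \<gamma>_def)
  also have "\<dots> = u \<otimes> v \<oplus> (u \<otimes> g \<oplus> v \<otimes> h \<oplus> h \<otimes> g)" using C by algebra
  also have "u \<otimes> v = t [^] (Suc s * d)" by (simp add: u_def v_def nat_pow_mult add.commute)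
  finally have "\<gamma> [^] Suc s = t [^] (Suc s * d) \<oplus> (u \<otimes> g \<oplus> v \<otimes> h \<oplus> h \<otimes> g)" .
  moreover have "u \<otimes> g \<oplus> v \<otimes> h \<oplus> h \<otimes> g \<in> pol (Suc s * d)"
    using pol_tpow[OF g, of "s * d"] pol_tpow[OF h(1), of d] pol_times[OF h(1) g]
    by (auto simp: u_def v_def add.commute intro!: pol_add)
  ultimately show ?case by blast
qed

text \<open>
  A power of \<open>\<gamma>\<close> is monic as a polynomial in \<open>t\<close>, and a denominator \<open>q\<close> has, modulo \<open>x\<close>, a unit
  as leading coefficient; so the product has one too and is not divisible by \<open>x\<close> in \<open>A[t]\<close>.
\<close>
lemma gamma_power_not_in_xT: "\<gamma> [^] (s::nat) \<notin> mults T x"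
proof
  assume "\<gamma> [^] s \<in> mults T x"
  then obtain w where w: "w \<in> T" "\<gamma> [^] s = x \<otimes> w" by (rule multsE)
  obtain q where q: "w \<in> carrier R" "q \<in> P" "q \<notin> nonunits B" "w \<otimes> q \<in> P" using w(1) by (rule TE)
  obtain l where l: "q \<in> pol l" using q(2) by (rule PE)
  have "q \<notin> mults P x" using q(3) xP_nonunit by blast
  then obtain e c r v where *: "c \<in> A" "c \<notin> nonunits A" "r \<in> pol e" "v \<in> P" "q = (c \<otimes> t [^] e \<oplus> r) \<oplus> x \<otimes> v"
    using leading_unit_mod_x[OF l] by blast
  obtain h where h: "h \<in> pol (s * d)" "\<gamma> [^] s = t [^] (s * d) \<oplus> h" using gamma_power_monic by blast
  define a where "a = t [^] (s * d)"
  define b where "b = t [^] e"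
  define p where "p = w \<otimes> q"
  define u where "u = \<gamma> [^] s"
  have pP: "p \<in> P" "u \<in> P" using q gP Pc by (auto simp: p_def u_def)
  have C: "a \<in> carrier R" "b \<in> carrier R" "c \<in> carrier R" "r \<in> carrier R" "v \<in> carrier R" "h \<in> carrier R" "p \<in> carrier R"
    "u \<in> carrier R" "q \<in> carrier R"
    using * h pol_carrier Ac Pc pP q by (auto simp: a_def b_def)
  have "x \<otimes> p = u \<otimes> q" using w q C by (simp add: p_def u_def m_assoc)
  then have xp: "x \<otimes> p = u \<otimes> (c \<otimes> b \<oplus> r) \<oplus> u \<otimes> (x \<otimes> v)"
    unfolding *(5) b_def[symmetric] using C by (simp add: r_distr)
  have "c \<otimes> (a \<otimes> b) \<oplus> (a \<otimes> r \<oplus> h \<otimes> (c \<otimes> b \<oplus> r)) = (a \<oplus> h) \<otimes> (c \<otimes> b \<oplus> r)"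
    using C by algebra
  also have "\<dots> = u \<otimes> (c \<otimes> b \<oplus> r)" using h by (simp add: a_def u_def)
  also have "\<dots> = (u \<otimes> (c \<otimes> b \<oplus> r) \<oplus> u \<otimes> (x \<otimes> v)) \<ominus> u \<otimes> (x \<otimes> v)" using C elems(1) by algebra
  also have "\<dots> = x \<otimes> p \<ominus> u \<otimes> (x \<otimes> v)" by (simp add: xp)
  also have "\<dots> = x \<otimes> (p \<ominus> u \<otimes> v)" using C elems(1) by algebra
  finally have "c \<otimes> (a \<otimes> b) \<oplus> (a \<otimes> r \<oplus> h \<otimes> (c \<otimes> b \<oplus> r)) \<in> mults P x"
    using multsI[of "p \<ominus> u \<otimes> v" P x] pP *(4) Pc by simp
  moreover have "a \<otimes> b = t [^] (s * d + e)" by (simp add: a_def b_def nat_pow_mult)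
  moreover have "a \<otimes> r \<oplus> h \<otimes> (c \<otimes> b \<oplus> r) \<in> pol (s * d + e)"
  proof -
    have "h \<otimes> b = t [^] e \<otimes> h" using C by (simp add: b_def m_comm)
    then have "h \<otimes> b \<in> pol (s * d + e)" using pol_tpow[OF h(1), of e] by (simp add: add.commute)
    moreover have "h \<otimes> (c \<otimes> b \<oplus> r) = c \<otimes> (h \<otimes> b) \<oplus> h \<otimes> r" using C by algebra
    ultimately show ?thesis
      using pol_tpow[OF *(3), of "s * d"] pol_times[OF h(1) *(3)] *(1) by (auto simp: a_def intro!: pol_add pol_smult)
  qed
  ultimately show False using leading_unit_not_in_xP[OF *(1,2)] by simp
qed

lemma x_mults_unit:
  assumes "a \<otimes> e \<in> mults T x" "a \<in> T" "e \<in> T" "e \<notin> nonunits T"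
  shows "a \<in> mults T x"
proof -
  obtain i where i: "i \<in> T" "e \<otimes> i = \<one>" using unit_in assms by blast
  have "(a \<otimes> e) \<otimes> i \<in> mults T x" by (rule mults_times[OF sT elems(1) assms(1) i(1)])
  moreover have "(a \<otimes> e) \<otimes> i = a" using i assms Tc by (simp add: m_assoc)
  ultimately show ?thesis by simp
qed

lemma gamma_unit_not_in_xT:
  assumes "e \<in> T" "e \<notin> nonunits T" shows "\<gamma> [^] (s::nat) \<otimes> e \<notin> mults T x"
proof -
  have "\<gamma> [^] s \<in> T" using gT nonunits_in by (simp add: Tc(8))
  then show ?thesis using x_mults_unit[OF _ _ assms] gamma_power_not_in_xT by blast
qed

lemma mults_diff:
  assumes "a \<oplus> x \<otimes> u \<in> mults T x" "a \<in> T" "u \<in> T" shows "a \<in> mults T x"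
proof -
  have C: "a \<in> carrier R" "u \<in> carrier R" using assms Tc by auto
  have "x \<otimes> \<ominus> u \<in> mults T x" using multsI[of "\<ominus> u" T x] assms Tc by simp
  then have "(a \<oplus> x \<otimes> u) \<oplus> x \<otimes> \<ominus> u \<in> mults T x"
    using assms(1) by (rule mults_add[OF sT elems(1), rotated])
  moreover have "(a \<oplus> x \<otimes> u) \<oplus> x \<otimes> \<ominus> u = a" using C elems(1) by algebra
  ultimately show ?thesis by simp
qed

lemma x_prime:
  assumes "a \<in> T" "b \<in> T" "a \<otimes> b \<in> mults T x"
  shows "a \<in> mults T x \<or> b \<in> mults T x"
proof (rule ccontr)
  assume no: "\<not> ?thesis"
  obtain s :: nat and e u where a: "e \<in> T" "e \<notin> nonunits T" "u \<in> T" "a = \<gamma> [^] s \<otimes> e \<oplus> x \<otimes> u"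
    using T_decomposition[OF assms(1)] no by blast
  obtain s' :: nat and e' u' where b: "e' \<in> T" "e' \<notin> nonunits T" "u' \<in> T" "b = \<gamma> [^] s' \<otimes> e' \<oplus> x \<otimes> u'"
    using T_decomposition[OF assms(2)] no by blast
  define p where "p = \<gamma> [^] s"
  define q where "q = \<gamma> [^] s'"
  have pqT: "p \<in> T" "q \<in> T" "x \<in> T" using gT xT nonunits_in Tc by (auto simp: p_def q_def)
  have C: "p \<in> carrier R" "q \<in> carrier R" "e \<in> carrier R" "u \<in> carrier R" "e' \<in> carrier R" "u' \<in> carrier R"
    using a b pqT Tc by auto
  have "a \<otimes> b = (p \<otimes> q) \<otimes> (e \<otimes> e') \<oplus> x \<otimes> (p \<otimes> e \<otimes> u' \<oplus> q \<otimes> e' \<otimes> u \<oplus> x \<otimes> u \<otimes> u')"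
    unfolding a b p_def[symmetric] q_def[symmetric] using C elems(1) by algebra
  then have "(p \<otimes> q) \<otimes> (e \<otimes> e') \<in> mults T x"
    using assms(3) mults_diff[of "(p \<otimes> q) \<otimes> (e \<otimes> e')" "p \<otimes> e \<otimes> u' \<oplus> q \<otimes> e' \<otimes> u \<oplus> x \<otimes> u \<otimes> u'"]
      pqT a b Tc by simp
  moreover have "p \<otimes> q = \<gamma> [^] (s + s')" by (simp add: p_def q_def nat_pow_mult)
  moreover have "e \<otimes> e' \<in> T" "e \<otimes> e' \<notin> nonunits T"
    using surface_units_mult[OF sT a(1) b(1) a(2) b(2)] a b Tc by auto
  ultimately show False using gamma_unit_not_in_xT by metis
qed

end

section \<open>Separators\<close>

context field
begin

text \<open>
  For \<open>g \<noteq> 0\<close> the fraction \<open>h/g\<close> lies outside \<open>B\<close> and in every surface \<open>S\<close> above \<open>A\<close> that is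
  incomparable with \<open>B\<close>. The condition on powers makes \<open>g\<close> generate an ideal of \<open>S\<close> that
  contains a power of the maximal ideal of \<open>A\<close>, which leaves room to change \<open>g\<close> by terms of high
  order. For \<open>g = 0\<close> the definition says that there is no such \<open>S\<close>.
\<close>
definition separator :: "'a set \<Rightarrow> 'a set \<Rightarrow> 'a \<Rightarrow> 'a \<Rightarrow> nat \<Rightarrow> bool" where
  "separator A B g h n \<longleftrightarrow> g \<in> A \<and> h \<in> A \<and> h \<notin> mults B g \<and>
     (\<forall>S. surface S \<and> A \<subseteq> S \<and> \<not> B \<subseteq> S \<and> \<not> S \<subseteq> B \<longrightarrow>
        h \<in> mults S g \<and> (\<forall>c\<in>nonunits A. c [^] n \<in> mults S g))"

lemma one_minus_nonunit:
  assumes "surface A" "a \<in> nonunits A" shows "\<one> \<ominus> a \<notin> nonunits A"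
  using unit_add_nonunit[OF assms(1) subring_closed(3)[OF surface_subring[OF assms(1)]]
      one_not_nonunit[OF surface_subring[OF assms(1)]] surface_nonunits(5)[OF assms]]
  by (simp add: minus_eq)

lemma mults_unit_cancel:
  assumes S: "subring S R" and "a \<in> carrier R" "e \<in> S" "e \<notin> nonunits S"
  shows "mults S (a \<otimes> e) = mults S a"
proof
  note Sc = subring_closed[OF S]
  obtain i where i: "i \<in> S" "e \<otimes> i = \<one>" using unit_in assms by blast
  have C: "e \<in> carrier R" "i \<in> carrier R" using i assms Sc by auto
  show "mults S (a \<otimes> e) \<subseteq> mults S a"
  proof
    fix z assume "z \<in> mults S (a \<otimes> e)"
    then obtain r where r: "r \<in> S" "z = a \<otimes> e \<otimes> r" by (rule multsE)
    then have "z = a \<otimes> (e \<otimes> r)" using C assms Sc(1) by (simp add: m_assoc)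
    then show "z \<in> mults S a" using multsI[of "e \<otimes> r" S a] r(1) assms(3) Sc(4) by simp
  qed
  show "mults S a \<subseteq> mults S (a \<otimes> e)"
  proof
    fix z assume "z \<in> mults S a"
    then obtain r where r: "r \<in> S" "z = a \<otimes> r" by (rule multsE)
    have rC: "r \<in> carrier R" using r Sc by simp
    have "a \<otimes> e \<otimes> (i \<otimes> r) = a \<otimes> (e \<otimes> i) \<otimes> r" using C rC assms(2) by (simp add: m_assoc)
    then have "z = a \<otimes> e \<otimes> (i \<otimes> r)" using r(2) i(2) assms(2) by simp
    then show "z \<in> mults S (a \<otimes> e)" using multsI[of "i \<otimes> r" S "a \<otimes> e"] r(1) i(1) Sc(4) by simp
  qed
qed

text \<open>
  In each of the rings \<open>S\<close> the second summand is \<open>g\<close> times a nonunit, so the new element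
  generates the same ideal. In \<open>B\<close> this may fail, but only if the new element does not divide
  \<open>c\<^sup>n\<close>, which then serves as the new numerator.
\<close>
lemma separator_perturb:
  assumes A: "surface A" and B: "surface B" and AB: "A \<subseteq> B"
    and sep: "separator A B g h n" and e: "e \<in> A" "e \<notin> nonunits A"
    and c: "c \<in> nonunits A" and b: "b \<in> A"
  shows "\<exists>h'. separator A B (g \<otimes> e \<oplus> c [^] Suc n \<otimes> b) h' n"
proof -
  have sA: "subring A R" and sB: "subring B R" using A B by (auto intro: surface_subring)
  note Ac = subring_closed[OF sA] and Bc = subring_closed[OF sB]
  define g' where "g' = g \<otimes> e \<oplus> c [^] Suc n \<otimes> b"
  define C where "C = c [^] n"
  have gh: "g \<in> A" "h \<in> A" "h \<notin> mults B g" using sep by (auto simp: separator_def)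
  have cA: "c \<in> A" using c nonunits_in by blast
  have CA: "C \<in> A" using cA Ac by (simp add: C_def)
  have g'A: "g' \<in> A" using gh e cA b Ac by (simp add: g'_def)
  have inC: "g \<in> carrier R" "e \<in> carrier R" "c \<in> carrier R" "b \<in> carrier R" "C \<in> carrier R" "g' \<in> carrier R"
    using gh e cA b CA g'A Ac(1) by auto
  have g'_eq: "g' = g \<otimes> e \<oplus> C \<otimes> c \<otimes> b" by (simp add: g'_def C_def)
  have e_unit: "e \<notin> nonunits S" if "A \<subseteq> S" for S
    using unit_mono[OF that e] .
  \<comment> \<open>Nakayama: \<open>g\<close> and \<open>g'\<close> differ by a factor \<open>e + c w b\<close>, a unit plus a nonunit.\<close>
  have same: "mults S g' = mults S g" if S: "surface S" "A \<subseteq> S" "C \<in> mults S g" for S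
  proof -
    have sS: "subring S R" using S by (auto intro: surface_subring)
    note Sc = subring_closed[OF sS]
    obtain w where w: "w \<in> S" "C = g \<otimes> w" using S(3) by (rule multsE)
    have wC: "w \<in> carrier R" using w Sc by simp
    have eq: "g' = g \<otimes> (e \<oplus> c \<otimes> (w \<otimes> b))"
      unfolding g'_eq w(2) using inC wC by algebra
    have "c \<in> nonunits S" using surface_dominates[OF A S(1,2)] c by blast
    then have "c \<otimes> (w \<otimes> b) \<in> nonunits S" using w b S(2) Sc(4) surface_nonunits(3)[OF S(1)] by blast
    then have "e \<oplus> c \<otimes> (w \<otimes> b) \<notin> nonunits S"
      using unit_add_nonunit[OF S(1) _ e_unit[OF S(2)]] e S(2) by blast
    moreover have "e \<oplus> c \<otimes> (w \<otimes> b) \<in> S" using e cA w b S(2) by (auto intro!: Sc)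
    ultimately show ?thesis unfolding eq by (intro mults_unit_cancel[OF sS inC(1)])
  qed
  have old: "mults S g' = mults S g" "h \<in> mults S g" "\<forall>c\<in>nonunits A. c [^] n \<in> mults S g"
    if S: "surface S" "A \<subseteq> S" "\<not> B \<subseteq> S" "\<not> S \<subseteq> B" for S
  proof -
    show "h \<in> mults S g" and *: "\<forall>c\<in>nonunits A. c [^] n \<in> mults S g"
      using sep S unfolding separator_def by blast+
    show "mults S g' = mults S g" using same[OF S(1,2)] * c by (simp add: C_def)
  qed
  show ?thesis
  proof (cases "C \<in> mults B g'")
    case False
    have "separator A B g' C n"
      unfolding separator_def using g'A CA False old c by (auto simp: C_def)
    then show ?thesis unfolding g'_def by blast
  next
    case True
    then obtain w where w: "w \<in> B" "C = g' \<otimes> w" by (rule multsE)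
    have wC: "w \<in> carrier R" using w Bc by simp
    have "g \<otimes> e = (g \<otimes> e \<oplus> C \<otimes> c \<otimes> b) \<ominus> C \<otimes> c \<otimes> b" using inC by algebra
    also have "\<dots> = g' \<ominus> g' \<otimes> w \<otimes> c \<otimes> b" using g'_eq w by simp
    also have "\<dots> = g' \<otimes> (\<one> \<ominus> c \<otimes> (w \<otimes> b))" using inC wC by algebra
    finally have eq: "g \<otimes> e = g' \<otimes> (\<one> \<ominus> c \<otimes> (w \<otimes> b))" .
    have "c \<in> nonunits B" using surface_dominates[OF A B AB] c by blast
    then have "c \<otimes> (w \<otimes> b) \<in> nonunits B" using w b AB Bc(4) surface_nonunits(3)[OF B] by blast
    then have "\<one> \<ominus> c \<otimes> (w \<otimes> b) \<notin> nonunits B" by (rule one_minus_nonunit[OF B])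
    moreover have "\<one> \<ominus> c \<otimes> (w \<otimes> b) \<in> B" using cA w b AB by (auto intro!: Bc)
    ultimately have "mults B (g \<otimes> e) = mults B g'" unfolding eq by (intro mults_unit_cancel[OF sB inC(6)])
    moreover have "mults B (g \<otimes> e) = mults B g"
      using mults_unit_cancel[OF sB inC(1) _ e_unit[OF AB]] e AB by blast
    ultimately have "h \<notin> mults B g'" using gh by simp
    then have "separator A B g' h n"
      unfolding separator_def using g'A gh old by auto
    then show ?thesis unfolding g'_def by blast
  qed
qed

end

section \<open>The quadratic transform is a surface\<close>

context blowup_center
begin

text \<open>
  If powers of \<open>x\<close> and \<open>\<gamma>\<close> were multiples of a nonunit \<open>b\<close>, then \<open>x\<close> would not divide \<open>b\<close>, as it
  divides no power of \<open>\<gamma>\<close>; being prime, it could be cancelled from \<open>x\<^sup>n = b s\<close>, and \<open>b\<close> would be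
  a unit.
\<close>
lemma T_dim_at_least_two: "dim_at_least_two T"
  unfolding dim_at_least_two_def
proof (rule ballI, rule ccontr)
  fix b assume b: "b \<in> nonunits T" and "\<not> (\<exists>c\<in>nonunits T. \<forall>n::nat. c [^] n \<notin> mults T b)"
  then have pow: "\<exists>n::nat. c [^] n \<in> mults T b" if "c \<in> nonunits T" for c using that by blast
  have bT: "b \<in> T" "b \<in> carrier R" using b nonunits_in Tc(1) by blast+
  have bx: "b \<notin> mults T x"
  proof
    assume "b \<in> mults T x"
    then obtain v where v: "v \<in> T" "b = x \<otimes> v" by (rule multsE)
    obtain n :: nat where "\<gamma> [^] n \<in> mults T b" using pow[OF gT] by blast
    then obtain w where w: "w \<in> T" "\<gamma> [^] n = b \<otimes> w" by (rule multsE)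
    have "\<gamma> [^] n = x \<otimes> (v \<otimes> w)" using v w Tc(1) by (simp add: m_assoc)
    then have "\<gamma> [^] n \<in> mults T x" using multsI[of "v \<otimes> w" T x] v w Tc(4) by simp
    then show False using gamma_power_not_in_xT by blast
  qed
  have no: "\<not> (\<exists>s\<in>T. x [^] n = b \<otimes> s)" for n :: nat
  proof (induction n)
    case 0
    then show ?case using b by (auto simp: nonunits_def)
  next
    case (Suc n)
    show ?case
    proof
      assume "\<exists>s\<in>T. x [^] Suc n = b \<otimes> s"
      then obtain s where s: "s \<in> T" "x [^] Suc n = b \<otimes> s" by blast
      have "x [^] Suc n = x \<otimes> x [^] n" by (simp add: m_comm)
      moreover have "x [^] n \<in> T" using xA A_T Tc(8) by blast
      ultimately have "b \<otimes> s \<in> mults T x" using multsI[of "x [^] n" T x] s by simp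
      then obtain s' where s': "s' \<in> T" "s = x \<otimes> s'" using x_prime[OF bT(1) s(1)] bx by (auto elim: multsE)
      have "x \<otimes> x [^] n = x \<otimes> (b \<otimes> s')"
        using s s' bT Tc(1) \<open>x [^] Suc n = x \<otimes> x [^] n\<close> by (simp add: m_lcomm)
      then have "x [^] n = b \<otimes> s'" using x0 bT s' Tc(1) by (simp add: m_lcancel)
      then show False using Suc s' by blast
    qed
  qed
  obtain n :: nat where "x [^] n \<in> mults T b" using pow[OF xT] by blast
  then show False using no unfolding mults_def by blast
qed

lemma T_adically_separated: "adically_separated T"
  unfolding adically_separated_def
proof (intro ballI impI)
  fix x' y' a assume *: "x' \<in> nonunits T" "y' \<in> nonunits T" "a \<in> T" "\<forall>k. a \<in> forms T x' y' (Suc k)"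
  have "\<forall>k. a \<in> forms B x' y' (Suc k)" using *(4) forms_mono[OF T_B] by blast
  moreover have "x' \<in> nonunits B" "y' \<in> nonunits B" "a \<in> B" using * T_B by (auto simp: T_nonunits)
  ultimately show "a = \<zero>" using B unfolding surface_def adically_separated_def by blast
qed

text \<open>
  Modulo \<open>x\<close> the element \<open>p\<close> is a power of \<open>\<gamma>\<close> times a unit, so a power of every nonunit has the
  form \<open>p v + x w\<close>; now raise this to the power \<open>n\<close>.
\<close>
lemma T_primary:
  assumes p: "p \<in> T" "p \<notin> mults T x" and q: "q \<in> T" and xn: "x [^] (n::nat) \<in> lin T p q"
  shows "primary_pair T p q"
  unfolding primary_pair_def
proof
  fix c assume "c \<in> nonunits T"
  then obtain f f' where f: "f \<in> T" "f' \<in> T" "c = x \<otimes> f \<oplus> \<gamma> \<otimes> f'"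
    unfolding T_maximal_ideal by (rule linE)
  obtain s :: nat and e u where seu: "e \<in> T" "e \<notin> nonunits T" "u \<in> T" "p = \<gamma> [^] s \<otimes> e \<oplus> x \<otimes> u"
    using T_decomposition[OF p(1)] p(2) by blast
  obtain i where i: "i \<in> T" "e \<otimes> i = \<one>" using unit_in seu by blast
  have xT': "x \<in> T" and gT': "\<gamma> \<in> T" using xT gT nonunits_in by auto
  obtain w where w: "w \<in> T" "c [^] s = x \<otimes> w \<oplus> (\<gamma> \<otimes> f') [^] s"
    using power_add_mults[OF sT xT' f(1), of "\<gamma> \<otimes> f'" s] f gT' Tc(4) by auto
  define v where "v = \<gamma> [^] s"
  define k where "k = f' [^] s"
  have vk: "v \<in> T" "k \<in> T" using gT' f Tc(8) by (auto simp: v_def k_def)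
  have C: "p \<in> carrier R" "q \<in> carrier R" "e \<in> carrier R" "u \<in> carrier R" "i \<in> carrier R" "w \<in> carrier R"
    "v \<in> carrier R" "k \<in> carrier R" "f \<in> carrier R" "f' \<in> carrier R" "c \<in> carrier R"
    using p q seu i w vk f \<open>c \<in> nonunits T\<close> nonunits_in Tc(1) by blast+
  have "p \<otimes> (i \<otimes> k) \<oplus> x \<otimes> (w \<ominus> u \<otimes> i \<otimes> k) = x \<otimes> w \<oplus> v \<otimes> (e \<otimes> i) \<otimes> k"
    unfolding seu(4) v_def[symmetric] using C elems(1) by algebra
  also have "\<dots> = x \<otimes> w \<oplus> v \<otimes> k" using i C by simp
  also have "\<dots> = c [^] s" using w f C by (simp add: v_def k_def nat_pow_distrib)
  finally have cs: "c [^] s = p \<otimes> (i \<otimes> k) \<oplus> x \<otimes> (w \<ominus> u \<otimes> i \<otimes> k)" by simp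
  define w2 where "w2 = w \<ominus> u \<otimes> i \<otimes> k"
  have w2: "w2 \<in> T" "w2 \<in> carrier R" using w seu i vk C Tc by (auto simp: w2_def)
  obtain w3 where w3: "w3 \<in> T" "(p \<otimes> (i \<otimes> k) \<oplus> x \<otimes> w2) [^] n = p \<otimes> w3 \<oplus> (x \<otimes> w2) [^] n"
    using power_add_mults[OF sT p(1), of "i \<otimes> k" "x \<otimes> w2" n] i vk w2 xT' Tc(4) by auto
  obtain r l where rl: "r \<in> T" "l \<in> T" "x [^] n = p \<otimes> r \<oplus> q \<otimes> l" using xn by (rule linE)
  define z where "z = w2 [^] n"
  have z: "z \<in> T" using w2 Tc(8) by (simp add: z_def)
  have C2: "r \<in> carrier R" "l \<in> carrier R" "z \<in> carrier R" "w3 \<in> carrier R" using rl z w3 Tc(1) by auto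
  have "(x \<otimes> w2) [^] n = (p \<otimes> r \<oplus> q \<otimes> l) \<otimes> z" using rl w2 by (simp add: nat_pow_distrib z_def)
  then have "(c [^] s) [^] n = p \<otimes> w3 \<oplus> (p \<otimes> r \<oplus> q \<otimes> l) \<otimes> z" using w3 cs by (simp add: w2_def)
  also have "\<dots> = p \<otimes> (w3 \<oplus> r \<otimes> z) \<oplus> q \<otimes> (l \<otimes> z)" using C C2 by algebra
  also have "\<dots> \<in> lin T p q" using w3 rl z Tc by (intro linI) auto
  finally have "c [^] (s * n) \<in> lin T p q" using C by (simp add: nat_pow_pow)
  then show "\<exists>n::nat. c [^] n \<in> lin T p q" ..
qed

text \<open>
  Start from lowest terms over \<open>A\<close> and cancel the largest common power of \<open>x\<close>. It exists because
  elements divisible by all powers of \<open>x\<close> are zero in \<open>B\<close>.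
\<close>
lemma T_fraction:
  assumes z: "z \<in> carrier R"
  shows "\<exists>a\<in>T. \<exists>b\<in>T. b \<noteq> \<zero> \<and> z \<otimes> b = a \<and> primary_pair T a b"
proof -
  obtain a b where ab: "a \<in> A" "b \<in> A" "b \<noteq> \<zero>" "z \<otimes> b = a" "primary_pair A a b"
    using surface_fraction[OF A z] by blast
  have abC: "a \<in> carrier R" "b \<in> carrier R" using ab Ac by auto
  define Q where "Q i \<longleftrightarrow> (\<exists>a'\<in>T. \<exists>b'\<in>T. a = x [^] i \<otimes> a' \<and> b = x [^] i \<otimes> b')" for i :: nat
  have Q0: "Q 0" unfolding Q_def using ab A_T abC by force
  have "\<exists>k. \<not> Q k"
  proof (rule ccontr)
    assume "\<not> ?thesis"
    then have all: "Q k" for k by blast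
    have "b \<in> forms B x x (Suc k)" for k
    proof -
      obtain b' where b': "b' \<in> T" "b = x [^] k \<otimes> b'" using all[of k] unfolding Q_def by blast
      have "b' \<otimes> x [^] k \<in> forms B x x (Suc k)"
        using const_times_power_forms[of B x x b' k] b' T_B Bc(2) by auto
      then show ?thesis using b' Tc(1) by (simp add: m_comm)
    qed
    moreover have "b \<in> B" using ab AB by blast
    ultimately have "b = \<zero>" using B xMB unfolding surface_def adically_separated_def by blast
    then show False using ab by simp
  qed
  define m where "m = (LEAST k. \<not> Q k)"
  have "\<not> Q m" unfolding m_def using \<open>\<exists>k. \<not> Q k\<close> by (rule LeastI_ex)
  then obtain i where i: "m = Suc i" using Q0 by (cases m) auto
  have "Q i" using not_less_Least[of i "\<lambda>k. \<not> Q k"] i unfolding m_def[symmetric] by simp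
  then obtain a' b' where ab': "a' \<in> T" "b' \<in> T" "a = x [^] i \<otimes> a'" "b = x [^] i \<otimes> b'"
    unfolding Q_def by blast
  have ab'C: "a' \<in> carrier R" "b' \<in> carrier R" using ab' Tc by auto
  have b'0: "b' \<noteq> \<zero>" using ab'(4) ab(3) by auto
  have one: "a' \<notin> mults T x \<or> b' \<notin> mults T x"
  proof (rule ccontr)
    assume "\<not> ?thesis"
    then obtain a'' b'' where *: "a'' \<in> T" "a' = x \<otimes> a''" "b'' \<in> T" "b' = x \<otimes> b''"
      by (auto elim!: multsE)
    have "a = x [^] Suc i \<otimes> a''" "b = x [^] Suc i \<otimes> b''"
      using * ab' Tc(1) by (simp_all add: m_assoc)
    then have "Q (Suc i)" unfolding Q_def using * by blast
    then show False using \<open>\<not> Q m\<close> i by simp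
  qed
  obtain n :: nat where "x [^] n \<in> lin A a b" using ab(5) xM unfolding primary_pair_def by blast
  then obtain r s where rs: "r \<in> A" "s \<in> A" "x [^] n = a \<otimes> r \<oplus> b \<otimes> s" by (rule linE)
  define Z where "Z = x [^] i"
  have Z: "Z \<in> T" "Z \<in> carrier R" "Z \<noteq> \<zero>" using xA A_T Tc(8) pow_nonzero[OF _ x0] by (auto simp: Z_def)
  have rsT: "r \<in> T" "s \<in> T" "r \<in> carrier R" "s \<in> carrier R" using rs A_T Ac(1) by auto
  have "x [^] n = a' \<otimes> (Z \<otimes> r) \<oplus> b' \<otimes> (Z \<otimes> s)"
    unfolding rs(3) ab'(3,4) Z_def[symmetric] using ab'C Z rsT(3,4) by algebra
  then have xn: "x [^] n \<in> lin T a' b'" using Z(1) rsT(1,2) Tc(4) linI[of "Z \<otimes> r" T "Z \<otimes> s" a' b'] by simp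
  have comm: "lin T a' b' = lin T b' a'" by (rule lin_commute[OF sT ab'C])
  have "primary_pair T a' b'"
    using one
  proof
    assume "a' \<notin> mults T x"
    then show ?thesis using T_primary ab' xn by blast
  next
    assume "b' \<notin> mults T x"
    then have "primary_pair T b' a'" using T_primary ab' xn comm by blast
    then show ?thesis by (simp add: primary_pair_def comm)
  qed
  moreover have "z \<otimes> b' = a'"
  proof -
    have "Z \<otimes> (z \<otimes> b') = Z \<otimes> a'" using ab(4) ab'(3,4) z ab'C Z(2) by (simp add: Z_def m_lcomm)
    then show ?thesis using Z ab'C z by (simp add: m_lcancel)
  qed
  ultimately show ?thesis using ab' b'0 by blast
qed

theorem surface_T: "surface T"
proof -
  have "x \<in> T" "\<gamma> \<in> T" using xT gT nonunits_in by auto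
  then show ?thesis
    using sT T_maximal_ideal T_dim_at_least_two T_adically_separated T_fraction unfolding surface_def by blast
qed

lemmas MTc = surface_nonunits[OF surface_T]

section \<open>Weierstrass polynomials at the centre\<close>

text \<open>
  \<open>A[t]/(x, \<gamma>)\<close> is a field. As in Euclid's algorithm, divide \<open>\<gamma>\<close> by the monic polynomial \<open>\<delta>\<close>
  that is proportional to \<open>r\<close> modulo \<open>x\<close>. The remainder has lower degree, and it does not vanish
  at the centre of \<open>B\<close>: otherwise it would be divisible by \<open>x\<close>, and so would the quotient, which
  has degree below \<open>d\<close> and would vanish there as well; but then \<open>x\<close> would divide \<open>\<gamma>\<close>.
\<close>
lemma short_inverse:
  assumes "k \<le> d" "r \<in> pol k" "r \<notin> nonunits B"
  shows "\<exists>r'\<in>P. \<one> \<ominus> r \<otimes> r' \<in> nonunits B"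
  using assms
proof (induction k arbitrary: r rule: less_induct)
  case (less k)
  obtain e c r0 s where *: "e < k" "c \<in> A" "c \<notin> nonunits A" "r0 \<in> pol e" "s \<in> P" "r = (c \<otimes> t [^] e \<oplus> r0) \<oplus> x \<otimes> s"
    using leading_unit_mod_x[OF less.prems(2)] xP_nonunit less.prems(3) by blast
  obtain i where i: "i \<in> A" "c \<otimes> i = \<one>" using unit_in * by blast
  define u where "u = t [^] e"
  define \<delta> where "\<delta> = u \<oplus> i \<otimes> r0"
  have C: "c \<in> carrier R" "i \<in> carrier R" "r0 \<in> carrier R" "s \<in> carrier R" "u \<in> carrier R" "r \<in> carrier R"
    using * i less.prems Ac(1) Pc(1) pol_carrier by (auto simp: u_def)
  have \<delta>C: "\<delta> \<in> carrier R" using C by (simp add: \<delta>_def)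
  have "c \<otimes> \<delta> = c \<otimes> u \<oplus> (c \<otimes> i) \<otimes> r0" unfolding \<delta>_def using C by algebra
  then have r_eq: "r = c \<otimes> \<delta> \<oplus> x \<otimes> s" using i * C by (simp add: u_def)
  have iP: "i \<in> P" using i A_P by blast
  show ?case
  proof (cases "e = 0")
    case True
    then have "\<delta> = \<one>" using *(4) C by (simp add: \<delta>_def u_def pol_0)
    then have "\<one> \<ominus> r \<otimes> i = \<one> \<ominus> (c \<otimes> i \<oplus> x \<otimes> (s \<otimes> i))" unfolding r_eq using C elems(1) by algebra
    also have "\<dots> = \<ominus> (x \<otimes> (s \<otimes> i))" unfolding i(2) using C elems(1) by algebra
    also have "\<dots> \<in> nonunits B" using *(5) iP Pc(4) by (intro MBc(5) xP_nonunit multsI)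
    finally show ?thesis using iP by blast
  next
    case False
    have ed: "e < d" using * less.prems by simp
    have ir0: "i \<otimes> r0 \<in> pol e" using pol_smult i * by blast
    obtain q r1 where qr: "q \<in> pol (Suc d - e)" "r1 \<in> pol e" "\<gamma> = q \<otimes> \<delta> \<oplus> r1"
      using monic_division[OF ir0 g_pol] by (auto simp: \<delta>_def u_def)
    have qP: "q \<in> P" "r1 \<in> P" using qr PI by auto
    have \<delta>P: "\<delta> \<in> P" using PI[OF ir0] t_P Pc by (simp add: \<delta>_def u_def)
    have C2: "q \<in> carrier R" "r1 \<in> carrier R" using qP Pc(1) by auto
    have "r1 \<notin> nonunits B"
    proof
      assume r1: "r1 \<in> nonunits B"
      have "\<gamma> \<ominus> r1 \<in> nonunits B" using MBc(6)[OF gMB r1] .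
      moreover have "(q \<otimes> \<delta> \<oplus> r1) \<ominus> r1 = q \<otimes> \<delta>" using C2 \<delta>C by algebra
      ultimately have "q \<otimes> \<delta> \<in> nonunits B" using qr by simp
      moreover have "\<delta> \<notin> nonunits B" using minimal[OF ed ir0] by (simp add: \<delta>_def u_def)
      ultimately have "q \<in> nonunits B" using surface_units_mult[OF sB] qP \<delta>P P_B by blast
      moreover have "q \<in> pol d" using pol_mono[OF _ qr(1)] False by simp
      ultimately have "q \<in> mults P x" by (intro short_nonunit_in_xP)
      moreover have "r1 \<in> mults P x" using short_nonunit_in_xP[OF pol_mono[OF _ qr(2)] r1] ed by simp
      ultimately have "\<gamma> \<in> mults P x"
        unfolding qr(3) by (intro mults_add[OF sP elems(1)] mults_times[OF sP elems(1) _ \<delta>P])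
      moreover have "\<gamma> = \<one> \<otimes> t [^] d \<oplus> g" by (simp add: \<gamma>_def)
      ultimately show False using leading_unit_not_in_xP[OF Ac(3) one_not_nonunit[OF sA] g] by simp
    qed
    then obtain r1' where r1': "r1' \<in> P" "\<one> \<ominus> r1 \<otimes> r1' \<in> nonunits B"
      using less.IH[OF *(1) _ qr(2)] ed by auto
    have r1'C: "r1' \<in> carrier R" using r1' Pc(1) by blast
    define r' where "r' = \<ominus> (i \<otimes> q \<otimes> r1')"
    have "\<one> \<ominus> r \<otimes> r' = \<one> \<oplus> ((c \<otimes> i) \<otimes> (q \<otimes> \<delta>)) \<otimes> r1' \<oplus> x \<otimes> (s \<otimes> i \<otimes> q \<otimes> r1')"
      unfolding r_eq r'_def using C C2 \<delta>C r1'C elems(1) by algebra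
    also have "(c \<otimes> i) \<otimes> (q \<otimes> \<delta>) = (q \<otimes> \<delta> \<oplus> r1) \<ominus> r1" unfolding i(2) using C2 \<delta>C by algebra
    also have "\<dots> = \<gamma> \<ominus> r1" using qr by simp
    also have "\<one> \<oplus> (\<gamma> \<ominus> r1) \<otimes> r1' \<oplus> x \<otimes> (s \<otimes> i \<otimes> q \<otimes> r1')
        = (\<one> \<ominus> r1 \<otimes> r1') \<oplus> r1' \<otimes> \<gamma> \<oplus> x \<otimes> (s \<otimes> i \<otimes> q \<otimes> r1')"
      using C C2 r1'C elems(1) gC by algebra
    also have "\<dots> \<in> nonunits B"
      using *(5) iP qP r1' Pc(4)
      by (intro MBc(2) r1'(2) gamma_times_nonunit[OF r1'(1)] xP_nonunit multsI) auto
    finally have "\<one> \<ominus> r \<otimes> r' \<in> nonunits B" .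
    moreover have "r' \<in> P" using iP qP r1' by (auto simp: r'_def intro!: Pc)
    ultimately show ?thesis by blast
  qed
qed

lemma P_inverse:
  assumes "q \<in> P" "q \<notin> nonunits B"
  shows "\<exists>q'\<in>P. \<one> \<ominus> q \<otimes> q' \<in> nonunits B"
proof -
  obtain l where l: "q \<in> pol l" using assms(1) by (rule PE)
  obtain q1 r where qr: "q1 \<in> pol (l - d)" "r \<in> pol d" "q = q1 \<otimes> \<gamma> \<oplus> r"
    using monic_division[OF g l] by (auto simp: \<gamma>_def)
  have q1P: "q1 \<in> P" "r \<in> P" using qr PI by auto
  have C: "q1 \<in> carrier R" "r \<in> carrier R" using q1P Pc(1) by auto
  have "r \<notin> nonunits B" using assms(2) gamma_times_nonunit[OF q1P(1)] MBc(2) qr(3) by auto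
  then obtain r' where r': "r' \<in> P" "\<one> \<ominus> r \<otimes> r' \<in> nonunits B"
    using short_inverse[OF _ qr(2)] by blast
  have r'C: "r' \<in> carrier R" using r' Pc(1) by blast
  have "\<one> \<ominus> q \<otimes> r' = (\<one> \<ominus> r \<otimes> r') \<ominus> (q1 \<otimes> r') \<otimes> \<gamma>"
    unfolding qr(3) using C r'C gC by algebra
  also have "\<dots> \<in> nonunits B" using r' q1P by (intro MBc(6)[OF r'(2)] gamma_times_nonunit Pc(4))
  finally show ?thesis using r'(1) by blast
qed

text \<open>
  Denominators can be inverted modulo \<open>(\<gamma>\<^sup>s, x)\<close>: if \<open>\<epsilon> = 1 - q q'\<close> is a nonunit, then \<open>1 - \<epsilon>\<^sup>s\<close>
  is a multiple of \<open>q\<close>, and \<open>\<epsilon>\<^sup>s\<close> lies in \<open>(\<gamma>\<^sup>s, x)\<close>.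
\<close>
lemma T_mod_P:
  assumes w: "w \<in> T"
  shows "\<exists>p\<in>P. \<exists>a\<in>T. \<exists>b\<in>T. w = p \<oplus> \<gamma> [^] (s::nat) \<otimes> a \<oplus> x \<otimes> b"
proof -
  obtain q where q: "w \<in> carrier R" "q \<in> P" "q \<notin> nonunits B" "w \<otimes> q \<in> P" using w by (rule TE)
  obtain q' where q': "q' \<in> P" "\<one> \<ominus> q \<otimes> q' \<in> nonunits B" using P_inverse[OF q(2,3)] by blast
  define \<epsilon> where "\<epsilon> = \<one> \<ominus> q \<otimes> q'"
  have C: "q \<in> carrier R" "q' \<in> carrier R" using q q' Pc(1) by auto
  have \<epsilon>P: "\<epsilon> \<in> P" using q q' Pc by (simp add: \<epsilon>_def)
  have \<epsilon>C: "\<epsilon> \<in> carrier R" using \<epsilon>P Pc(1) by blast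
  have "\<exists>q''\<in>P. q \<otimes> q'' = \<one> \<ominus> \<epsilon> [^] s"
  proof (induction s)
    case 0
    have "q \<otimes> \<zero> = \<one> \<ominus> \<one>" using C by algebra
    then show ?case using Pc(2) by (intro bexI[of _ \<zero>]) auto
  next
    case (Suc s)
    then obtain q'' where q'': "q'' \<in> P" "q \<otimes> q'' = \<one> \<ominus> \<epsilon> [^] s" by blast
    define E where "E = \<epsilon> [^] s"
    have E: "E \<in> carrier R" "E \<in> P" using \<epsilon>C \<epsilon>P Pc(8) by (auto simp: E_def)
    have q''C: "q'' \<in> carrier R" using q'' Pc(1) by blast
    have "q \<otimes> (q'' \<oplus> E \<otimes> q') = q \<otimes> q'' \<oplus> E \<otimes> (q \<otimes> q')" using C E(1) q''C by algebra
    also have "\<dots> = (\<one> \<ominus> E) \<oplus> E \<otimes> (q \<otimes> q')" using q'' by (simp add: E_def)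
    also have "\<dots> = \<one> \<ominus> (E \<ominus> E \<otimes> (q \<otimes> q'))" using C E(1) by algebra
    also have "E \<ominus> E \<otimes> (q \<otimes> q') = E \<otimes> \<epsilon>"
      unfolding \<epsilon>_def using C E(1) by (simp add: minus_eq r_distr r_minus)
    finally have "q \<otimes> (q'' \<oplus> E \<otimes> q') = \<one> \<ominus> \<epsilon> [^] Suc s" by (simp add: E_def)
    then show ?case using q'' q' E Pc by (intro bexI[of _ "q'' \<oplus> E \<otimes> q'"]) auto
  qed
  then obtain q'' where q'': "q'' \<in> P" "q \<otimes> q'' = \<one> \<ominus> \<epsilon> [^] s" by blast
  have "\<epsilon> \<in> lin P x \<gamma>" using P_nonunits[OF \<epsilon>P] q' by (simp add: \<epsilon>_def)
  then obtain f f' where f: "f \<in> P" "f' \<in> P" "\<epsilon> = x \<otimes> f \<oplus> \<gamma> \<otimes> f'" by (rule linE)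
  have xP: "x \<in> P" using xA A_P by blast
  obtain v where v: "v \<in> P" "\<epsilon> [^] s = x \<otimes> v \<oplus> (\<gamma> \<otimes> f') [^] s"
    using power_add_mults[OF sP xP f(1), of "\<gamma> \<otimes> f'" s] f gP Pc(4) by auto
  define k where "k = f' [^] s"
  define G where "G = \<gamma> [^] s"
  have k: "k \<in> P" "G \<in> P" using f gP Pc(8) by (auto simp: k_def G_def)
  have C2: "v \<in> carrier R" "k \<in> carrier R" "G \<in> carrier R" "q'' \<in> carrier R" "f' \<in> carrier R"
    using v k q'' f Pc(1) by auto
  have "(\<gamma> \<otimes> f') [^] s = G \<otimes> k" using C2 by (simp add: G_def k_def nat_pow_distrib)
  then have E: "\<epsilon> [^] s = x \<otimes> v \<oplus> G \<otimes> k" using v by simp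
  have "(w \<otimes> q) \<otimes> q'' = w \<otimes> (q \<otimes> q'')" using q C C2 by (simp add: m_assoc)
  also have "\<dots> = w \<otimes> (\<one> \<ominus> (x \<otimes> v \<oplus> G \<otimes> k))" using q'' E by simp
  finally have 1: "(w \<otimes> q) \<otimes> q'' = w \<otimes> (\<one> \<ominus> (x \<otimes> v \<oplus> G \<otimes> k))" .
  have "w = w \<otimes> (\<one> \<ominus> (x \<otimes> v \<oplus> G \<otimes> k)) \<oplus> G \<otimes> (w \<otimes> k) \<oplus> x \<otimes> (w \<otimes> v)"
    using q(1) C2 elems(1) by algebra
  then have "w = (w \<otimes> q) \<otimes> q'' \<oplus> \<gamma> [^] s \<otimes> (w \<otimes> k) \<oplus> x \<otimes> (w \<otimes> v)" using 1 by (simp add: G_def)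
  moreover have "(w \<otimes> q) \<otimes> q'' \<in> P" using q q'' Pc(4) by simp
  moreover have "w \<otimes> k \<in> T" "w \<otimes> v \<in> T" using w k v P_T by (auto intro!: Tc(4))
  ultimately show ?thesis by blast
qed

lemma T_mod_pol:
  assumes w: "w \<in> T"
  shows "\<exists>\<mu>\<in>pol (s * d). \<exists>a\<in>T. \<exists>b\<in>T. w = \<mu> \<oplus> \<gamma> [^] s \<otimes> a \<oplus> x \<otimes> b"
proof -
  obtain p a b where pab: "p \<in> P" "a \<in> T" "b \<in> T" "w = p \<oplus> \<gamma> [^] s \<otimes> a \<oplus> x \<otimes> b"
    using T_mod_P[OF w] by blast
  obtain h where h: "h \<in> pol (s * d)" "\<gamma> [^] s = t [^] (s * d) \<oplus> h" using gamma_power_monic by blast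
  obtain l where l: "p \<in> pol l" using pab(1) by (rule PE)
  obtain q \<mu> where q: "q \<in> pol (l - s * d)" "\<mu> \<in> pol (s * d)" "p = q \<otimes> \<gamma> [^] s \<oplus> \<mu>"
    using monic_division[OF h(1) l] h(2) by auto
  have qT: "q \<in> T" using PI[OF q(1)] P_T by blast
  define G where "G = \<gamma> [^] s"
  have C: "q \<in> carrier R" "\<mu> \<in> carrier R" "a \<in> carrier R" "b \<in> carrier R" "G \<in> carrier R"
    using q pol_carrier pab Tc(1) by (auto simp: G_def)
  have "w = \<mu> \<oplus> G \<otimes> (a \<oplus> q) \<oplus> x \<otimes> b"
    unfolding pab(4) q(3) G_def[symmetric] using C elems(1) by algebra
  then show ?thesis using q(2) pab(2,3) qT Tc(5) unfolding G_def by blast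
qed

text \<open>
  For \<open>g1\<close> congruent to \<open>\<gamma>\<^sup>s\<close> times a unit modulo \<open>x\<close>, the powers of \<open>t\<close> below \<open>s d\<close> generate
  \<open>T/g1 T\<close> modulo \<open>x\<close>, hence modulo every power of \<open>x\<close>; the coefficients stay in \<open>A\<close> because \<open>x\<close>
  does.
\<close>
lemma T_mod_power:
  assumes g1: "g1 = \<gamma> [^] s \<otimes> e \<oplus> x \<otimes> u" "e \<in> T" "e \<notin> nonunits T" "u \<in> T" and w: "w \<in> T"
  shows "\<exists>\<mu>\<in>pol (s * d). \<exists>a\<in>T. \<exists>b\<in>T. w = \<mu> \<oplus> g1 \<otimes> a \<oplus> x [^] (j::nat) \<otimes> b"
  using w
proof (induction j arbitrary: w)
  case 0
  have "g1 \<in> carrier R" using g1 Tc(1) by simp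
  then have "w = \<zero> \<oplus> g1 \<otimes> \<zero> \<oplus> x [^] (0::nat) \<otimes> w" using 0 Tc(1) by simp
  then show ?case using pol_zero Tc(2) 0 by blast
next
  case (Suc j)
  have step: "\<exists>\<mu>\<in>pol (s * d). \<exists>a\<in>T. \<exists>b\<in>T. v = \<mu> \<oplus> g1 \<otimes> a \<oplus> x \<otimes> b" if v: "v \<in> T" for v
  proof -
    obtain \<mu> a b where *: "\<mu> \<in> pol (s * d)" "a \<in> T" "b \<in> T" "v = \<mu> \<oplus> \<gamma> [^] s \<otimes> a \<oplus> x \<otimes> b"
      using T_mod_pol[OF v] by blast
    obtain i where i: "i \<in> T" "e \<otimes> i = \<one>" using unit_in g1 by blast
    define G where "G = \<gamma> [^] s"
    have C: "\<mu> \<in> carrier R" "a \<in> carrier R" "b \<in> carrier R" "i \<in> carrier R" "e \<in> carrier R" "u \<in> carrier R" "G \<in> carrier R"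
      using * pol_carrier i g1 Tc(1) by (auto simp: G_def)
    have "\<mu> \<oplus> g1 \<otimes> (i \<otimes> a) \<oplus> x \<otimes> (b \<ominus> u \<otimes> i \<otimes> a) = \<mu> \<oplus> G \<otimes> (e \<otimes> i) \<otimes> a \<oplus> x \<otimes> b"
      unfolding g1(1) G_def[symmetric] using C elems(1) by algebra
    then have "v = \<mu> \<oplus> g1 \<otimes> (i \<otimes> a) \<oplus> x \<otimes> (b \<ominus> u \<otimes> i \<otimes> a)" using *(4) i C by (simp add: G_def)
    moreover have "i \<otimes> a \<in> T" "b \<ominus> u \<otimes> i \<otimes> a \<in> T" using * i g1 Tc(4,7) by auto
    ultimately show ?thesis using *(1) by blast
  qed
  obtain \<mu> a b where *: "\<mu> \<in> pol (s * d)" "a \<in> T" "b \<in> T" "w = \<mu> \<oplus> g1 \<otimes> a \<oplus> x [^] j \<otimes> b"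
    using Suc.IH[OF Suc.prems] by blast
  obtain \<mu>' a' b' where **: "\<mu>' \<in> pol (s * d)" "a' \<in> T" "b' \<in> T" "b = \<mu>' \<oplus> g1 \<otimes> a' \<oplus> x \<otimes> b'"
    using step[OF *(3)] by blast
  define Z where "Z = x [^] j"
  have Z: "Z \<in> A" using xA Ac(8) by (simp add: Z_def)
  have ZT: "Z \<in> T" using Z A_T by blast
  have C: "\<mu> \<in> carrier R" "\<mu>' \<in> carrier R" "a \<in> carrier R" "a' \<in> carrier R" "b' \<in> carrier R" "g1 \<in> carrier R" "Z \<in> carrier R"
    using * ** pol_carrier g1 Tc(1) ZT by auto
  have "w = (\<mu> \<oplus> Z \<otimes> \<mu>') \<oplus> g1 \<otimes> (a \<oplus> Z \<otimes> a') \<oplus> (Z \<otimes> x) \<otimes> b'"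
    unfolding *(4) **(4) Z_def[symmetric] using C elems(1) by algebra
  then have "w = (\<mu> \<oplus> Z \<otimes> \<mu>') \<oplus> g1 \<otimes> (a \<oplus> Z \<otimes> a') \<oplus> x [^] Suc j \<otimes> b'" by (simp add: Z_def)
  moreover have "\<mu> \<oplus> Z \<otimes> \<mu>' \<in> pol (s * d)" using * ** Z pol_add pol_smult by blast
  moreover have "a \<oplus> Z \<otimes> a' \<in> T" using * ** ZT Tc(4,5) by auto
  ultimately show ?case using **(3) by blast
qed

text \<open>
  Up to a unit and a term of high order in \<open>x\<close>, every element of \<open>T\<close> not divisible by \<open>x\<close> is a
  monic polynomial in \<open>t\<close> whose reduction modulo \<open>x\<close> is exactly a power of \<open>\<gamma>\<close>. To find it,
  express \<open>t\<^sup>s\<^sup>d\<close> through lower powers of \<open>t\<close> modulo \<open>(g1, x\<^sup>n\<^sup>+\<^sup>1)\<close>. The resulting monic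
  polynomial lies in \<open>(\<gamma>\<^sup>s, x)\<close> and has the degree of \<open>\<gamma>\<^sup>s\<close>, so modulo \<open>x\<close> it equals \<open>\<gamma>\<^sup>s\<close>;
  comparing both expressions shows that the cofactor \<open>a\<close> of \<open>g1\<close> is a unit.
\<close>
lemma weierstrass_polynomial:
  assumes g1: "g1 = \<gamma> [^] s \<otimes> e \<oplus> x \<otimes> u" "e \<in> T" "e \<notin> nonunits T" "u \<in> T"
  shows "\<exists>m\<in>pol (s * d). \<exists>a\<in>T - nonunits T. \<exists>b\<in>T. \<exists>r\<in>P.
    t [^] (s * d) \<oplus> m = g1 \<otimes> a \<oplus> x [^] Suc n \<otimes> b \<and> t [^] (s * d) \<oplus> m = \<gamma> [^] s \<oplus> x \<otimes> r"
proof -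
  define G where "G = \<gamma> [^] s"
  define u' where "u' = t [^] (s * d)"
  define Z where "Z = x [^] n"
  have u'T: "u' \<in> T" and GT: "G \<in> T" and ZT: "Z \<in> T"
    using t_P gP xA A_P P_T by (auto simp: u'_def G_def Z_def intro!: Tc(8))
  obtain h where h: "h \<in> pol (s * d)" "G = u' \<oplus> h"
    using gamma_power_monic by (auto simp: G_def u'_def)
  obtain \<mu> a b where *: "\<mu> \<in> pol (s * d)" "a \<in> T" "b \<in> T" "u' = \<mu> \<oplus> g1 \<otimes> a \<oplus> x [^] Suc n \<otimes> b"
    using T_mod_power[OF g1 u'T] by blast
  have C: "G \<in> carrier R" "u' \<in> carrier R" "h \<in> carrier R" "\<mu> \<in> carrier R" "a \<in> carrier R" "b \<in> carrier R"
    "e \<in> carrier R" "u \<in> carrier R" "Z \<in> carrier R" "g1 \<in> carrier R"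
    using GT u'T h * g1 ZT pol_carrier Tc(1) by auto
  have u'_eq: "u' = \<mu> \<oplus> g1 \<otimes> a \<oplus> (Z \<otimes> x) \<otimes> b" using * by (simp add: Z_def)
  have monic_eq: "u' \<oplus> \<ominus> \<mu> = g1 \<otimes> a \<oplus> (Z \<otimes> x) \<otimes> b"
  proof -
    have "(\<mu> \<oplus> g1 \<otimes> a \<oplus> (Z \<otimes> x) \<otimes> b) \<oplus> \<ominus> \<mu> = g1 \<otimes> a \<oplus> (Z \<otimes> x) \<otimes> b"
      using C elems(1) by algebra
    then show ?thesis using u'_eq by simp
  qed
  \<comment> \<open>The difference of the two monic polynomials has degree below \<open>s d\<close>; were it not divisible
    by \<open>x\<close>, its expansion would start with a lower power of \<open>\<gamma>\<close>.\<close>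
  define c where "c = \<ominus> \<mu> \<ominus> h"
  have c: "c \<in> pol (s * d)" using * h by (auto simp: c_def intro!: pol_diff pol_minus)
  have cC: "c \<in> carrier R" using pol_carrier[OF c] .
  have uc: "u' \<oplus> \<ominus> \<mu> = G \<oplus> c" unfolding h(2) c_def using C by algebra
  have c_eq: "c = G \<otimes> (e \<otimes> a \<ominus> \<one>) \<oplus> x \<otimes> (u \<otimes> a \<oplus> Z \<otimes> b)"
  proof -
    have "c = (G \<oplus> c) \<ominus> G" using C cC by algebra
    also have "\<dots> = (g1 \<otimes> a \<oplus> (Z \<otimes> x) \<otimes> b) \<ominus> G" using uc monic_eq by simp
    also have "\<dots> = G \<otimes> (e \<otimes> a \<ominus> \<one>) \<oplus> x \<otimes> (u \<otimes> a \<oplus> Z \<otimes> b)"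
      unfolding g1(1) G_def[symmetric] using C elems(1) r_one[OF C(1)] by algebra
    finally show ?thesis .
  qed
  have ea: "e \<otimes> a \<ominus> \<one> \<in> T" "u \<otimes> a \<oplus> Z \<otimes> b \<in> T" using g1 * ZT Tc by auto
  have "c \<in> mults P x"
  proof (rule ccontr)
    assume "c \<notin> mults P x"
    then obtain s' e' v where **: "e' \<in> P" "e' \<notin> nonunits B" "v \<in> P" "c = \<gamma> [^] s' \<otimes> e' \<oplus> x \<otimes> v" "s' * d < s * d"
      using pol_decomposition[OF c] by blast
    have "s' < s" using **(5) by simp
    define G' where "G' = \<gamma> [^] s'"
    define H where "H = \<gamma> [^] (s - s')"
    have GH: "G = G' \<otimes> H" using \<open>s' < s\<close> by (simp add: G_def G'_def H_def nat_pow_mult)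
    have HM: "H \<in> nonunits T" unfolding H_def using \<open>s' < s\<close> by (intro surface_nonunits_pow[OF surface_T gT]) simp
    have G'T: "G' \<in> T" using gP P_T by (auto simp: G'_def intro!: Tc(8))
    have e'T: "e' \<in> T" "v \<in> T" "e' \<notin> nonunits T" using ** P_T by (auto simp: T_nonunits)
    have C': "G' \<in> carrier R" "H \<in> carrier R" "e' \<in> carrier R" "v \<in> carrier R"
      using G'T HM e'T nonunits_in Tc(1) by blast+
    define f where "f = e' \<ominus> H \<otimes> (e \<otimes> a \<ominus> \<one>)"
    have "G' \<otimes> f = (G' \<otimes> e' \<oplus> x \<otimes> v) \<ominus> x \<otimes> v \<ominus> G \<otimes> (e \<otimes> a \<ominus> \<one>)"
      unfolding f_def GH using C C' elems(1) by algebra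
    also have "\<dots> = (G \<otimes> (e \<otimes> a \<ominus> \<one>) \<oplus> x \<otimes> (u \<otimes> a \<oplus> Z \<otimes> b)) \<ominus> x \<otimes> v \<ominus> G \<otimes> (e \<otimes> a \<ominus> \<one>)"
      using **(4) c_eq by (simp add: G'_def)
    also have "\<dots> = x \<otimes> ((u \<otimes> a \<oplus> Z \<otimes> b) \<ominus> v)" using C C' elems(1) by algebra
    finally have "G' \<otimes> f \<in> mults T x" using multsI ea(2) e'T(2) Tc(7) by metis
    moreover have "f \<notin> nonunits T"
      unfolding f_def minus_eq
      using unit_add_nonunit[OF surface_T e'T(1,3) MTc(5)[OF MTc(3)[OF HM ea(1)]]] by (simp add: minus_eq)
    moreover have "f \<in> T" using e'T HM ea nonunits_in Tc by (simp add: f_def)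
    ultimately show False using gamma_unit_not_in_xT by (simp add: G'_def)
  qed
  then obtain r where r: "r \<in> P" "c = x \<otimes> r" by (rule multsE)
  have "a \<notin> nonunits T"
  proof
    assume aM: "a \<in> nonunits T"
    have rT: "r \<in> T" using r P_T by blast
    have rC: "r \<in> carrier R" using rT Tc(1) by blast
    have "G \<otimes> (e \<otimes> a \<ominus> \<one>) = (G \<otimes> (e \<otimes> a \<ominus> \<one>) \<oplus> x \<otimes> (u \<otimes> a \<oplus> Z \<otimes> b)) \<ominus> x \<otimes> (u \<otimes> a \<oplus> Z \<otimes> b)"
      using C elems(1) by algebra
    also have "\<dots> = x \<otimes> r \<ominus> x \<otimes> (u \<otimes> a \<oplus> Z \<otimes> b)" using c_eq r by simp
    also have "\<dots> = x \<otimes> (r \<ominus> (u \<otimes> a \<oplus> Z \<otimes> b))" using C rC elems(1) by algebra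
    finally have "G \<otimes> (e \<otimes> a \<ominus> \<one>) \<in> mults T x" using multsI ea(2) rT Tc(7) by metis
    moreover have "e \<otimes> a \<ominus> \<one> \<notin> nonunits T"
    proof
      assume "e \<otimes> a \<ominus> \<one> \<in> nonunits T"
      then have "e \<otimes> a \<ominus> (e \<otimes> a \<ominus> \<one>) \<in> nonunits T" using MTc(4)[OF aM g1(2)] MTc(6) by blast
      moreover have "e \<otimes> a \<ominus> (e \<otimes> a \<ominus> \<one>) = \<one>" using C by algebra
      ultimately show False using one_not_nonunit[OF sT] by simp
    qed
    ultimately show False using gamma_unit_not_in_xT ea(1) by (simp add: G_def)
  qed
  moreover have "u' \<oplus> \<ominus> \<mu> = G \<oplus> x \<otimes> r" using uc r by simp
  moreover have "u' \<oplus> \<ominus> \<mu> = g1 \<otimes> a \<oplus> x [^] Suc n \<otimes> b" using monic_eq by (simp add: Z_def)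
  moreover have "\<ominus> \<mu> \<in> pol (s * d)" using * pol_minus by blast
  ultimately show ?thesis using *(2,3) r(1) unfolding G_def u'_def by blast
qed

end

section \<open>Descent along a quadratic transform\<close>

context blowup
begin

lemma homogenize_in_A:
  assumes "p \<in> pol k" shows "x [^] k \<otimes> p \<in> A"
proof (cases k)
  case 0
  then show ?thesis using assms Ac(2) by (simp add: pol_0)
next
  case (Suc l)
  obtain ms where ms: "p = form t \<one> ms" "length ms = k" "set ms \<subseteq> A"
    using assms by (auto simp: pol_def forms_def)
  have "set ms \<subseteq> carrier R" using ms elems(4) by blast
  then have "x \<otimes> form y x ms = x [^] k \<otimes> p"
    using form_scale[of x t \<one> ms] ms by (simp add: yt)
  moreover have "x \<otimes> form y x ms \<in> A"
    using form_in[OF sA yA xA ms(3)] xA Ac(4) by blast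
  ultimately show ?thesis by simp
qed

text \<open>
  In the chart of the blow-up where \<open>w = x/y\<close> is regular, a polynomial of degree less than \<open>k\<close>
  in \<open>t\<close>, homogenized to degree \<open>k\<close>, is \<open>y\<^sup>k\<close> times a multiple of \<open>w\<close>.
\<close>
lemma homogenize_other_chart:
  assumes p: "p \<in> pol k" and S: "subring S R" "A \<subseteq> S" and w: "w \<in> S" "x = y \<otimes> w"
  shows "\<exists>f\<in>S. x [^] k \<otimes> p = y [^] k \<otimes> (w \<otimes> f)"
proof -
  note Sc = subring_closed[OF S(1)]
  obtain ms where ms: "p = form t \<one> ms" "length ms = k" "set ms \<subseteq> A"
    using p by (auto simp: pol_def forms_def)
  have msC: "set ms \<subseteq> carrier R" using ms elems(4) by blast
  have wC: "w \<in> carrier R" using w Sc by blast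
  define f where "f = form \<one> w ms"
  define k' where "k' = y [^] k"
  have f: "f \<in> S" unfolding f_def using ms S(2) w Sc(3) by (intro form_in[OF S(1)]) auto
  have C: "f \<in> carrier R" "k' \<in> carrier R" using f Sc(1) by (auto simp: k'_def)
  have F: "form y x ms \<in> carrier R" using msC by simp
  have "y \<otimes> form (y \<otimes> \<one>) (y \<otimes> w) ms = y [^] length ms \<otimes> form \<one> w ms"
    using msC wC by (intro form_scale) auto
  then have yf: "y \<otimes> form y x ms = k' \<otimes> f" using ms w(2) by (simp add: f_def k'_def)
  have "x [^] k \<otimes> p = x \<otimes> form y x ms"
    using form_scale[of x t \<one> ms] ms msC by (simp add: yt)
  also have "\<dots> = (y \<otimes> w) \<otimes> form y x ms" using w(2) by simp
  also have "\<dots> = w \<otimes> (y \<otimes> form y x ms)" using F wC elems(2) by (simp add: m_ac)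
  also have "\<dots> = k' \<otimes> (w \<otimes> f)" using yf C wC by (simp add: m_lcomm)
  finally show ?thesis using f unfolding k'_def by blast
qed

end

context blowup_center
begin

text \<open>
  A surface with the same centre on the chart \<open>A[t]\<close> contains \<open>T\<close>: an element of \<open>A[t]\<close> that
  does not vanish at the centre is invertible modulo \<open>(x, \<gamma>)\<close>.
\<close>
lemma T_subset_if_center:
  assumes S: "surface S" "A \<subseteq> S" "t \<in> S" and g: "\<gamma> \<in> nonunits S"
  shows "T \<subseteq> S"
proof (rule T_subset)
  show sS: "subring S R" using S by (auto intro: surface_subring)
  show PS: "P \<subseteq> S" by (rule P_subset[OF sS S(2,3)])
  note MS = surface_nonunits[OF S(1)]
  have xS: "x \<in> nonunits S" using surface_dominates[OF A S(1,2)] xM by blast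
  fix q assume q: "q \<in> P" "q \<notin> nonunits B"
  obtain q' where q': "q' \<in> P" "\<one> \<ominus> q \<otimes> q' \<in> nonunits B" using P_inverse[OF q] by blast
  have C: "q \<in> carrier R" "q' \<in> carrier R" using q q' Pc(1) by auto
  have "\<one> \<ominus> q \<otimes> q' \<in> P" using q q' by (intro Pc)
  then have "\<one> \<ominus> q \<otimes> q' \<in> lin P x \<gamma>" using P_nonunits q' by blast
  then obtain f f' where f: "f \<in> P" "f' \<in> P" "\<one> \<ominus> q \<otimes> q' = x \<otimes> f \<oplus> \<gamma> \<otimes> f'" by (rule linE)
  have nu: "\<one> \<ominus> q \<otimes> q' \<in> nonunits S" unfolding f(3) using f PS xS g by (intro MS(2,3)) auto
  show "q \<notin> nonunits S"
  proof
    assume "q \<in> nonunits S"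
    then have "q \<otimes> q' \<in> nonunits S" using MS(3) q' PS by blast
    then have "(\<one> \<ominus> q \<otimes> q') \<oplus> q \<otimes> q' \<in> nonunits S" using MS(2) nu by blast
    moreover have "(\<one> \<ominus> q \<otimes> q') \<oplus> q \<otimes> q' = \<one>" using C by algebra
    ultimately show False using one_not_nonunit[OF sS] by simp
  qed
qed

text \<open>
  After a perturbation the denominator on \<open>T\<close> is a polynomial \<open>p\<close> that is monic of degree
  \<open>K = s d\<close> and congruent to \<open>\<gamma>\<^sup>s\<close> modulo \<open>x\<close>, and the numerator \<open>h3\<close> is a polynomial of lower
  degree or a power of \<open>x\<close>. The new denominator is \<open>G = x\<^sup>K p\<close>, a form of degree \<open>K\<close> in \<open>y\<close> and
  \<open>x\<close>, and the new numerator is \<open>x\<^sup>K h3\<close>. For a surface above \<open>T\<close> nothing has changed. The other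
  surfaces above \<open>A\<close> have a different centre on the blow-up. The curve \<open>p = 0\<close> meets the
  exceptional curve only at the centre of \<open>B\<close>; so there \<open>G\<close> is a unit times \<open>x\<^sup>K\<close> or \<open>y\<^sup>K\<close>,
  according to the chart, and divides every form of degree \<open>K\<close>.
\<close>
theorem separator_descend:
  assumes "separator T B g0 h0 n"
  shows "\<exists>g h k. separator A B g h k"
proof -
  have perturb: "\<exists>h'. separator T B (g \<otimes> e \<oplus> c [^] Suc n \<otimes> b) h' n"
    if "separator T B g h n" "e \<in> T" "e \<notin> nonunits T" "c \<in> nonunits T" "b \<in> T" for g h e c b
    by (rule separator_perturb[OF surface_T B T_B that])
  \<comment> \<open>The denominator must not contain the exceptional curve; adding a power of \<open>\<gamma>\<close> achieves this.\<close>
  have "\<exists>g1 h1. separator T B g1 h1 n \<and> g1 \<notin> mults T x"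
  proof (cases "g0 \<in> mults T x")
    case True
    then obtain v where v: "v \<in> T" "g0 = x \<otimes> v" by (rule multsE)
    have vC: "v \<in> carrier R" using v Tc(1) by blast
    obtain h1 where h1: "separator T B (g0 \<otimes> \<one> \<oplus> \<gamma> [^] Suc n \<otimes> \<one>) h1 n"
      using perturb[OF assms Tc(3) one_not_nonunit[OF sT] gT Tc(3)] by blast
    have eq: "g0 \<otimes> \<one> \<oplus> \<gamma> [^] Suc n \<otimes> \<one> = \<gamma> [^] Suc n \<oplus> x \<otimes> v"
      using v(2) vC by (simp add: a_comm)
    have "\<gamma> [^] Suc n \<in> T" using nonunits_in[OF gT] by (rule Tc(8))
    then have "\<gamma> [^] Suc n \<oplus> x \<otimes> v \<notin> mults T x"
      using mults_diff v(1) gamma_power_not_in_xT by blast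
    then show ?thesis using h1 unfolding eq by blast
  qed (use assms in blast)
  then obtain g1 h1 where g1: "separator T B g1 h1 n" "g1 \<notin> mults T x" by blast
  have "g1 \<in> T" using g1 by (simp add: separator_def)
  then obtain s :: nat and e u where seu: "g1 = \<gamma> [^] s \<otimes> e \<oplus> x \<otimes> u" "e \<in> T" "e \<notin> nonunits T" "u \<in> T"
    using T_decomposition g1(2) by blast
  define K where "K = s * d"
  obtain m a b r where m: "m \<in> pol K" "a \<in> T" "a \<notin> nonunits T" "b \<in> T" "r \<in> P"
    "t [^] K \<oplus> m = g1 \<otimes> a \<oplus> x [^] Suc n \<otimes> b" "t [^] K \<oplus> m = \<gamma> [^] s \<oplus> x \<otimes> r"
    using weierstrass_polynomial[OF seu] unfolding K_def by blast
  define p where "p = t [^] K \<oplus> m"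
  obtain h2 where "separator T B p h2 n"
    using perturb[OF g1(1) m(2,3) xT m(4)] m(6) by (auto simp: p_def)
  then have p: "p \<in> T" "h2 \<in> T" "h2 \<notin> mults B p"
    and p_sep: "\<And>S. \<lbrakk>surface S; T \<subseteq> S; \<not> B \<subseteq> S; \<not> S \<subseteq> B\<rbrakk> \<Longrightarrow> h2 \<in> mults S p \<and> (\<forall>c\<in>nonunits T. c [^] n \<in> mults S p)"
    unfolding separator_def by blast+
  have rT: "r \<in> T" "r \<in> carrier R" using m P_T Pc(1) by auto
  have p_eq: "p = \<gamma> [^] s \<otimes> \<one> \<oplus> x \<otimes> r" using m(7) by (simp add: p_def)
  obtain \<mu> a2 b2 where \<mu>: "\<mu> \<in> pol K" "a2 \<in> T" "b2 \<in> T" "h2 = \<mu> \<oplus> p \<otimes> a2 \<oplus> x [^] n \<otimes> b2"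
    using T_mod_power[OF p_eq Tc(3) one_not_nonunit[OF sT] rT(1) p(2), of n] unfolding K_def by blast
  have C: "p \<in> carrier R" "a2 \<in> carrier R" "b2 \<in> carrier R" "\<mu> \<in> carrier R" "x [^] n \<in> carrier R" "m \<in> carrier R"
    using p \<mu> m pol_carrier Tc(1) by auto
  have \<mu>_eq: "\<mu> = h2 \<oplus> p \<otimes> \<ominus> a2 \<oplus> x [^] n \<otimes> \<ominus> b2"
  proof -
    define Z where "Z = x [^] n"
    have "Z \<in> carrier R" by (simp add: Z_def)
    then have "\<mu> = (\<mu> \<oplus> p \<otimes> a2 \<oplus> Z \<otimes> b2) \<oplus> p \<otimes> \<ominus> a2 \<oplus> Z \<otimes> \<ominus> b2" using C by algebra
    then show ?thesis using \<mu>(4) by (simp add: Z_def)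
  qed
  have \<mu>_in: "\<mu> \<in> mults S p" if S: "subring S R" "T \<subseteq> S" "h2 \<in> mults S p" "x [^] n \<in> mults S p" for S
    unfolding \<mu>_eq using S \<mu>(2,3) subring_closed(6)[OF S(1)]
    by (intro mults_add[OF S(1) C(1)] mults_times[OF S(1) C(1)] multsI) auto
  \<comment> \<open>Not both of these lie in \<open>pB\<close>, since together with \<open>p\<close> they generate the old numerator.\<close>
  obtain h3 where h3: "h3 = \<mu> \<or> h3 = x [^] n" "h3 \<notin> mults B p"
  proof -
    have "\<mu> \<notin> mults B p \<or> x [^] n \<notin> mults B p"
    proof (rule ccontr)
      assume "\<not> ?thesis"
      then have "h2 \<in> mults B p"
        unfolding \<mu>(4) using \<mu>(2,3) T_B by (intro mults_add[OF sB C(1)] mults_times[OF sB C(1)] multsI) auto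
      then show False using p by simp
    qed
    then show ?thesis using that by blast
  qed
  have h3P: "h3 \<in> P" using h3(1) PI[OF \<mu>(1)] xA A_P Pc(8) by auto
  have h3C: "h3 \<in> carrier R" using h3P Pc(1) by blast
  have h3_sep: "h3 \<in> mults S p" if S: "surface S" "T \<subseteq> S" "\<not> B \<subseteq> S" "\<not> S \<subseteq> B" for S
    using p_sep[OF S] \<mu>_in[OF surface_subring[OF S(1)] S(2)] xT h3(1) by blast
  define Z where "Z = x [^] K"
  have Z: "Z \<in> carrier R" "Z \<noteq> \<zero>" "Z \<in> A" using pow_nonzero[OF _ x0] xA Ac(8) by (auto simp: Z_def)
  define G where "G = Z \<otimes> p"
  define h where "h = Z \<otimes> h3"
  have GC: "G \<in> carrier R" "h \<in> carrier R" using Z C h3C by (auto simp: G_def h_def)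
  have G_eq: "G = y [^] K \<oplus> Z \<otimes> m"
    using C by (simp add: G_def p_def Z_def r_distr yt nat_pow_distrib)
  have GA: "G \<in> A" unfolding G_eq Z_def using homogenize_in_A[OF m(1)] Ac(5,8) yA by simp
  have hA: "h \<in> A"
    using h3(1) homogenize_in_A[OF \<mu>(1)] Z(3) Ac(4,8) xA by (auto simp: h_def Z_def)
  have hG: "h \<notin> mults B G"
  proof
    assume "h \<in> mults B G"
    then obtain v where v: "v \<in> B" "Z \<otimes> h3 = Z \<otimes> p \<otimes> v" unfolding G_def h_def by (rule multsE)
    have vC: "v \<in> carrier R" using v Bc(1) by blast
    have "Z \<otimes> h3 = Z \<otimes> (p \<otimes> v)" using v(2) Z C vC by (simp add: m_assoc)
    then have "h3 = p \<otimes> v" using Z h3C C vC by (simp add: m_lcancel)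
    then show False using h3(2) multsI[OF v(1)] by simp
  qed
  have "separator A B G h (K + n)"
    unfolding separator_def
  proof (intro conjI allI impI GA hA hG)
    fix S assume "surface S \<and> A \<subseteq> S \<and> \<not> B \<subseteq> S \<and> \<not> S \<subseteq> B"
    then have S: "surface S" "A \<subseteq> S" "\<not> B \<subseteq> S" "\<not> S \<subseteq> B" by auto
    have sS: "subring S R" using S by (auto intro: surface_subring)
    note Sc = subring_closed[OF sS]
    have xS: "x \<in> nonunits S" using surface_dominates[OF A S(1,2)] xM by blast
    have xyS: "x \<in> S" "y \<in> S" using xA yA S by auto
    have "h \<in> mults S G \<and> (\<forall>r\<in>S. \<forall>s\<in>S. (x \<otimes> r \<oplus> y \<otimes> s) [^] (K + n) \<in> mults S G)"
    proof (cases "t \<in> S")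
      case tS: True
      have PS: "P \<subseteq> S" by (rule P_subset[OF sS S(2) tS])
      have core: "h3 \<in> mults S p \<and> x [^] n \<in> mults S p"
      proof (cases "T \<subseteq> S")
        case True
        then show ?thesis using h3_sep[OF S(1) True S(3,4)] p_sep[OF S(1) True S(3,4)] xT by blast
      next
        case False
        have pP: "p \<in> P" using m(7,5) gP xA A_P by (auto simp: p_def intro!: Pc)
        have "p \<notin> nonunits S"
        proof
          assume pS: "p \<in> nonunits S"
          define E where "E = \<gamma> [^] s"
          have E: "E \<in> carrier R" by (simp add: E_def)
          have "x \<otimes> r \<in> nonunits S" using xS m(5) PS surface_nonunits(3)[OF S(1)] by blast
          then have "p \<ominus> x \<otimes> r \<in> nonunits S" using surface_nonunits(6)[OF S(1) pS] by blast
          moreover have "(E \<oplus> x \<otimes> r) \<ominus> x \<otimes> r = E" using E rT elems(1) by algebra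
          ultimately have "E \<in> nonunits S" using m(7) by (simp add: p_def E_def)
          then have "\<gamma> \<in> nonunits S" using surface_units_pow[OF sS] gP PS unfolding E_def by blast
          then show False using T_subset_if_center[OF S(1,2) tS] False by blast
        qed
        then obtain i where i: "i \<in> S" "p \<otimes> i = \<one>" using unit_in pP PS by blast
        have iC: "i \<in> carrier R" using i Sc(1) by blast
        have all: "z \<in> mults S p" if z: "z \<in> S" for z
        proof -
          have zC: "z \<in> carrier R" using z Sc(1) by blast
          have "z = p \<otimes> (i \<otimes> z)" using i iC zC C(1) by (simp add: m_assoc[symmetric])
          then show ?thesis using multsI[OF Sc(4)[OF i(1) z], of p] by simp
        qed
        show ?thesis using all h3P PS xyS Sc(8) by blast
      qed
      have lift: "Z \<otimes> z \<in> mults S G" if z: "z \<in> mults S p" for z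
      proof -
        obtain v where v: "v \<in> S" "z = p \<otimes> v" using z by (rule multsE)
        have "Z \<otimes> z = G \<otimes> v" using v Z C Sc(1) by (simp add: G_def m_assoc)
        then show ?thesis using multsI[OF v(1)] by simp
      qed
      show ?thesis
      proof (intro conjI ballI)
        show "h \<in> mults S G" unfolding h_def using lift core by blast
        fix r' s' assume rs: "r' \<in> S" "s' \<in> S"
        have rsC: "r' \<in> carrier R" "s' \<in> carrier R" using rs Sc(1) by auto
        define c where "c = r' \<oplus> t \<otimes> s'"
        have c: "c \<in> S" using rs tS by (auto simp: c_def intro!: Sc)
        have cC: "c \<in> carrier R" using c Sc(1) by blast
        have "x \<otimes> r' \<oplus> y \<otimes> s' = x \<otimes> c" unfolding c_def yt using rsC elems(1,3) by algebra
        then have "(x \<otimes> r' \<oplus> y \<otimes> s') [^] (K + n) = Z \<otimes> x [^] n \<otimes> c [^] (K + n)"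
          using cC by (simp add: nat_pow_distrib Z_def nat_pow_mult)
        also have "\<dots> \<in> mults S G" 
          using core lift mults_times[OF sS GC(1) _ Sc(8)[OF c]] by blast
        finally show "(x \<otimes> r' \<oplus> y \<otimes> s') [^] (K + n) \<in> mults S G" .
      qed
    next
      case tS: False
      have "A \<noteq> S" using AB S by blast
      have "y \<notin> mults S x"
      proof
        assume "y \<in> mults S x"
        then obtain v where v: "v \<in> S" "y = x \<otimes> v" by (rule multsE)
        then have "t = v" using x0 Sc(1) by (simp add: yt m_lcancel)
        then show False using tS v by simp
      qed
      then have "x \<in> mults S y"
        using surface_overring_comparable[OF A S(1,2) \<open>A \<noteq> S\<close> MA xA yA] by blast
      then obtain w where w: "w \<in> S" "x = y \<otimes> w" by (rule multsE)
      have wC: "w \<in> carrier R" using w Sc(1) by blast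
      have wM: "w \<in> nonunits S"
      proof (rule ccontr)
        assume "w \<notin> nonunits S"
        then obtain i where i: "i \<in> S" "w \<otimes> i = \<one>" using unit_in w by blast
        have iC: "i \<in> carrier R" using i Sc(1) by blast
        have "y = (y \<otimes> w) \<otimes> i" using i iC wC by (simp add: m_assoc)
        then have "y = x \<otimes> i" using w by simp
        then show False using \<open>y \<notin> mults S x\<close> multsI[OF i(1)] by simp
      qed
      define V where "V = y [^] K"
      have VC: "V \<in> carrier R" by (simp add: V_def)
      obtain f where f: "f \<in> S" "Z \<otimes> m = V \<otimes> (w \<otimes> f)"
        using homogenize_other_chart[OF m(1) sS S(2) w] unfolding Z_def V_def by blast
      have fC: "f \<in> carrier R" using f Sc(1) by blast
      have G_V: "G = V \<otimes> (\<one> \<oplus> w \<otimes> f)"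
        unfolding G_eq V_def[symmetric] f(2) using VC wC fC by (simp add: r_distr)
      have "\<one> \<oplus> w \<otimes> f \<notin> nonunits S"
        using unit_add_nonunit[OF S(1) Sc(3) one_not_nonunit[OF sS] surface_nonunits(3)[OF S(1) wM f(1)]] .
      then have GV: "mults S G = mults S V"
        unfolding G_V using w f Sc by (intro mults_unit_cancel[OF sS VC]) auto
      have "h \<in> mults S V"
        using h3(1)
      proof
        assume "h3 = \<mu>"
        then obtain f' where "f' \<in> S" "h = V \<otimes> (w \<otimes> f')"
          using homogenize_other_chart[OF \<mu>(1) sS S(2) w] unfolding Z_def V_def h_def by blast
        then show ?thesis using multsI[of "w \<otimes> f'" S V] w Sc(4) by simp
      next
        assume "h3 = x [^] n"
        then have "h = V \<otimes> (w [^] K \<otimes> x [^] n)"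
          unfolding h_def Z_def V_def using w wC nat_pow_distrib[of y w K] by (simp add: m_assoc)
        moreover have "w [^] K \<otimes> x [^] n \<in> S" using w xyS Sc by simp
        ultimately show ?thesis using multsI by metis
      qed
      moreover have "(x \<otimes> r' \<oplus> y \<otimes> s') [^] (K + n) \<in> mults S V" if rs: "r' \<in> S" "s' \<in> S" for r' s'
      proof -
        have rsC: "r' \<in> carrier R" "s' \<in> carrier R" using rs Sc(1) by auto
        define c where "c = w \<otimes> r' \<oplus> s'"
        have c: "c \<in> S" using rs w by (auto simp: c_def intro!: Sc)
        have cC: "c \<in> carrier R" using c Sc(1) by blast
        have "(y \<otimes> w) \<otimes> r' \<oplus> y \<otimes> s' = y \<otimes> c" unfolding c_def using rsC wC elems(2) by algebra
        then have "x \<otimes> r' \<oplus> y \<otimes> s' = y \<otimes> c" using w(2) by simp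
        then have "(x \<otimes> r' \<oplus> y \<otimes> s') [^] (K + n) = V \<otimes> (y [^] n \<otimes> c [^] (K + n))"
          using cC by (simp add: nat_pow_distrib V_def nat_pow_mult[symmetric] m_ac)
        moreover have "y [^] n \<otimes> c [^] (K + n) \<in> S" using xyS c Sc by simp
        ultimately show ?thesis using multsI by metis
      qed
      ultimately show ?thesis unfolding GV by blast
    qed
    then show "h \<in> mults S G" "\<forall>c\<in>nonunits A. c [^] (K + n) \<in> mults S G"
      using S(2) unfolding MA by (auto elim!: linE)
  qed
  then show ?thesis by blast
qed

end

context field
begin

text \<open>
  Induction along the chain of quadratic transforms from \<open>A\<close> towards \<open>B\<close>. It reaches \<open>B\<close>: write
  the generators \<open>u, v\<close> of the maximal ideal of \<open>B\<close> as fractions \<open>a/b\<close> and \<open>c/b\<close> over \<open>A\<close>. If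
  \<open>b\<close> is a unit of \<open>A\<close>, then \<open>u\<close> and \<open>v\<close> lie in the maximal ideal of \<open>A\<close>, which generates a
  principal ideal of \<open>B\<close> if \<open>A\<close> is different from \<open>B\<close>; this is absurd. If \<open>b\<close> is a nonunit, all
  three are divisible by \<open>x\<close> in \<open>T\<close>, and the order of \<open>b\<close> in \<open>B\<close>, bounded by \<open>n\<close>, drops.
\<close>
lemma separator_exists_bounded:
  assumes B: "surface B" and uv: "u \<in> B" "v \<in> B" "nonunits B = lin B u v"
    and "surface A" "A \<subseteq> B" "a \<in> A" "b \<in> A" "c \<in> A" "u \<otimes> b = a" "v \<otimes> b = c" "b \<noteq> \<zero>"
    and "b \<notin> forms B u v (Suc n)"
  shows "\<exists>g h k. separator A B g h k"
  using assms(5-)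
proof (induction n arbitrary: A a b c)
  have sB: "subring B R" using B by (rule surface_subring)
  note Bc = subring_closed[OF sB]
  {
    case 0
    have "b \<in> B" "b \<in> carrier R" using 0 Bc(1) by auto
    then have "b = form u v [b]" using uv Bc(1) by simp
    then show ?case using 0 formsI[of "[b]" B u v] \<open>b \<in> B\<close> by simp
  }
  case (Suc n)
  have A: "surface A" and AB: "A \<subseteq> B" by fact+
  have sA: "subring A R" using A by (rule surface_subring)
  note Ac = subring_closed[OF sA]
  have dom: "nonunits A \<subseteq> nonunits B" by (rule surface_dominates[OF A B AB])
  have uvC: "u \<in> carrier R" "v \<in> carrier R" using uv Bc(1) by auto
  have uvM: "u \<in> nonunits B" "v \<in> nonunits B"
    using lin_generators[OF sB uv(1,2)] by (simp_all add: uv(3))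
  have abcC: "a \<in> carrier R" "b \<in> carrier R" "c \<in> carrier R" using Suc.prems Ac(1) by auto
  have A_nonunit: "z \<in> nonunits A" if "z \<in> A" "z \<in> nonunits B" for z
    using that AB by (auto simp: nonunits_def)
  show ?case
  proof (cases "A = B")
    case True
    \<comment> \<open>Every surface above \<open>A\<close> is comparable with \<open>B = A\<close>.\<close>
    have "separator A B \<zero> \<one> 0"
      unfolding separator_def using Ac True by (auto elim!: multsE)
    then show ?thesis by blast
  next
    case False
    obtain x0 y0 where xy0: "x0 \<in> A" "y0 \<in> A" "nonunits A = lin A x0 y0" using A by (rule surfaceE)
    have "\<exists>x\<in>A. \<exists>y\<in>A. nonunits A = lin A x y \<and> y \<in> mults B x"
      using surface_overring_comparable[OF A B AB False xy0(3,1,2)] xy0 lin_commute[OF sA, of x0 y0] Ac(1) by blast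
    then obtain x y where xy: "x \<in> A" "y \<in> A" "nonunits A = lin A x y" "y \<in> mults B x" by blast
    obtain t where t: "t \<in> B" "y = x \<otimes> t" using xy(4) by (rule multsE)
    have tC: "t \<in> carrier R" "x \<in> carrier R" using t xy Bc Ac by auto
    have xM: "x \<in> nonunits A"
      using lin_generators[OF sA xy(1,2)] by (simp add: xy(3))
    have MA_x: "nonunits A \<subseteq> mults B x"
    proof
      fix z assume "z \<in> nonunits A"
      then obtain r s where rs: "r \<in> A" "s \<in> A" "z = x \<otimes> r \<oplus> y \<otimes> s" unfolding xy(3) by (rule linE)
      then show "z \<in> mults B x"
        using AB xy(4) by (auto intro!: mults_add[OF sB] mults_times[OF sB] multsI tC)
    qed
    have notall: "\<not> nonunits B \<subseteq> mults B x"
      using maximal_ideal_not_principal[OF B] xM dom by blast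
    have x_nz: "x \<noteq> \<zero>"
    proof
      assume "x = \<zero>"
      then have "nonunits A \<subseteq> {\<zero>}" unfolding xy(3) t(2) using tC Ac(1) by (auto elim!: linE)
      then have "nonunits A \<subseteq> mults A x"
        using multsI[OF Ac(2), of x] tC by auto
      then show False using maximal_ideal_not_principal[OF A xM] by simp
    qed
    have bM: "b \<in> nonunits A"
    proof (rule ccontr)
      assume "b \<notin> nonunits A"
      then obtain i where i: "i \<in> A" "b \<otimes> i = \<one>" using unit_in Suc.prems by blast
      have iC: "i \<in> carrier R" using i Ac(1) by blast
      have "u = a \<otimes> i" "v = c \<otimes> i"
        using Suc.prems(6,7)[symmetric] i abcC iC uvC by (simp_all add: m_assoc)
      then have "u \<in> nonunits A" "v \<in> nonunits A"
        using A_nonunit uvM Suc.prems i Ac(4) by auto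
      then have "u \<in> mults B x" "v \<in> mults B x" using MA_x by auto
      then have "nonunits B \<subseteq> mults B x"
        unfolding uv(3) by (auto elim!: linE intro!: mults_add[OF sB] mults_times[OF sB] tC)
      then show False using notall by simp
    qed
    have bB: "b \<in> B" using Suc.prems AB by blast
    have aM: "a \<in> nonunits A" and cM: "c \<in> nonunits A"
      using A_nonunit[of a] A_nonunit[of c] Suc.prems surface_nonunits(3)[OF B uvM(1) bB]
        surface_nonunits(3)[OF B uvM(2) bB] by auto
    interpret bl: blowup R A B x y t
      by unfold_locales (use A B AB xy t x_nz in auto)
    define d where "d = (LEAST e. \<exists>r\<in>bl.pol e. t [^] e \<oplus> r \<in> nonunits B)"
    have "\<exists>r\<in>bl.pol d. t [^] d \<oplus> r \<in> nonunits B"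
      unfolding d_def by (rule LeastI_ex[OF bl.monic_nonunit_exists])
    then obtain g where g: "g \<in> bl.pol d" "t [^] d \<oplus> g \<in> nonunits B" by blast
    interpret bc: blowup_center R A B x y t d g
    proof
      show "t [^] e \<oplus> r \<notin> nonunits B" if "e < d" "r \<in> bl.pol e" for e r
        using that not_less_Least[of e "\<lambda>e. \<exists>r\<in>bl.pol e. t [^] e \<oplus> r \<in> nonunits B"] unfolding d_def by blast
    qed (use g in auto)
    have divide: "\<exists>z'\<in>bc.T. z = x \<otimes> z'" if "z \<in> nonunits A" for z
      using bl.nonunit_in_xP[OF that] bc.P_T by blast
    obtain a' b' c' where abc': "a' \<in> bc.T" "a = x \<otimes> a'" "b' \<in> bc.T" "b = x \<otimes> b'" "c' \<in> bc.T" "c = x \<otimes> c'"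
      using divide[OF aM] divide[OF bM] divide[OF cM] by blast
    have C': "a' \<in> carrier R" "b' \<in> carrier R" "c' \<in> carrier R" using abc' bc.Tc(1) by auto
    have "x \<otimes> (u \<otimes> b') = x \<otimes> a'" "x \<otimes> (v \<otimes> b') = x \<otimes> c'"
      using Suc.prems(6,7) abc' C' uvC tC by (simp_all add: m_lcomm)
    then have ub: "u \<otimes> b' = a'" "v \<otimes> b' = c'"
      using x_nz C' uvC tC by (simp_all add: m_lcancel)
    have b'0: "b' \<noteq> \<zero>" using abc'(4) Suc.prems tC by auto
    have b'forms: "b' \<notin> forms B u v (Suc n)"
    proof
      assume b': "b' \<in> forms B u v (Suc n)"
      have "x \<in> lin B u v" using xM dom uv(3) by blast
      then obtain r s where rs: "r \<in> B" "s \<in> B" "x = u \<otimes> r \<oplus> v \<otimes> s" by (rule linE)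
      have rsC: "r \<in> carrier R" "s \<in> carrier R" using rs Bc(1) by auto
      have BC: "B \<subseteq> carrier R" using Bc(1) by blast
      have "b = u \<otimes> (r \<otimes> b') \<oplus> v \<otimes> (s \<otimes> b')"
        unfolding abc'(4) rs(3) using rsC uvC C'(2) by algebra
      moreover have "r \<otimes> b' \<in> forms B u v (Suc n)" "s \<otimes> b' \<in> forms B u v (Suc n)"
        using b' rs Bc(4) by (auto intro!: forms_smult[OF BC uvC _ _ b'] rsC)
      ultimately have "b \<in> forms B u v (Suc (Suc n))"
        using forms_add[OF BC uvC Bc(5)] forms_times_left[OF BC Bc(2) uvC] forms_times_right[OF BC Bc(2) uvC] by simp
      then show False using Suc.prems by simp
    qed
    obtain g' h' k' where "separator bc.T B g' h' k'"
      using Suc.IH[OF bc.surface_T bc.T_B abc'(1,3,5) ub b'0 b'forms] by blast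
    then show ?thesis by (rule bc.separator_descend)
  qed
qed

theorem separator_exists:
  assumes A: "surface A" and B: "surface B" and AB: "A \<subseteq> B"
  shows "\<exists>g h k. separator A B g h k"
proof -
  have sB: "subring B R" using B by (rule surface_subring)
  note Bc = subring_closed[OF sB]
  have sA: "subring A R" using A by (rule surface_subring)
  note Ac = subring_closed[OF sA]
  obtain u v where uv: "u \<in> B" "v \<in> B" "nonunits B = lin B u v" using B by (rule surfaceE)
  have uvC: "u \<in> carrier R" "v \<in> carrier R" using uv Bc(1) by auto
  have uvM: "u \<in> nonunits B" "v \<in> nonunits B"
    using lin_generators[OF sB uv(1,2)] by (simp_all add: uv(3))
  obtain a b where ab: "a \<in> A" "b \<in> A" "b \<noteq> \<zero>" "u \<otimes> b = a" using surface_fraction[OF A uvC(1)] by blast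
  obtain c e where ce: "c \<in> A" "e \<in> A" "e \<noteq> \<zero>" "v \<otimes> e = c" using surface_fraction[OF A uvC(2)] by blast
  have C: "a \<in> carrier R" "b \<in> carrier R" "c \<in> carrier R" "e \<in> carrier R" using ab ce Ac(1) by auto
  have be: "b \<otimes> e \<in> A" "b \<otimes> e \<noteq> \<zero>" using ab ce C Ac(4) by (auto simp: integral_iff)
  have eqs: "u \<otimes> (b \<otimes> e) = a \<otimes> e" "v \<otimes> (b \<otimes> e) = c \<otimes> b"
    unfolding ab(4)[symmetric] ce(4)[symmetric] using uvC C by (simp_all add: m_ac)
  have "b \<otimes> e \<in> B" using be AB by blast
  then obtain n where "b \<otimes> e \<notin> forms B u v (Suc n)"
    using B be uvM unfolding surface_def adically_separated_def by blast
  then show ?thesis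
    using separator_exists_bounded[OF B uv A AB _ be(1) _ eqs be(2)] ab ce Ac(4) by blast
qed

text \<open>
  The fraction \<open>h/g\<close> of a separator; if \<open>g = 0\<close>, the family is empty and any element outside \<open>B\<close>
  will do.
\<close>
theorem element_separating_incomparable_overrings:
  assumes A: "surface A" and B: "surface B" and AB: "A \<subseteq> B"
    and Fam: "\<And>S. S \<in> Fam \<Longrightarrow> surface S \<and> A \<subseteq> S \<and> \<not> B \<subseteq> S \<and> \<not> S \<subseteq> B"
  shows "\<exists>f\<in>carrier R. f \<notin> B \<and> (\<forall>S\<in>Fam. f \<in> S)"
proof -
  have sB: "subring B R" using B by (rule surface_subring)
  note Bc = subring_closed[OF sB]
  obtain g h k where *: "separator A B g h k" using separator_exists[OF A B AB] by blast
  then have gh: "g \<in> A" "h \<in> A" "h \<notin> mults B g" by (auto simp: separator_def)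
  have C: "g \<in> carrier R" "h \<in> carrier R" using gh subring_closed(1)[OF surface_subring[OF A]] by auto
  have hS: "h \<in> mults S g" if "S \<in> Fam" for S using * Fam[OF that] unfolding separator_def by blast
  show ?thesis
  proof (cases "g = \<zero>")
    case True
    have "h \<noteq> \<zero>" using gh(3) multsI[OF Bc(2), of g] C by auto
    then have "S \<notin> Fam" for S
      using hS[of S] True Fam[of S] subring_closed(1)[OF surface_subring] by (auto elim!: multsE)
    then show ?thesis using surface_not_valuation[OF B] by metis
  next
    case False
    obtain f where f: "f \<in> carrier R" "h = g \<otimes> f" using divide_ex C False by blast
    have "f \<notin> B" using gh(3) multsI[of f B g] f by auto
    moreover have "f \<in> S" if S: "S \<in> Fam" for S
    proof -
      obtain s where s: "s \<in> S" "h = g \<otimes> s" using hS[OF S] by (rule multsE)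
      have "s \<in> carrier R" using s Fam[OF S] subring_closed(1)[OF surface_subring] by blast
      then have "f = s" using s(2) f False C by (simp add: m_lcancel)
      then show ?thesis using s by simp
    qed
    ultimately show ?thesis using f by blast
  qed
qed

end

section \<open>Irredundance\<close>

theorem corollary3p7:
  fixes F :: "('a, 'b) ring_scheme" and D :: "'a set" and \<R> :: "'a set set"
  assumes "quotient_field_of F D"
    and "two_dim_regular_local_subring D F"
    and "\<And>R. R \<in> \<R> \<Longrightarrow> overring F D R \<and> two_dim_regular_local_subring R F"
    and "pairwise (\<lambda>R S. \<not> R \<subseteq> S \<and> \<not> S \<subseteq> R) \<R>"
  shows "irredundant_Inter F \<R>"
  unfolding irredundant_Inter_def
proof
  interpret F: field F using assms(1) by (simp add: quotient_field_of_def)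
  fix B assume B: "B \<in> \<R>"
  have "overring F D D" using assms(1) by (simp add: overring_def quotient_field_of_def)
  then have D: "F.surface D" using surface_if_two_dim_regular assms(1,2) by blast
  have surf: "F.surface R" "D \<subseteq> R" if "R \<in> \<R>" for R
    using surface_if_two_dim_regular[OF assms(1)] assms(3)[OF that] by (auto simp: overring_def)
  have "\<exists>f\<in>carrier F. f \<notin> B \<and> (\<forall>S\<in>\<R> - {B}. f \<in> S)"
  proof (rule F.element_separating_incomparable_overrings[OF D surf[OF B]])
    fix S assume S: "S \<in> \<R> - {B}"
    then show "F.surface S \<and> D \<subseteq> S \<and> \<not> B \<subseteq> S \<and> \<not> S \<subseteq> B"
      using surf assms(4) B unfolding pairwise_def by blast
  qed
  then obtain f where "f \<in> carrier F" "f \<notin> B" "\<forall>S\<in>\<R> - {B}. f \<in> S" by blast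
  then have "f \<in> ring_Inter F (\<R> - {B})" "f \<notin> ring_Inter F \<R>"
    using B by (auto simp: ring_Inter_def)
  moreover have "ring_Inter F \<R> \<subseteq> ring_Inter F (\<R> - {B})" by (auto simp: ring_Inter_def)
  ultimately show "ring_Inter F \<R> \<subset> ring_Inter F (\<R> - {B})" by blast
qed

end
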